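(* Let $X$ be a cosimplicial space and let $s,s'\ge0$. Then the following diagram, with three horizontal rows and two squares, commutes. Rows: $$(F^{-s}/F^{-s-1})H\operatorname{Tot}X\otimes(F^{-s'}/F^{-s'-1})H\operatorname{Tot}X\xrightarrow{\iota\otimes\iota}E^\infty_{-s}(S_*(X))\otimes E^\infty_{-s'}(S_*(X)),$$ $$(F^{-s-s'}/F^{-s-s'-1})H\operatorname{Tot}(X\times X)\xrightarrow{\iota}E^\infty_{-s-s'}(S_*(X\times X)),$$ $$(F^{-s-s'}/F^{-s-s'-1})H\operatorname{Tot}(E\pi\times_\pi X^{\times2})\xrightarrow{\iota}E^\infty_{-s-s'}(S_*(E\pi\times_\pi X^{\times2})).$$ The left vertical map from the first row to the second is induced on filtration quotients by the external multiplication $H\operatorname{Tot}X\otimes H\operatorname{Tot}X\to H(\operatorname{Tot}X\times\operatorname{Tot}X)\cong H\operatorname{Tot}(X\times X)$, the right vertical map from the first row to the second is the external multiplication of the spectral sequence, and both vertical maps from the second row to the third are induced by the map of cosimplicial spaces $X\times X\to E\pi\times_\pi X^{\times2}$, $(x,x')\mapsto( *,x,x')$.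
   Context: **Basics.** Work over $\mathbb K=\mathbb Z/2$, $\otimes=\otimes_{\mathbb K}$. "Space" means simplicial set. $\pi=\{e,\sigma\}$ is the group of order two; $E\pi$ is the space with $E\pi_q=\pi^{q+1}$ (faces delete, degeneracies repeat entries, diagonal $\pi$-action), and $*=(e,\dots,e)\in E\pi_q$. $\pi$ acts on $X\times X$ by swapping factors. $\mathbb KZ$ is the (levelwise) free $\mathbb K$-module on a space $Z$. For a simplicial $\mathbb K$-module $A$, $N(A)$ is the normalized complex. $S_*(Z)=N(\mathbb KZ)$, $H_*(Z)=H(S_*(Z))$. $\nabla:N(A)\otimes N(B)\to N(A\otimes B)$ is the shuffle map. **Spectral sequence.** For a cosimplicial chain complex $Y$, the conormalization is the second-quadrant bicomplex $C(Y)_{-p,q}=\operatorname{coker}(\bigoplus_{k=1}^p d^k:\bigoplus Y_q^{p-1}\to Y_q^p)$, horizontal differential induced by $d^0$. For a bicomplex $B$, $TB_m=\prod_jB_{j,m-j}$, $F^kTB_m=\prod_{j\le k}B_{j,m-j}$, $T_\ell B=TB/F^{-(\ell+1)}TB$. $E^r(Y)$ is the spectral sequence of the filtered complex $TC(Y)$; $E^\infty_{-s,t}(Y)$ is represented by cycles in $F^{-s}TC(Y)$ of total degree $t-s$, modulo cycles in $F^{-s-1}$ and boundaries lying in $F^{-s}$. $E^\infty_{-s}$ denotes the column $E^\infty_{-s,*}$. **Tot and abutment.** $\operatorname{Tot}X=\operatorname{map}(\Delta^\bullet,X)$: a $q$-simplex is a cosimplicial map $f:\Delta^\bullet\times\Delta^q\to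 X$; likewise for cosimplicial simplicial $\mathbb K$-modules. $f\mapsto\mathbb Kf$ defines $\mathbb K\operatorname{Tot}X\to\operatorname{Tot}\mathbb KX$. The quasi-isomorphism $\phi_\infty:N\operatorname{Tot}V\to TCNV$ sends $f\in(\operatorname{Tot}V)_q$ to $\prod_kf^k(\nabla(\imath_k\otimes\imath_q))$, $\imath_k$ the fundamental simplex of $\Delta^k$. The filtration is $F^{-s}H(\operatorname{Tot}X)=\ker(H(\operatorname{Tot}X)\to H(TCN\mathbb KX)\to H(T_{s-1}CN\mathbb KX))$, where the first map is induced by $N\mathbb K\operatorname{Tot}X\to N\operatorname{Tot}\mathbb KX\xrightarrow{\phi_\infty}TCN\mathbb KX$. The abutment map $\iota:(F^{-s}/F^{-s-1})H\operatorname{Tot}X\hookrightarrow E^\infty_{-s}(S_*(X))$ sends a class to the $E^\infty$-class of a cycle in $F^{-s}TCN\mathbb KX$ representing its image in $H(TCN\mathbb KX)$. **External multiplication in the spectral sequence.** $E^\infty_{-s}(S_*(X))\otimes E^\infty_{-s'}(S_*(X))\to E^\infty_{-s-s'}(S_*(X\times X))$ is induced by the filtered chain maps $$TCN\mathbb KX\otimes TCN\mathbb KX\to T(CN\mathbb KX\otimes CN\mathbb KX)\xrightarrow{AW}TC(N\mathbb KX\otimes N\mathbb KX)\xrightarrow{\nabla}TCN(\mathbb KX\otimes\mathbb KX)=TCS_*(X\times X),$$ where $AW$ is the cosimplicial Alexander–Whitney map $AW(y^p\otimes z^q)=d^{p+q}\cdots d^{p+1}y^p\otimes d^{p-1}\cdots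 d^0z^q$ and tensor products of cosimplicial objects are levelwise. The external multiplication on $H\operatorname{Tot}X$ is the homology cross product followed by the isomorphism $\operatorname{Tot}X\times\operatorname{Tot}X\cong\operatorname{Tot}(X\times X)$.
   Formalization: The Alexander–Whitney formula is not well defined on arbitrary representatives of classes in the cokernel C(Y) (d^1y'⊗z goes to d^1y'⊗d^0z); it is evaluated on the unique representatives, modulo degenerate chains, annihilated by all codegeneracies. *)

theory Defs
  imports Main "HOL-Library.Poly_Mapping" "HOL-Library.Z2" "HOL-Library.Function_Algebras"
begin

section \<open>Modules over the field with two elements\<close>

text \<open>
  A module over \<open>\<int>/2\<close> is an abelian group of exponent two. All modules below are presented as
  subquotients \<open>carr M / rel M\<close> of an ambient abelian group: elements are named by
  representatives in \<open>carr M\<close>, and two representatives are equal in the module iff their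
  difference lies in \<open>rel M\<close>. A map of modules is given by a function on representatives, which
  has to be additive modulo \<open>rel\<close> and to respect \<open>rel\<close>. Since \<open>-1 = 1\<close>, submodules are the
  subsets containing \<open>0\<close> and closed under \<open>+\<close>, and no signs occur.
\<close>

record 'v kmod =
  carr :: "'v set"
  rel :: "'v set"

definition kmodule :: "'v::ab_group_add kmod \<Rightarrow> bool" where
  "kmodule M \<longleftrightarrow>
     0 \<in> rel M \<and> rel M \<subseteq> carr M \<and>
     (\<forall>x\<in>carr M. \<forall>y\<in>carr M. x + y \<in> carr M) \<and>
     (\<forall>x\<in>rel M. \<forall>y\<in>rel M. x + y \<in> rel M) \<and>
     (\<forall>x\<in>carr M. x + x = 0)"

definition zero_kmod :: "'v::ab_group_add kmod" where
  "zero_kmod = \<lparr>carr = {0}, rel = {0}\<rparr>"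

definition eq_in :: "'v::ab_group_add kmod \<Rightarrow> 'v \<Rightarrow> 'v \<Rightarrow> bool" where
  "eq_in M x y \<longleftrightarrow> x - y \<in> rel M"

definition kmod_hom :: "'v::ab_group_add kmod \<Rightarrow> 'w::ab_group_add kmod \<Rightarrow> ('v \<Rightarrow> 'w) \<Rightarrow> bool" where
  "kmod_hom M N f \<longleftrightarrow>
     (\<forall>x\<in>carr M. f x \<in> carr N) \<and>
     (\<forall>x\<in>rel M. f x \<in> rel N) \<and>
     (\<forall>x\<in>carr M. \<forall>y\<in>carr M. eq_in N (f (x + y)) (f x + f y))"

text \<open>The square with rows \<open>t: A \<rightarrow> B\<close> and \<open>b: C \<rightarrow> D\<close> and columns \<open>l: A \<rightarrow> C\<close> and \<open>r: B \<rightarrow> D\<close>.\<close>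

definition commuting_square ::
  "'u::ab_group_add kmod \<Rightarrow> 'v::ab_group_add kmod \<Rightarrow> 'w::ab_group_add kmod \<Rightarrow> 'z::ab_group_add kmod \<Rightarrow>
   ('u \<Rightarrow> 'v) \<Rightarrow> ('u \<Rightarrow> 'w) \<Rightarrow> ('v \<Rightarrow> 'z) \<Rightarrow> ('w \<Rightarrow> 'z) \<Rightarrow> bool" where
  "commuting_square A B C D t l r b \<longleftrightarrow>
     kmodule A \<and> kmodule B \<and> kmodule C \<and> kmodule D \<and>
     kmod_hom A B t \<and> kmod_hom A C l \<and> kmod_hom B D r \<and> kmod_hom C D b \<and>
     (\<forall>x\<in>carr A. eq_in D (r (t x)) (b (l x)))"

inductive_set kspan :: "'v::ab_group_add set \<Rightarrow> 'v set" for S where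
  zero: "0 \<in> kspan S"
| add: "x \<in> S \<Longrightarrow> y \<in> kspan S \<Longrightarrow> x + y \<in> kspan S"

text \<open>
  The free module on a set \<open>A\<close> consists of the \<open>a :: 'a \<Rightarrow>\<^sub>0 bit\<close> with \<open>Poly_Mapping.keys a \<subseteq> A\<close>;
  \<open>kmap f\<close> is the linear map induced by \<open>f\<close> on basis elements.
\<close>

abbreviation gen :: "'a \<Rightarrow> ('a \<Rightarrow>\<^sub>0 bit)" where
  "gen x \<equiv> Poly_Mapping.single x 1"

definition klin :: "('a \<Rightarrow> 'v::ab_group_add) \<Rightarrow> ('a \<Rightarrow>\<^sub>0 bit) \<Rightarrow> 'v" where
  "klin f a = (\<Sum>x\<in>Poly_Mapping.keys a. f x)"

definition kmap :: "('a \<Rightarrow> 'b) \<Rightarrow> ('a \<Rightarrow>\<^sub>0 bit) \<Rightarrow> ('b \<Rightarrow>\<^sub>0 bit)" where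
  "kmap f = klin (\<lambda>x. gen (f x))"

text \<open>The isomorphism from \<open>\<int>/2[A] \<otimes> \<int>/2[B]\<close> to \<open>\<int>/2[A \<times> B]\<close>, as a bilinear map.\<close>

definition kcross :: "('a \<Rightarrow>\<^sub>0 bit) \<Rightarrow> ('b \<Rightarrow>\<^sub>0 bit) \<Rightarrow> ('a \<times> 'b \<Rightarrow>\<^sub>0 bit)" where
  "kcross a b = (\<Sum>x\<in>Poly_Mapping.keys a. \<Sum>y\<in>Poly_Mapping.keys b. gen (x, y))"

definition tensor ::
  "'v::ab_group_add kmod \<Rightarrow> 'w::ab_group_add kmod \<Rightarrow> ('v \<times> 'w \<Rightarrow>\<^sub>0 bit) kmod" where
  "tensor M N =
     \<lparr>carr = {w. Poly_Mapping.keys w \<subseteq> carr M \<times> carr N},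
      rel = kspan
        ({gen (x + x', y) - (gen (x, y) + gen (x', y)) | x x' y. x \<in> carr M \<and> x' \<in> carr M \<and> y \<in> carr N} \<union>
         {gen (x, y + y') - (gen (x, y) + gen (x, y')) | x y y'. x \<in> carr M \<and> y \<in> carr N \<and> y' \<in> carr N} \<union>
         {gen (x, y) | x y. x \<in> rel M \<and> y \<in> carr N} \<union>
         {gen (x, y) | x y. x \<in> carr M \<and> y \<in> rel N})\<rparr>"

definition tensor_map ::
  "('v \<Rightarrow> 'v2) \<Rightarrow> ('w \<Rightarrow> 'w2) \<Rightarrow> ('v \<times> 'w \<Rightarrow>\<^sub>0 bit) \<Rightarrow> ('v2 \<times> 'w2 \<Rightarrow>\<^sub>0 bit)" where
  "tensor_map f g = kmap (map_prod f g)"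

text \<open>The linear map on a tensor product determined by a bilinear map.\<close>

definition tensor_lift :: "('v \<Rightarrow> 'w \<Rightarrow> 'z::ab_group_add) \<Rightarrow> ('v \<times> 'w \<Rightarrow>\<^sub>0 bit) \<Rightarrow> 'z" where
  "tensor_lift \<mu> = klin (\<lambda>(x, y). \<mu> x y)"


section \<open>Spaces and cosimplicial spaces\<close>

text \<open>
  A monotone map \<open>[m] \<rightarrow> [n]\<close> is encoded as the list of its \<open>m + 1\<close> values.
\<close>

definition mono_maps :: "nat \<Rightarrow> nat \<Rightarrow> nat list set" where
  "mono_maps m n = {\<theta>. length \<theta> = Suc m \<and> sorted \<theta> \<and> set \<theta> \<subseteq> {..n}}"

definition id_map :: "nat \<Rightarrow> nat list" where
  "id_map n = [0..<Suc n]"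

definition after :: "'a list \<Rightarrow> nat list \<Rightarrow> 'a list" where
  "after \<theta> \<eta> = map ((!) \<theta>) \<eta>"

text \<open>\<open>cofc n i : [n-1] \<rightarrow> [n]\<close> omits \<open>i\<close>, and \<open>codg n i : [n+1] \<rightarrow> [n]\<close> repeats \<open>i\<close>.\<close>

definition cofc :: "nat \<Rightarrow> nat \<Rightarrow> nat list" where
  "cofc n i = map (\<lambda>k. if k < i then k else Suc k) [0..<n]"

definition codg :: "nat \<Rightarrow> nat \<Rightarrow> nat list" where
  "codg n i = map (\<lambda>k. if k \<le> i then k else k - 1) [0..<Suc (Suc n)]"

text \<open>
  \<open>sop Z n \<theta> : Z\<^sub>n \<rightarrow> Z\<^sub>m\<close> is the operator of \<open>\<theta> : [m] \<rightarrow> [n]\<close>.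
\<close>

record 'a sspace =
  cells :: "nat \<Rightarrow> 'a set"
  sop :: "nat \<Rightarrow> nat list \<Rightarrow> 'a \<Rightarrow> 'a"

definition simplicial_set :: "'a sspace \<Rightarrow> bool" where
  "simplicial_set Z \<longleftrightarrow>
     (\<forall>m n. \<forall>\<theta>\<in>mono_maps m n. \<forall>x\<in>cells Z n. sop Z n \<theta> x \<in> cells Z m) \<and>
     (\<forall>n. \<forall>x\<in>cells Z n. sop Z n (id_map n) x = x) \<and>
     (\<forall>l m n. \<forall>\<theta>\<in>mono_maps m n. \<forall>\<eta>\<in>mono_maps l m. \<forall>x\<in>cells Z n.
        sop Z m \<eta> (sop Z n \<theta> x) = sop Z n (after \<theta> \<eta>) x)"

definition simplicial_map :: "'a sspace \<Rightarrow> 'b sspace \<Rightarrow> (nat \<Rightarrow> 'a \<Rightarrow> 'b) \<Rightarrow> bool" where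
  "simplicial_map Z W h \<longleftrightarrow>
     (\<forall>n. \<forall>x\<in>cells Z n. h n x \<in> cells W n) \<and>
     (\<forall>m n. \<forall>\<theta>\<in>mono_maps m n. \<forall>x\<in>cells Z n. h m (sop Z n \<theta> x) = sop W n \<theta> (h n x))"

text \<open>
  \<open>cop X n \<theta> q : X\<^sup>m\<^sub>q \<rightarrow> X\<^sup>n\<^sub>q\<close> is the cosimplicial operator of \<open>\<theta> : [m] \<rightarrow> [n]\<close>.
\<close>

record 'a cospace =
  lev :: "nat \<Rightarrow> 'a sspace"
  cop :: "nat \<Rightarrow> nat list \<Rightarrow> nat \<Rightarrow> 'a \<Rightarrow> 'a"

definition cosimplicial_space :: "'a cospace \<Rightarrow> bool" where
  "cosimplicial_space X \<longleftrightarrow>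
     (\<forall>p. simplicial_set (lev X p)) \<and>
     (\<forall>m n. \<forall>\<theta>\<in>mono_maps m n. simplicial_map (lev X m) (lev X n) (cop X n \<theta>)) \<and>
     (\<forall>n q. \<forall>x\<in>cells (lev X n) q. cop X n (id_map n) q x = x) \<and>
     (\<forall>l m n q. \<forall>\<theta>\<in>mono_maps m n. \<forall>\<eta>\<in>mono_maps l m. \<forall>x\<in>cells (lev X l) q.
        cop X n \<theta> q (cop X m \<eta> q x) = cop X n (after \<theta> \<eta>) q x)"

definition cosimplicial_map :: "'a cospace \<Rightarrow> 'b cospace \<Rightarrow> (nat \<Rightarrow> nat \<Rightarrow> 'a \<Rightarrow> 'b) \<Rightarrow> bool" where
  "cosimplicial_map X Y h \<longleftrightarrow>
     (\<forall>p. simplicial_map (lev X p) (lev Y p) (h p)) \<and>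
     (\<forall>m n q. \<forall>\<theta>\<in>mono_maps m n. \<forall>x\<in>cells (lev X m) q. h n q (cop X n \<theta> q x) = cop Y n \<theta> q (h m q x))"

definition const_co :: "'a sspace \<Rightarrow> 'a cospace" where
  "const_co Z = \<lparr>lev = (\<lambda>p. Z), cop = (\<lambda>n \<theta> q x. x)\<rparr>"

definition sprod :: "'a sspace \<Rightarrow> 'b sspace \<Rightarrow> ('a \<times> 'b) sspace" where
  "sprod Z W = \<lparr>cells = (\<lambda>n. cells Z n \<times> cells W n), sop = (\<lambda>n \<theta>. map_prod (sop Z n \<theta>) (sop W n \<theta>))\<rparr>"

definition cprod :: "'a cospace \<Rightarrow> 'b cospace \<Rightarrow> ('a \<times> 'b) cospace" where
  "cprod X Y = \<lparr>lev = (\<lambda>p. sprod (lev X p) (lev Y p)),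
                cop = (\<lambda>n \<theta> q. map_prod (cop X n \<theta> q) (cop Y n \<theta> q))\<rparr>"

definition Simplex :: "nat \<Rightarrow> nat list sspace" where
  "Simplex n = \<lparr>cells = (\<lambda>q. mono_maps q n), sop = (\<lambda>q \<theta> u. after u \<theta>)\<rparr>"

definition Simplex_co :: "nat list cospace" where
  "Simplex_co = \<lparr>lev = Simplex, cop = (\<lambda>n \<theta> q u. after \<theta> u)\<rparr>"


section \<open>Tot\<close>

text \<open>
  Cosimplicial maps \<open>f : \<Delta>\<^sup>\<bullet> \<times> \<Delta>\<^sup>q \<rightarrow> X\<close> are HOL functions taking the fixed value \<open>e\<close> outside of
  their domain. For spaces \<open>e = undefined\<close>; for modules \<open>e = 0\<close>, so that \<open>Tot\<close> is a module under
  pointwise addition.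
\<close>

type_synonym 'a tot = "nat \<Rightarrow> nat \<Rightarrow> nat list \<times> nat list \<Rightarrow> 'a"

definition tot_dom :: "nat \<Rightarrow> (nat list \<times> nat list) cospace" where
  "tot_dom q = cprod Simplex_co (const_co (Simplex q))"

definition on_dom :: "nat \<Rightarrow> 'a \<Rightarrow> 'a tot \<Rightarrow> 'a tot" where
  "on_dom q e f = (\<lambda>p k w. if w \<in> cells (lev (tot_dom q) p) k then f p k w else e)"

definition Tot_ext :: "'a \<Rightarrow> 'a cospace \<Rightarrow> 'a tot sspace" where
  "Tot_ext e X =
     \<lparr>cells = (\<lambda>q. {f. cosimplicial_map (tot_dom q) X f \<and> on_dom q e f = f}),
      sop = (\<lambda>q \<theta> f. on_dom (length \<theta> - 1) e (\<lambda>p k (u, v). f p k (u, after \<theta> v)))\<rparr>"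

abbreviation Tot :: "'a cospace \<Rightarrow> 'a tot sspace" where
  "Tot \<equiv> Tot_ext undefined"

abbreviation TotK :: "'v::ab_group_add cospace \<Rightarrow> 'v tot sspace" where
  "TotK \<equiv> Tot_ext 0"

definition Tot_map :: "(nat \<Rightarrow> nat \<Rightarrow> 'a \<Rightarrow> 'b) \<Rightarrow> nat \<Rightarrow> 'a tot \<Rightarrow> 'b tot" where
  "Tot_map h q f = on_dom q undefined (\<lambda>p k w. h p k (f p k w))"

definition Tot_prod_iso :: "nat \<Rightarrow> 'a tot \<times> 'b tot \<Rightarrow> ('a \<times> 'b) tot" where
  "Tot_prod_iso q = (\<lambda>(f, g). on_dom q undefined (\<lambda>p k w. (f p k w, g p k w)))"


section \<open>Chain complexes\<close>

record 'v complex =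
  chain :: "int \<Rightarrow> 'v kmod"
  bdry :: "int \<Rightarrow> 'v \<Rightarrow> 'v"

definition homology :: "'v::ab_group_add complex \<Rightarrow> int \<Rightarrow> 'v kmod" where
  "homology D m =
     \<lparr>carr = {x \<in> carr (chain D m). bdry D m x \<in> rel (chain D (m - 1))},
      rel = {bdry D (m + 1) y + r | y r. y \<in> carr (chain D (m + 1)) \<and> r \<in> rel (chain D m)}\<rparr>"

definition KS :: "'a sspace \<Rightarrow> ('a \<Rightarrow>\<^sub>0 bit) sspace" where
  "KS Z = \<lparr>cells = (\<lambda>q. {a. Poly_Mapping.keys a \<subseteq> cells Z q}), sop = (\<lambda>q \<theta>. kmap (sop Z q \<theta>))\<rparr>"

definition KC :: "'a cospace \<Rightarrow> ('a \<Rightarrow>\<^sub>0 bit) cospace" where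
  "KC X = \<lparr>lev = (\<lambda>p. KS (lev X p)), cop = (\<lambda>n \<theta> q. kmap (cop X n \<theta> q))\<rparr>"

text \<open>Normalization of a simplicial module is the quotient by the degenerate elements.\<close>

definition Norm :: "'v::ab_group_add sspace \<Rightarrow> 'v complex" where
  "Norm A =
     \<lparr>chain = (\<lambda>i. if i < 0 then zero_kmod else
        (let q = nat i in
          \<lparr>carr = cells A q,
           rel = kspan (\<Union>k\<in>{..<q}. sop A (q - 1) (codg (q - 1) k) ` cells A (q - 1))\<rparr>)),
      bdry = (\<lambda>i x. if i \<le> 0 then 0 else
        (let q = nat i in \<Sum>k\<le>q. sop A q (cofc q k) x))\<rparr>"

definition S_space :: "'a sspace \<Rightarrow> ('a \<Rightarrow>\<^sub>0 bit) complex" where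
  "S_space Z = Norm (KS Z)"

record 'v cocomplex =
  clev :: "nat \<Rightarrow> 'v complex"
  ccop :: "nat \<Rightarrow> nat list \<Rightarrow> int \<Rightarrow> 'v \<Rightarrow> 'v"

definition Norm_co :: "'v::ab_group_add cospace \<Rightarrow> 'v cocomplex" where
  "Norm_co V = \<lparr>clev = (\<lambda>p. Norm (lev V p)), ccop = (\<lambda>n \<theta> i. cop V n \<theta> (nat i))\<rparr>"

definition S_co :: "'a cospace \<Rightarrow> ('a \<Rightarrow>\<^sub>0 bit) cocomplex" where
  "S_co X = Norm_co (KC X)"

text \<open>
  The shuffle map \<open>Z\<^sub>p \<times> W\<^sub>q \<rightarrow> (Z \<times> W)\<^sub>p\<^sub>+\<^sub>q\<close> on free modules. A \<open>(p,q)\<close>-shuffle \<open>(\<mu>, \<nu>)\<close> is given by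
  the subset \<open>\<mu> \<subseteq> {0..<p+q}\<close>, and \<open>\<nu>\<close> is its complement. The list
  \<open>collapse (p+q) \<mu> : [p+q] \<rightarrow> [p]\<close> increases exactly after the positions in \<open>\<mu>\<close>, i.e. it is the
  operator of the iterated degeneracy \<open>s\<^sub>\<nu>\<close>; likewise for \<open>\<nu>\<close>.
\<close>

definition collapse :: "nat \<Rightarrow> nat set \<Rightarrow> nat list" where
  "collapse n \<mu> = map (\<lambda>i. card (\<mu> \<inter> {..<i})) [0..<Suc n]"

definition shuffle ::
  "'a sspace \<Rightarrow> 'b sspace \<Rightarrow> nat \<Rightarrow> nat \<Rightarrow> ('a \<Rightarrow>\<^sub>0 bit) \<Rightarrow> ('b \<Rightarrow>\<^sub>0 bit) \<Rightarrow> ('a \<times> 'b \<Rightarrow>\<^sub>0 bit)" where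
  "shuffle Z W p q a b =
     (\<Sum>\<mu> | \<mu> \<subseteq> {..<p + q} \<and> card \<mu> = p.
        kcross (kmap (sop Z p (collapse (p + q) \<mu>)) a)
               (kmap (sop W q (collapse (p + q) ({..<p + q} - \<mu>))) b))"


section \<open>Bicomplexes and the spectral sequence\<close>

record 'v bicomplex =
  bimod :: "int \<Rightarrow> int \<Rightarrow> 'v kmod"
  hdiff :: "int \<Rightarrow> int \<Rightarrow> 'v \<Rightarrow> 'v"
  vdiff :: "int \<Rightarrow> int \<Rightarrow> 'v \<Rightarrow> 'v"

definition conorm :: "'v::ab_group_add cocomplex \<Rightarrow> 'v bicomplex" where
  "conorm Y =
     \<lparr>bimod = (\<lambda>j q. if j > 0 then zero_kmod else
        (let p = nat (- j) in
          \<lparr>carr = carr (chain (clev Y p) q),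
           rel = kspan (rel (chain (clev Y p) q) \<union>
             (\<Union>k\<in>{1..p}. ccop Y p (cofc p k) q ` carr (chain (clev Y (p - 1)) q)))\<rparr>)),
      hdiff = (\<lambda>j q y. if j > 0 then 0 else
        (let p = nat (- j) in ccop Y (Suc p) (cofc (Suc p) 0) q y)),
      vdiff = (\<lambda>j q y. if j > 0 then 0 else bdry (clev Y (nat (- j))) q y)\<rparr>"

definition total :: "'v::ab_group_add bicomplex \<Rightarrow> (int \<Rightarrow> 'v) complex" where
  "total B =
     \<lparr>chain = (\<lambda>m. \<lparr>carr = {y. \<forall>j. y j \<in> carr (bimod B j (m - j))},
                    rel = {y. \<forall>j. y j \<in> rel (bimod B j (m - j))}\<rparr>),
      bdry = (\<lambda>m y j. hdiff B (j + 1) (m - (j + 1)) (y (j + 1)) + vdiff B j (m - j) (y j))\<rparr>"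

definition filt :: "'v::ab_group_add bicomplex \<Rightarrow> int \<Rightarrow> int \<Rightarrow> (int \<Rightarrow> 'v) set" where
  "filt B k m = {y \<in> carr (chain (total B) m). \<forall>j>k. y j \<in> rel (bimod B j (m - j))}"

definition total_trunc :: "int \<Rightarrow> 'v::ab_group_add bicomplex \<Rightarrow> (int \<Rightarrow> 'v) complex" where
  "total_trunc l B =
     \<lparr>chain = (\<lambda>m. \<lparr>carr = carr (chain (total B) m), rel = filt B (- (l + 1)) m\<rparr>),
      bdry = bdry (total B)\<rparr>"

text \<open>
  \<open>TC Y\<close> is the total complex whose homology is the abutment, and \<open>E_inf Y s t\<close> is the term in
  bidegree \<open>(-s, t)\<close>.
\<close>

abbreviation TC :: "'v::ab_group_add cocomplex \<Rightarrow> (int \<Rightarrow> 'v) complex" where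
  "TC Y \<equiv> total (conorm Y)"

definition E_inf :: "'v::ab_group_add cocomplex \<Rightarrow> int \<Rightarrow> int \<Rightarrow> (int \<Rightarrow> 'v) kmod" where
  "E_inf Y s t = (let m = t - s in
     \<lparr>carr = filt (conorm Y) (- s) m \<inter> carr (homology (TC Y) m),
      rel = {x + b | x b. x \<in> filt (conorm Y) (- s - 1) m \<inter> carr (homology (TC Y) m) \<and>
                          b \<in> rel (homology (TC Y) m) \<inter> filt (conorm Y) (- s) m}\<rparr>)"

definition TC_map :: "(nat \<Rightarrow> nat \<Rightarrow> 'a \<Rightarrow> 'b) \<Rightarrow> int \<Rightarrow>
    (int \<Rightarrow> 'a \<Rightarrow>\<^sub>0 bit) \<Rightarrow> (int \<Rightarrow> 'b \<Rightarrow>\<^sub>0 bit)" where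
  "TC_map h m y = (\<lambda>j. if j > 0 then 0 else kmap (h (nat (- j)) (nat (m - j))) (y j))"


section \<open>The abutment\<close>

definition K_to_TotK :: "nat \<Rightarrow> ('a tot \<Rightarrow>\<^sub>0 bit) \<Rightarrow> ('a \<Rightarrow>\<^sub>0 bit) tot" where
  "K_to_TotK q = klin (\<lambda>f. on_dom q 0 (\<lambda>p k w. gen (f p k w)))"

definition phi_inf :: "nat \<Rightarrow> 'v::ab_group_add tot \<Rightarrow> (int \<Rightarrow> 'v)" where
  "phi_inf q f = (\<lambda>j. if j > 0 then 0 else
     (let k = nat (- j) in
       klin (f k (k + q)) (shuffle (Simplex k) (Simplex q) k q (gen (id_map k)) (gen (id_map q)))))"

definition to_TC :: "int \<Rightarrow> ('a tot \<Rightarrow>\<^sub>0 bit) \<Rightarrow> (int \<Rightarrow> 'a \<Rightarrow>\<^sub>0 bit)" where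
  "to_TC m a = phi_inf (nat m) (K_to_TotK (nat m) a)"

text \<open>\<open>F_HTot X s m\<close> is the \<open>(-s)\<close>-th filtration submodule of the homology of \<open>Tot X\<close> in degree \<open>m\<close>.\<close>

definition F_HTot :: "'a cospace \<Rightarrow> int \<Rightarrow> int \<Rightarrow> ('a tot \<Rightarrow>\<^sub>0 bit) kmod" where
  "F_HTot X s m =
     \<lparr>carr = {a \<in> carr (homology (S_space (Tot X)) m).
               to_TC m a \<in> rel (homology (total_trunc (s - 1) (conorm (S_co X))) m)},
      rel = rel (homology (S_space (Tot X)) m)\<rparr>"

definition gr_HTot :: "'a cospace \<Rightarrow> int \<Rightarrow> int \<Rightarrow> ('a tot \<Rightarrow>\<^sub>0 bit) kmod" where
  "gr_HTot X s m = \<lparr>carr = carr (F_HTot X s m), rel = carr (F_HTot X (s + 1) m)\<rparr>"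

definition abut :: "'a cospace \<Rightarrow> int \<Rightarrow> int \<Rightarrow> ('a tot \<Rightarrow>\<^sub>0 bit) \<Rightarrow> (int \<Rightarrow> 'a \<Rightarrow>\<^sub>0 bit)" where
  "abut X s m a =
     (SOME w. w \<in> filt (conorm (S_co X)) (- s) m \<inter> carr (homology (TC (S_co X)) m) \<and>
              eq_in (homology (TC (S_co X)) m) w (to_TC m a))"


section \<open>External multiplications\<close>

definition HTot_mult :: "'a cospace \<Rightarrow> 'b cospace \<Rightarrow> int \<Rightarrow> int \<Rightarrow>
    ('a tot \<Rightarrow>\<^sub>0 bit) \<Rightarrow> ('b tot \<Rightarrow>\<^sub>0 bit) \<Rightarrow> (('a \<times> 'b) tot \<Rightarrow>\<^sub>0 bit)" where
  "HTot_mult X X' m m' a b =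
     kmap (Tot_prod_iso (nat (m + m'))) (shuffle (Tot X) (Tot X') (nat m) (nat m') a b)"

text \<open>
  The Alexander--Whitney formula does not respect arbitrary representatives in the cokernel
  defining \<open>conorm\<close>: already \<open>d\<^sup>1 y \<otimes> z\<close> with \<open>y\<close>, \<open>z\<close> in cosimplicial degree \<open>0\<close> goes to
  \<open>d\<^sup>1 y \<otimes> d\<^sup>0 z\<close>, which need not be in the image of \<open>d\<^sup>1\<close>. It has to be evaluated on the
  representatives annihilated by all codegeneracies; modulo the relations of \<open>Y\<close>, each class of
  the cokernel contains exactly one of these. The elements \<open>phi_inf q f\<close> consist of such representatives.
\<close>

definition conorm_rep :: "'v::ab_group_add cocomplex \<Rightarrow> nat \<Rightarrow> int \<Rightarrow> 'v \<Rightarrow> 'v" where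
  "conorm_rep Y p i y =
     (SOME y'. y' \<in> carr (chain (clev Y p) i) \<and>
        (\<forall>k<p. ccop Y (p - 1) (codg (p - 1) k) i y' \<in> rel (chain (clev Y (p - 1)) i)) \<and>
        eq_in (bimod (conorm Y) (- int p) i) y' y)"

text \<open>
  \<open>AW_left Y p q\<close> is \<open>d\<^sup>p\<^sup>+\<^sup>q \<cdots> d\<^sup>p\<^sup>+\<^sup>1 : Y\<^sup>p \<rightarrow> Y\<^sup>p\<^sup>+\<^sup>q\<close>, and \<open>AW_right Y p q\<close> is
  \<open>d\<^sup>p\<^sup>-\<^sup>1 \<cdots> d\<^sup>0 : Y\<^sup>q \<rightarrow> Y\<^sup>p\<^sup>+\<^sup>q\<close> (the rightmost factor is applied first).
\<close>

definition AW_left :: "'v cocomplex \<Rightarrow> nat \<Rightarrow> nat \<Rightarrow> int \<Rightarrow> 'v \<Rightarrow> 'v" where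
  "AW_left Y p q i = fold (\<lambda>k. ccop Y k (cofc k k) i) [p + 1..<p + q + 1]"

definition AW_right :: "'v cocomplex \<Rightarrow> nat \<Rightarrow> nat \<Rightarrow> int \<Rightarrow> 'v \<Rightarrow> 'v" where
  "AW_right Y p q i = fold (\<lambda>k. ccop Y (q + k + 1) (cofc (q + k + 1) k) i) [0..<p]"

text \<open>
  The composite \<open>TC \<otimes> TC \<rightarrow> T(C \<otimes> C) \<rightarrow> TC(N \<otimes> N) \<rightarrow> TCN\<close> as a bilinear map on total degrees
  \<open>m\<close> and \<open>m'\<close>.
\<close>

definition TC_mult :: "'a cospace \<Rightarrow> 'b cospace \<Rightarrow> int \<Rightarrow> int \<Rightarrow>
    (int \<Rightarrow> 'a \<Rightarrow>\<^sub>0 bit) \<Rightarrow> (int \<Rightarrow> 'b \<Rightarrow>\<^sub>0 bit) \<Rightarrow> (int \<Rightarrow> 'a \<times> 'b \<Rightarrow>\<^sub>0 bit)" where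
  "TC_mult X X' m m' y z = (\<lambda>j. if j > 0 then 0 else
     (let n = nat (- j) in
       \<Sum>p\<le>n. let p' = n - p; i = m + int p; i' = m' + int p' in
         shuffle (lev X n) (lev X' n) (nat i) (nat i')
           (AW_left (S_co X) p p' i (conorm_rep (S_co X) p i (y (- int p))))
           (AW_right (S_co X') p p' i' (conorm_rep (S_co X') p' i' (z (- int p'))))))"


section \<open>The quotient by the group of order two\<close>

text \<open>The group \<open>\<pi> = {e, \<sigma>}\<close> is \<open>bool\<close> with \<open>e = False\<close>, \<open>\<sigma> = True\<close> and exclusive or as product.\<close>

definition Epi :: "bool list sspace" where
  "Epi = \<lparr>cells = (\<lambda>q. {g. length g = Suc q}), sop = (\<lambda>q \<theta> g. after g \<theta>)\<rparr>"

definition Epi_base :: "nat \<Rightarrow> bool list" where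
  "Epi_base q = replicate (Suc q) False"

definition pi_act :: "bool \<Rightarrow> bool list \<times> 'a \<times> 'a \<Rightarrow> bool list \<times> 'a \<times> 'a" where
  "pi_act b = (\<lambda>(g, x, x'). (map (\<lambda>c. b \<noteq> c) g, if b then (x', x) else (x, x')))"

definition pi_orbit :: "bool list \<times> 'a \<times> 'a \<Rightarrow> (bool list \<times> 'a \<times> 'a) set" where
  "pi_orbit z = range (\<lambda>b. pi_act b z)"

definition Epi_square :: "'a cospace \<Rightarrow> (bool list \<times> 'a \<times> 'a) set cospace" where
  "Epi_square X = (let W = cprod (const_co Epi) (cprod X X) in
     \<lparr>lev = (\<lambda>p. \<lparr>cells = (\<lambda>q. pi_orbit ` cells (lev W p) q), sop = (\<lambda>q \<theta>. image (sop (lev W p) q \<theta>))\<rparr>),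
      cop = (\<lambda>n \<theta> q. image (cop W n \<theta> q))\<rparr>)"

definition Epi_incl :: "nat \<Rightarrow> nat \<Rightarrow> 'a \<times> 'a \<Rightarrow> (bool list \<times> 'a \<times> 'a) set" where
  "Epi_incl p q = (\<lambda>(x, x'). pi_orbit (Epi_base q, x, x'))"

end

theory Submission
  imports Defs
begin

text \<open>
  The image of a class under \<open>abut\<close> is represented by any cycle in filtration \<open>s\<close> of the total complex
  that is homologous to the image of the class under \<open>to_TC\<close>. Two such cycles differ by a boundary
  inside the filtration, which is zero in the spectral sequence. Each square therefore commutes as
  soon as its two composites are represented by cycles that are homologous in the total complex, and
  filtrations add up under the product.

  For the second square this is immediate, because \<open>to_TC\<close> is natural in the cosimplicial space
  (\<open>abut_natural\<close>); one only has to check that the orbits form a cosimplicial space and that the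
  inclusion is a cosimplicial map.

  For the first square, \<open>to_TC\<close> has to be multiplicative in homology
  (\<open>HTot_mult_homologous_TC_mult\<close>). The map \<open>to_TC\<close> pairs a chain on \<open>Tot X\<close> with the fundamental
  simplices of all \<open>\<Delta>\<^sup>n\<close>, by the shuffle map followed by evaluation \<open>\<Delta>\<^sup>n \<times> Tot X \<rightarrow> X\<^sup>n\<close>. Evaluating two chains at
  independent simplices pairs chains on \<open>Tot X \<times> Tot X\<close> with chains on \<open>\<Delta>\<^sup>n \<times> \<Delta>\<^sup>n\<close>. The external product
  in the homology of \<open>Tot\<close> comes from the diagonal simplex of \<open>\<Delta>\<^sup>n \<times> \<Delta>\<^sup>n\<close>
  (\<open>pairing2_diagonal\<close>). The product of the spectral sequence comes from the shuffle of the
  Alexander--Whitney diagonal of \<open>\<Delta>\<^sup>n\<close> (\<open>pairing2_AW_diagonal\<close>); this uses that two shuffle products of two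
  chains each can be interchanged (\<open>shuffle_interchange\<close>). The two chains on \<open>\<Delta>\<^sup>n \<times> \<Delta>\<^sup>n\<close>, as \<open>n\<close>
  varies, are connected by a natural chain homotopy, which is constructed by acyclic models
  (\<open>family_bd_EZ_homotopy\<close>). Pairing the homotopy with a product of cycles gives the required
  homology.

  The product of the spectral sequence is well defined on homology by the Leibniz rules for the
  shuffle map (\<open>shuffle_Leibniz\<close>) and for front and back faces (\<open>Alexander_Whitney_Leibniz\<close>). The
  second one needs the sum of all cofaces in place of \<open>d\<^sup>0\<close>. On the representatives that all
  codegeneracies annihilate this makes no difference modulo relations, and such representatives are
  unique modulo degenerate chains (\<open>conorm_rep_unique\<close>). The chain level identities for the shuffle
  map are proved by recursion on lists of vertices, and carried over to all simplicial sets by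
  naturality.
\<close>

section \<open>Linear algebra over the field with two elements\<close>

text \<open>
  The ambient groups of all modules in the theorem have exponent two, not only the modules themselves.
  As a type class this makes signs disappear from all calculations.
\<close>

class exponent_two = ab_group_add +
  assumes add_self [simp]: "x + x = 0"
begin

lemma uminus_eq [simp]: "- x = x"
  using add_self minus_unique by blast

lemma minus_eq [simp]: "x - y = x + y"
  by (simp add: diff_conv_add_uminus del: add_uminus_conv_diff)

lemma add_self_left [simp]: "x + (x + y) = y"
  by (simp flip: add.assoc)

end

instance bit :: exponent_two
  by standard simp

instance poly_mapping :: (type, exponent_two) exponent_two
  by standard (rule poly_mapping_eqI, simp add: lookup_add)

instance "fun" :: (type, exponent_two) exponent_two
  by standard (simp add: fun_eq_iff)

lemma additive_zero:
  fixes F :: "'v::ab_group_add \<Rightarrow> 'w::ab_group_add"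
  assumes "\<And>x y. F (x + y) = F x + F y"
  shows "F 0 = 0"
  using assms[of 0 0] by simp

lemma additive_sum:
  fixes F :: "'v::ab_group_add \<Rightarrow> 'w::ab_group_add"
  assumes "\<And>x y. F (x + y) = F x + F y"
  shows "F (sum g A) = (\<Sum>x\<in>A. F (g x))"
  by (induction A rule: infinite_finite_induct) (simp_all add: assms additive_zero)

subsection \<open>Linear extension\<close>

lemma keys_add_bit:
  fixes a b :: "'a \<Rightarrow>\<^sub>0 bit"
  shows "Poly_Mapping.keys (a + b) =
    (Poly_Mapping.keys a - Poly_Mapping.keys b) \<union> (Poly_Mapping.keys b - Poly_Mapping.keys a)"
  by (auto simp: in_keys_iff lookup_add)

text \<open>
  A basis element that occurs in both \<open>a\<close> and \<open>b\<close> does not occur in \<open>a + b\<close>; its two images on the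
  right-hand side cancel.
\<close>

lemma klin_add:
  fixes f :: "'a \<Rightarrow> 'v::exponent_two"
  shows "klin f (a + b) = klin f a + klin f b"
proof -
  let ?A = "Poly_Mapping.keys a" and ?B = "Poly_Mapping.keys b"
  have "sum f ?A = sum f (?A - ?B) + sum f (?A \<inter> ?B)"
    "sum f ?B = sum f (?B - ?A) + sum f (?A \<inter> ?B)"
    by (subst sum.union_disjoint[symmetric]; auto intro: sum.cong simp: Un_Diff_Int Int_commute)+
  moreover have "sum f ((?A - ?B) \<union> (?B - ?A)) = sum f (?A - ?B) + sum f (?B - ?A)"
    by (rule sum.union_disjoint) auto
  ultimately show ?thesis
    by (simp add: klin_def keys_add_bit ac_simps)
qed

lemma klin_zero [simp]: "klin f 0 = 0"
  by (simp add: klin_def)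

lemma klin_gen [simp]: "klin f (gen x) = f x"
  by (simp add: klin_def)

lemma klin_cong:
  "a = b \<Longrightarrow> (\<And>x. x \<in> Poly_Mapping.keys b \<Longrightarrow> f x = g x) \<Longrightarrow> klin f a = klin g b"
  by (simp add: klin_def)

lemma klin_fun_add: "klin (\<lambda>x. f x + g x) a = klin f a + klin g a"
  by (simp add: klin_def sum.distrib)

lemma klin_fun_zero [simp]: "klin (\<lambda>x. 0) a = 0"
  by (simp add: klin_def)

lemma klin_compose:
  fixes F :: "'v::ab_group_add \<Rightarrow> 'w::ab_group_add"
  assumes "\<And>x y. F (x + y) = F x + F y"
  shows "F (klin f a) = klin (\<lambda>x. F (f x)) a"
  by (simp add: klin_def additive_sum assms)

lemma klin_klin:
  fixes f :: "'a \<Rightarrow> 'v::exponent_two"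
  shows "klin f (klin g a) = klin (\<lambda>x. klin f (g x)) a"
  by (rule klin_compose) (rule klin_add)

lemma klin_gen_self: "klin (\<lambda>x. gen x) a = a"
proof (rule poly_mapping_eqI)
  fix y
  have "Poly_Mapping.lookup (klin gen a) y = (\<Sum>x\<in>Poly_Mapping.keys a. Poly_Mapping.lookup (gen x) y)"
    unfolding klin_def by (rule lookup_sum)
  also have "\<dots> = (\<Sum>x\<in>Poly_Mapping.keys a. if x = y then 1 else 0)"
    by (intro sum.cong) (auto simp: lookup_single when_def)
  also have "\<dots> = Poly_Mapping.lookup a y"
    by (simp add: sum.delta in_keys_iff)
  finally show "Poly_Mapping.lookup (klin gen a) y = Poly_Mapping.lookup a y" .
qed

lemma kmap_add [simp]: "kmap f (a + b) = kmap f a + kmap f b"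
  by (simp add: kmap_def klin_add)

lemma kmap_zero [simp]: "kmap f 0 = 0"
  by (simp add: kmap_def)

lemma kmap_gen [simp]: "kmap f (gen x) = gen (f x)"
  by (simp add: kmap_def)

lemma kmap_sum: "kmap f (sum g A) = (\<Sum>x\<in>A. kmap f (g x))"
  by (rule additive_sum) (rule kmap_add)

lemma kmap_cong:
  "a = b \<Longrightarrow> (\<And>x. x \<in> Poly_Mapping.keys b \<Longrightarrow> f x = g x) \<Longrightarrow> kmap f a = kmap g b"
  unfolding kmap_def by (rule klin_cong) simp_all

lemma klin_kmap:
  fixes f :: "'b \<Rightarrow> 'v::exponent_two"
  shows "klin f (kmap g a) = klin (\<lambda>x. f (g x)) a"
  by (simp add: kmap_def klin_klin)

lemma kmap_klin: "kmap f (klin g a) = klin (\<lambda>x. kmap f (g x)) a"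
  by (simp add: kmap_def klin_klin)

lemma kmap_kmap: "kmap f (kmap g a) = kmap (\<lambda>x. f (g x)) a"
  by (simp add: kmap_def klin_kmap[unfolded kmap_def])

lemma kmap_id:
  assumes "\<And>x. x \<in> Poly_Mapping.keys a \<Longrightarrow> f x = x"
  shows "kmap f a = a"
proof -
  have "klin (\<lambda>x. gen (f x)) a = klin (\<lambda>x. gen x) a"
    by (rule klin_cong) (simp_all add: assms)
  then show ?thesis by (simp only: kmap_def klin_gen_self)
qed

lemma keys_klin: "Poly_Mapping.keys (klin f a) \<subseteq> (\<Union>x\<in>Poly_Mapping.keys a. Poly_Mapping.keys (f x))"
  unfolding klin_def by (rule order_trans[OF keys_sum]) simp

lemma keys_kmap: "Poly_Mapping.keys (kmap f a) \<subseteq> f ` Poly_Mapping.keys a"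
  unfolding kmap_def by (rule order_trans[OF keys_klin]) auto

lemma kcross_klin: "kcross a b = klin (\<lambda>x. klin (\<lambda>y. gen (x, y)) b) a"
  by (simp add: kcross_def klin_def)

lemma kcross_add_left: "kcross (a + a') b = kcross a b + kcross a' b"
  by (simp add: kcross_klin klin_add)

lemma kcross_add_right: "kcross a (b + b') = kcross a b + kcross a b'"
  by (simp add: kcross_klin klin_add klin_fun_add)

lemma kcross_gen [simp]: "kcross (gen x) (gen y) = gen (x, y)"
  by (simp add: kcross_klin)

lemma kcross_zero [simp]: "kcross 0 b = 0" "kcross a 0 = 0"
  by (simp_all add: kcross_klin)

subsection \<open>Submodules and spans\<close>

definition submodule :: "'v::ab_group_add set \<Rightarrow> bool" where
  "submodule S \<longleftrightarrow> 0 \<in> S \<and> (\<forall>x\<in>S. \<forall>y\<in>S. x + y \<in> S)"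

lemma submodule_zero: "submodule S \<Longrightarrow> 0 \<in> S"
  by (simp add: submodule_def)

lemma submodule_add: "submodule S \<Longrightarrow> x \<in> S \<Longrightarrow> y \<in> S \<Longrightarrow> x + y \<in> S"
  by (simp add: submodule_def)

lemma submodule_sum: "submodule S \<Longrightarrow> (\<And>i. i \<in> I \<Longrightarrow> f i \<in> S) \<Longrightarrow> sum f I \<in> S"
  by (induction I rule: infinite_finite_induct) (auto simp: submodule_def)

lemma submodule_klin: "submodule S \<Longrightarrow> (\<And>x. x \<in> Poly_Mapping.keys a \<Longrightarrow> f x \<in> S) \<Longrightarrow> klin f a \<in> S"
  unfolding klin_def by (rule submodule_sum)

lemma submodule_cong:
  fixes x y :: "'v::exponent_two"
  assumes "submodule S" "x + y \<in> S"
  shows "x \<in> S \<longleftrightarrow> y \<in> S"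
  using submodule_add[OF assms(1) _ assms(2)] by (metis add.commute add_self_left)

lemma submodule_trans:
  fixes x y z :: "'v::exponent_two"
  assumes "submodule S" "x + y \<in> S" "y + z \<in> S"
  shows "x + z \<in> S"
proof -
  have "(x + y) + (y + z) \<in> S" using assms by (rule submodule_add)
  then show ?thesis by (simp add: add.assoc)
qed

lemma kspan_base: "x \<in> S \<Longrightarrow> x \<in> kspan S"
  using kspan.add[OF _ kspan.zero, of x S] by simp

lemma submodule_kspan: "submodule (kspan S)"
proof -
  have "x + y \<in> kspan S" if "x \<in> kspan S" "y \<in> kspan S" for x y
    using that by (induction rule: kspan.induct) (auto simp: add.assoc intro: kspan.add)
  then show ?thesis by (simp add: submodule_def kspan.zero)
qed

lemma kspan_image:
  fixes F :: "'v::ab_group_add \<Rightarrow> 'w::ab_group_add"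
  assumes "\<And>x y. F (x + y) = F x + F y" "submodule T" "\<And>x. x \<in> S \<Longrightarrow> F x \<in> T" "x \<in> kspan S"
  shows "F x \<in> T"
  using assms(4)
  by (induction rule: kspan.induct)
     (auto simp: assms(1,3) additive_zero[of F] intro: submodule_add submodule_zero assms(2))

definition free_on :: "'a set \<Rightarrow> ('a \<Rightarrow>\<^sub>0 bit) set" where
  "free_on A = {a. Poly_Mapping.keys a \<subseteq> A}"

lemma submodule_free_on: "submodule (free_on A)"
  by (auto simp: submodule_def free_on_def keys_add_bit)

lemma gen_in_free_on [simp]: "gen x \<in> free_on A \<longleftrightarrow> x \<in> A"
  by (simp add: free_on_def)

lemma free_on_keys: "a \<in> free_on A \<Longrightarrow> x \<in> Poly_Mapping.keys a \<Longrightarrow> x \<in> A"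
  by (auto simp: free_on_def)

lemma kmap_in_free_on: "a \<in> free_on A \<Longrightarrow> (\<And>x. x \<in> A \<Longrightarrow> f x \<in> B) \<Longrightarrow> kmap f a \<in> free_on B"
  using keys_kmap[of f a] by (fastforce simp: free_on_def)

lemma free_on_ext:
  fixes F G :: "('a \<Rightarrow>\<^sub>0 bit) \<Rightarrow> 'v::ab_group_add"
  assumes "\<And>x y. F (x + y) = F x + F y" "\<And>x y. G (x + y) = G x + G y"
    and "\<And>x. x \<in> A \<Longrightarrow> F (gen x) = G (gen x)" and "a \<in> free_on A"
  shows "F a = G a"
proof -
  have "F (klin gen a) = G (klin gen a)"
    unfolding klin_compose[of F, OF assms(1)] klin_compose[of G, OF assms(2)]
    by (rule klin_cong) (use assms(3) free_on_keys[OF assms(4)] in auto)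
  then show ?thesis by (simp add: klin_gen_self)
qed

lemma free_on_image:
  fixes F :: "('a \<Rightarrow>\<^sub>0 bit) \<Rightarrow> 'v::ab_group_add"
  assumes "\<And>x y. F (x + y) = F x + F y" "submodule S"
    and "\<And>x. x \<in> A \<Longrightarrow> F (gen x) \<in> S" and "a \<in> free_on A"
  shows "F a \<in> S"
proof -
  have "F (klin gen a) \<in> S"
    unfolding klin_compose[of F, OF assms(1)]
    by (rule submodule_klin) (use assms(2,3) free_on_keys[OF assms(4)] in auto)
  then show ?thesis by (simp add: klin_gen_self)
qed

section \<open>Monotone maps as lists\<close>

lemma length_after [simp]: "length (after \<theta> \<eta>) = length \<eta>"
  by (simp add: after_def)

lemma nth_after [simp]: "k < length \<eta> \<Longrightarrow> after \<theta> \<eta> ! k = \<theta> ! (\<eta> ! k)"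
  by (simp add: after_def)

lemma after_assoc: "set \<zeta> \<subseteq> {..<length \<eta>} \<Longrightarrow> after (after \<theta> \<eta>) \<zeta> = after \<theta> (after \<eta> \<zeta>)"
  by (auto simp: after_def)

lemma length_id_map [simp]: "length (id_map n) = Suc n"
  by (simp add: id_map_def)

lemma nth_id_map [simp]: "k \<le> n \<Longrightarrow> id_map n ! k = k"
  by (simp add: id_map_def del: upt_Suc)

lemma after_id_map: "length \<theta> = Suc n \<Longrightarrow> after \<theta> (id_map n) = \<theta>"
  by (rule nth_equalityI) auto

lemma id_map_after: "set \<theta> \<subseteq> {..n} \<Longrightarrow> after (id_map n) \<theta> = \<theta>"
  by (rule nth_equalityI) (auto simp: subset_iff)

lemma length_cofc [simp]: "length (cofc n i) = n"
  by (simp add: cofc_def)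

lemma nth_cofc [simp]: "k < n \<Longrightarrow> cofc n i ! k = (if k < i then k else Suc k)"
  by (simp add: cofc_def)

lemma length_codg [simp]: "length (codg n i) = Suc (Suc n)"
  by (simp add: codg_def)

lemma nth_codg [simp]: "k < Suc (Suc n) \<Longrightarrow> codg n i ! k = (if k \<le> i then k else k - 1)"
  by (simp add: codg_def del: upt_Suc)

lemma mono_mapsI:
  assumes "length \<theta> = Suc m" "\<And>j. j < m \<Longrightarrow> \<theta> ! j \<le> \<theta> ! Suc j" "\<And>j. j \<le> m \<Longrightarrow> \<theta> ! j \<le> n"
  shows "\<theta> \<in> mono_maps m n"
  using assms by (auto simp: mono_maps_def sorted_iff_nth_Suc in_set_conv_nth less_Suc_eq_le)

lemma mono_mapsD:
  assumes "\<theta> \<in> mono_maps m n"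
  shows "length \<theta> = Suc m" "set \<theta> \<subseteq> {..n}" "i \<le> j \<Longrightarrow> j \<le> m \<Longrightarrow> \<theta> ! i \<le> \<theta> ! j"
    "j \<le> m \<Longrightarrow> \<theta> ! j \<le> n"
proof -
  show l: "length \<theta> = Suc m" and s: "set \<theta> \<subseteq> {..n}"
    using assms by (auto simp: mono_maps_def)
  show "i \<le> j \<Longrightarrow> j \<le> m \<Longrightarrow> \<theta> ! i \<le> \<theta> ! j"
    using assms by (auto simp: mono_maps_def intro: sorted_nth_mono)
  show "j \<le> m \<Longrightarrow> \<theta> ! j \<le> n"
    using l s nth_mem[of j \<theta>] by (auto simp: less_Suc_eq_le subset_iff)
qed

lemma after_in_mono_maps:
  assumes "\<theta> \<in> mono_maps m n" "\<eta> \<in> mono_maps l m"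
  shows "after \<theta> \<eta> \<in> mono_maps l n"
  by (rule mono_mapsI) (simp_all add: mono_mapsD[OF assms(1)] mono_mapsD[OF assms(2)])

lemma id_map_in_mono_maps [simp]: "id_map n \<in> mono_maps n n"
  by (rule mono_mapsI) auto

lemma cofc_in_mono_maps [simp]: "cofc (Suc n) i \<in> mono_maps n (Suc n)"
  by (rule mono_mapsI) auto

lemma codg_in_mono_maps [simp]: "i \<le> n \<Longrightarrow> codg n i \<in> mono_maps (Suc n) n"
  by (rule mono_mapsI) auto

lemma after_assoc_mono:
  assumes "\<eta> \<in> mono_maps l m" "\<zeta> \<in> mono_maps k l"
  shows "after (after \<theta> \<eta>) \<zeta> = after \<theta> (after \<eta> \<zeta>)"
  by (rule after_assoc) (use mono_mapsD(1)[OF assms(1)] mono_mapsD(2)[OF assms(2)] in auto)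

subsection \<open>Cosimplicial identities\<close>

lemma cofc_cofc:
  "i < j \<Longrightarrow> after (cofc (Suc n) j) (cofc n i) = after (cofc (Suc n) i) (cofc n (j - 1))"
  by (rule nth_equalityI) auto

lemma codg_cofc_id:
  "i = k \<or> i = Suc k \<Longrightarrow> after (codg p k) (cofc (Suc p) i) = id_map p"
  by (rule nth_equalityI) auto

lemma codg_cofc_less:
  "i < k \<Longrightarrow> k \<le> Suc p \<Longrightarrow> after (codg (Suc p) k) (cofc (Suc (Suc p)) i) = after (cofc (Suc p) i) (codg p (k - 1))"
  by (rule nth_equalityI) auto

lemma codg_cofc_greater:
  "Suc k < i \<Longrightarrow> i \<le> Suc (Suc p) \<Longrightarrow> after (codg (Suc p) k) (cofc (Suc (Suc p)) i) = after (cofc (Suc p) (i - 1)) (codg p k)"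
  by (rule nth_equalityI) auto

lemma codg_codg:
  "k < j \<Longrightarrow> j \<le> Suc p \<Longrightarrow> after (codg p k) (codg (Suc p) j) = after (codg p (j - 1)) (codg (Suc p) k)"
  by (rule nth_equalityI) auto

text \<open>
  This criterion recognizes degenerate simplices: it suffices to find a repeated value in the list of
  an operator.
\<close>

lemma factor_through_codg:
  assumes "\<theta> \<in> mono_maps (Suc n) p" "j \<le> n" "\<theta> ! j = \<theta> ! Suc j"
  shows "after (after \<theta> (cofc (Suc n) j)) (codg n j) = \<theta>"
proof (rule nth_equalityI)
  fix k assume "k < length (after (after \<theta> (cofc (Suc n) j)) (codg n j))"
  then have k: "k \<le> Suc n" by simp
  consider "k < j" | "k = j" | "k = Suc j" | "Suc j < k" by linarith
  then show "after (after \<theta> (cofc (Suc n) j)) (codg n j) ! k = \<theta> ! k"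
    using k assms(2,3) by cases auto
qed (use mono_mapsD(1)[OF assms(1)] in auto)

text \<open>
  Deleting two entries of a list in either order gives the same result; so, modulo two, the terms of
  a twofold sum of faces cancel in pairs.
\<close>

lemma sum_faces_twice_zero:
  fixes G :: "nat \<Rightarrow> nat \<Rightarrow> 'v::exponent_two"
  assumes "\<And>i j. j < i \<Longrightarrow> i \<le> Suc n \<Longrightarrow> G i j = G j (i - 1)"
  shows "(\<Sum>i\<le>Suc n. \<Sum>j\<le>n. G i j) = 0"
proof -
  let ?P = "{..Suc n} \<times> {..n}"
  let ?A = "{(i, j) \<in> ?P. j < i}" and ?B = "{(i, j) \<in> ?P. \<not> j < i}"
  have "(\<Sum>i\<le>Suc n. \<Sum>j\<le>n. G i j) = (\<Sum>(i, j)\<in>?P. G i j)"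
    by (simp add: sum.cartesian_product del: sum.atMost_Suc)
  also have "\<dots> = (\<Sum>(i, j)\<in>?P \<inter> {(i, j). j < i}. G i j) + (\<Sum>(i, j)\<in>?P - {(i, j). j < i}. G i j)"
    by (rule sum.Int_Diff) simp
  also have "?P \<inter> {(i, j). j < i} = ?A" by auto
  also have "?P - {(i, j). j < i} = ?B" by auto
  also have "(\<Sum>(i, j)\<in>?A. G i j) = (\<Sum>(i, j)\<in>?B. G i j)"
    by (rule sum.reindex_bij_witness[where i = "\<lambda>(i, j). (Suc j, i)" and j = "\<lambda>(i, j). (j, i - 1)"])
       (auto simp: assms)
  finally show ?thesis by simp
qed


section \<open>Simplicial sets and their chains\<close>

lemma simplicial_setD:
  assumes "simplicial_set Z"
  shows "\<theta> \<in> mono_maps m n \<Longrightarrow> x \<in> cells Z n \<Longrightarrow> sop Z n \<theta> x \<in> cells Z m"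
    and "x \<in> cells Z n \<Longrightarrow> sop Z n (id_map n) x = x"
    and "\<theta> \<in> mono_maps m n \<Longrightarrow> \<eta> \<in> mono_maps l m \<Longrightarrow> x \<in> cells Z n \<Longrightarrow>
      sop Z m \<eta> (sop Z n \<theta> x) = sop Z n (after \<theta> \<eta>) x"
  using assms unfolding simplicial_set_def by blast+

lemma sop_face:
  assumes "simplicial_set Z" "\<theta> \<in> mono_maps (Suc n) p" "x \<in> cells Z p"
  shows "sop Z (Suc n) (cofc (Suc n) i) (sop Z p \<theta> x) = sop Z p (after \<theta> (cofc (Suc n) i)) x"
  by (rule simplicial_setD(3)[OF assms(1,2) cofc_in_mono_maps assms(3)])

lemma sop_degeneracy:
  assumes "simplicial_set Z" "\<theta> \<in> mono_maps n p" "x \<in> cells Z p" "i \<le> n"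
  shows "sop Z n (codg n i) (sop Z p \<theta> x) = sop Z p (after \<theta> (codg n i)) x"
  by (rule simplicial_setD(3)[OF assms(1,2) codg_in_mono_maps[OF assms(4)] assms(3)])

lemma sop_degeneracy_in:
  "simplicial_set Z \<Longrightarrow> x \<in> cells Z n \<Longrightarrow> i \<le> n \<Longrightarrow> sop Z n (codg n i) x \<in> cells Z (Suc n)"
  by (rule simplicial_setD(1)[OF _ codg_in_mono_maps])

lemma simplicial_mapD:
  assumes "simplicial_map Z W h"
  shows "x \<in> cells Z n \<Longrightarrow> h n x \<in> cells W n"
    and "\<theta> \<in> mono_maps m n \<Longrightarrow> x \<in> cells Z n \<Longrightarrow> h m (sop Z n \<theta> x) = sop W n \<theta> (h n x)"
  using assms unfolding simplicial_map_def by blast+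

lemma simplicial_map_compose:
  "simplicial_map Z W h \<Longrightarrow> simplicial_map W V g \<Longrightarrow> simplicial_map Z V (\<lambda>n x. g n (h n x))"
  unfolding simplicial_map_def by auto

lemma simplicial_map_sprod:
  "simplicial_map Z Z' h \<Longrightarrow> simplicial_map W W' g \<Longrightarrow>
    simplicial_map (sprod Z W) (sprod Z' W') (\<lambda>n. map_prod (h n) (g n))"
  unfolding simplicial_map_def by (auto simp: sprod_def)

lemma simplicial_map_id: "simplicial_map Z Z (\<lambda>n x. x)"
  unfolding simplicial_map_def by auto

lemma simplicial_set_sprod:
  "simplicial_set Z \<Longrightarrow> simplicial_set W \<Longrightarrow> simplicial_set (sprod Z W)"
  unfolding simplicial_set_def by (fastforce simp: sprod_def)

lemma cells_sprod [simp]: "cells (sprod Z W) n = cells Z n \<times> cells W n"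
  by (simp add: sprod_def)

lemma sop_sprod [simp]: "sop (sprod Z W) n \<theta> = map_prod (sop Z n \<theta>) (sop W n \<theta>)"
  by (simp add: sprod_def)

lemma cells_Simplex [simp]: "cells (Simplex n) q = mono_maps q n"
  by (simp add: Simplex_def)

lemma sop_Simplex [simp]: "sop (Simplex n) q \<theta> u = after u \<theta>"
  by (simp add: Simplex_def)

lemma simplicial_set_Simplex: "simplicial_set (Simplex n)"
  unfolding simplicial_set_def
  by (auto intro: after_in_mono_maps after_id_map after_assoc_mono dest: mono_mapsD(1))

text \<open>
  The simplex \<open>x\<close> of \<open>Z\<close> is the image of the fundamental simplex of \<open>\<Delta>\<^sup>n\<close> under this map.
\<close>

lemma simplicial_map_classifying:
  assumes "simplicial_set Z" "x \<in> cells Z n"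
  shows "simplicial_map (Simplex n) Z (\<lambda>k u. sop Z n u x)"
  using assms unfolding simplicial_map_def by (auto simp: simplicial_setD)

lemma simplicial_map_Simplex:
  "\<theta> \<in> mono_maps m n \<Longrightarrow> simplicial_map (Simplex m) (Simplex n) (\<lambda>k u. after \<theta> u)"
  using simplicial_map_classifying[OF simplicial_set_Simplex, of \<theta> n m] by simp

subsection \<open>The boundary\<close>

definition bd :: "'a sspace \<Rightarrow> nat \<Rightarrow> ('a \<Rightarrow>\<^sub>0 bit) \<Rightarrow> ('a \<Rightarrow>\<^sub>0 bit)" where
  "bd Z n a = (if n = 0 then 0 else \<Sum>k\<le>n. kmap (sop Z n (cofc n k)) a)"

lemma bd_add [simp]: "bd Z n (a + b) = bd Z n a + bd Z n b"
  by (simp add: bd_def sum.distrib)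

lemma bd_zero [simp]: "bd Z n 0 = 0" "bd Z 0 a = 0"
  by (simp_all add: bd_def)

lemma bd_sum: "bd Z n (sum f A) = (\<Sum>x\<in>A. bd Z n (f x))"
  by (rule additive_sum) simp

lemma bd_gen: "bd Z (Suc n) (gen x) = (\<Sum>k\<le>Suc n. gen (sop Z (Suc n) (cofc (Suc n) k) x))"
  by (simp add: bd_def)

lemma bd_in_free_on:
  assumes "simplicial_set Z" "a \<in> free_on (cells Z n)"
  shows "bd Z n a \<in> free_on (cells Z (n - 1))"
proof (cases n)
  case 0 then show ?thesis by (simp add: submodule_zero submodule_free_on)
next
  case (Suc r)
  then show ?thesis
    using assms unfolding bd_def
    by (auto intro!: submodule_sum submodule_free_on submodule_add
        kmap_in_free_on[where A = "cells Z n"] simplicial_setD[OF assms(1)])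
qed

lemma bd_natural:
  assumes "simplicial_map Z W h" "a \<in> free_on (cells Z n)"
  shows "kmap (h (n - 1)) (bd Z n a) = bd W n (kmap (h n) a)"
proof (cases n)
  case (Suc r)
  show ?thesis
    by (rule free_on_ext[OF _ _ _ assms(2)])
       (auto simp: Suc bd_gen kmap_sum simplicial_mapD(2)[OF assms(1)] simp del: sum.atMost_Suc)
qed simp

lemma bd_bd:
  assumes "simplicial_set Z" "a \<in> free_on (cells Z n)"
  shows "bd Z (n - 1) (bd Z n a) = 0"
proof -
  consider "n = 0" | "n = 1" | r where "n = Suc (Suc r)"
    by (metis One_nat_def not0_implies_Suc)
  then show ?thesis
  proof cases
    case 3
    show ?thesis
    proof (rule free_on_ext[OF _ _ _ assms(2), of "\<lambda>a. bd Z (n - 1) (bd Z n a)" "\<lambda>a. 0"])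
      fix x assume x: "x \<in> cells Z n"
      have "bd Z (n - 1) (bd Z n (gen x)) =
          (\<Sum>i\<le>Suc (Suc r). \<Sum>j\<le>Suc r. gen (sop Z n (after (cofc n i) (cofc (Suc r) j)) x))"
        using x
        by (simp add: 3 bd_gen bd_sum sop_face[OF assms(1)] del: sum.atMost_Suc)
      also have "\<dots> = 0"
        unfolding 3 by (rule sum_faces_twice_zero) (simp add: cofc_cofc)
      finally show "bd Z (n - 1) (bd Z n (gen x)) = 0" .
    qed simp_all
  qed simp_all
qed

subsection \<open>Degenerate chains\<close>

definition degen :: "'a sspace \<Rightarrow> nat \<Rightarrow> ('a \<Rightarrow>\<^sub>0 bit) set" where
  "degen Z q = kspan (\<Union>k\<in>{..<q}. kmap (sop Z (q - 1) (codg (q - 1) k)) ` free_on (cells Z (q - 1)))"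

lemma submodule_degen: "submodule (degen Z q)"
  unfolding degen_def by (rule submodule_kspan)

lemma degen_image:
  fixes F :: "('a \<Rightarrow>\<^sub>0 bit) \<Rightarrow> 'v::ab_group_add"
  assumes add: "\<And>x y. F (x + y) = F x + F y" and S: "submodule S"
    and gen: "\<And>n k x. q = Suc n \<Longrightarrow> k \<le> n \<Longrightarrow> x \<in> cells Z n \<Longrightarrow> F (gen (sop Z n (codg n k) x)) \<in> S"
    and a: "a \<in> degen Z q"
  shows "F a \<in> S"
proof (rule kspan_image[OF add S _ a[unfolded degen_def]])
  fix b assume "b \<in> (\<Union>k\<in>{..<q}. kmap (sop Z (q - 1) (codg (q - 1) k)) ` free_on (cells Z (q - 1)))"
  then obtain k c where k: "k < q" and c: "c \<in> free_on (cells Z (q - 1))"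
    and b: "b = kmap (sop Z (q - 1) (codg (q - 1) k)) c" by auto
  show "F b \<in> S" unfolding b
    by (rule free_on_image[OF _ S _ c]) (use k gen[of "q - 1" k] in \<open>auto simp: add\<close>)
qed

lemma gen_repeat_in_degen:
  assumes Z: "simplicial_set Z" and x: "x \<in> cells Z p" and \<theta>: "\<theta> \<in> mono_maps (Suc n) p"
    and j: "j \<le> n" "\<theta> ! j = \<theta> ! Suc j"
  shows "gen (sop Z p \<theta> x) \<in> degen Z (Suc n)"
proof -
  let ?\<eta> = "after \<theta> (cofc (Suc n) j)"
  have \<eta>: "?\<eta> \<in> mono_maps n p" using \<theta> cofc_in_mono_maps by (rule after_in_mono_maps)
  have "sop Z p \<theta> x = sop Z n (codg n j) (sop Z p ?\<eta> x)"
    using j(1) by (simp add: sop_degeneracy[OF Z \<eta> x] factor_through_codg[OF \<theta> j])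
  then have "gen (sop Z p \<theta> x) = kmap (sop Z n (codg n j)) (gen (sop Z p ?\<eta> x))" by simp
  moreover have "gen (sop Z p ?\<eta> x) \<in> free_on (cells Z n)"
    using simplicial_setD(1)[OF Z \<eta> x] by simp
  ultimately show ?thesis
    unfolding degen_def diff_Suc_1 using j(1) by (intro kspan_base UN_I[of j] image_eqI[of _ _ "gen (sop Z p ?\<eta> x)"]) auto
qed

lemma degen_subset_free_on: "simplicial_set Z \<Longrightarrow> degen Z q \<subseteq> free_on (cells Z q)"
  by (auto intro!: degen_image[of "\<lambda>x. x" "free_on (cells Z q)" q Z] submodule_free_on
      sop_degeneracy_in)

lemma kmap_degen:
  assumes "simplicial_set Z" "simplicial_set W" "simplicial_map Z W h" "a \<in> degen Z q"
  shows "kmap (h q) a \<in> degen W q"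
proof (rule degen_image[OF _ submodule_degen _ assms(4)])
  fix n k x assume *: "q = Suc n" "k \<le> n" "x \<in> cells Z n"
  then have "h q (sop Z n (codg n k) x) = sop W n (codg n k) (h n x)"
    by (simp add: simplicial_mapD[OF assms(3)])
  moreover have "gen (sop W n (codg n k) (h n x)) \<in> degen W q"
    using * simplicial_mapD(1)[OF assms(3)] by (auto intro!: gen_repeat_in_degen[where j = k] assms)
  ultimately show "kmap (h q) (gen (sop Z n (codg n k) x)) \<in> degen W q" by simp
qed simp

text \<open>
  In the boundary of a degenerate simplex \<open>s\<^sub>k x\<close> the faces \<open>k\<close> and \<open>k + 1\<close> cancel, and the other
  ones keep the repeated vertex.
\<close>

lemma bd_degen:
  assumes Z: "simplicial_set Z" and a: "a \<in> degen Z n"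
  shows "bd Z n a \<in> degen Z (n - 1)"
proof (rule degen_image[OF _ submodule_degen _ a])
  fix r k x assume n: "n = Suc r" and k: "k \<le> r" and x: "x \<in> cells Z r"
  let ?g = "\<lambda>i. gen (sop Z r (after (codg r k) (cofc (Suc r) i)) x)"
  have "bd Z n (gen (sop Z r (codg r k) x)) = (\<Sum>i\<le>Suc r. ?g i)"
    using k x by (simp add: n bd_gen sop_face[OF Z] del: sum.atMost_Suc)
  also have "\<dots> = (\<Sum>i\<in>{k, Suc k}. ?g i) + (\<Sum>i\<in>{..Suc r} - {k, Suc k}. ?g i)"
    by (subst sum.subset_diff[of "{k, Suc k}"]) (use k in \<open>auto simp: add.commute simp del: sum.atMost_Suc\<close>)
  also have "(\<Sum>i\<in>{k, Suc k}. ?g i) = 0"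
    by (simp add: codg_cofc_id)
  also have "0 + (\<Sum>i\<in>{..Suc r} - {k, Suc k}. ?g i) \<in> degen Z (n - 1)"
  proof (simp only: add_0, rule submodule_sum[OF submodule_degen])
    fix i assume i: "i \<in> {..Suc r} - {k, Suc k}"
    then obtain r' where r': "r = Suc r'" using k by (cases r) auto
    show "?g i \<in> degen Z (n - 1)"
      unfolding n r' diff_Suc_1
    proof (rule gen_repeat_in_degen[OF Z x[unfolded r']])
      show "after (codg (Suc r') k) (cofc (Suc (Suc r')) i) \<in> mono_maps (Suc r') (Suc r')"
        by (rule after_in_mono_maps[of _ "Suc (Suc r')"]) (use k r' in auto)
      show "(if k < i then k else k - 1) \<le> r'" using i k r' by auto
      show "after (codg (Suc r') k) (cofc (Suc (Suc r')) i) ! (if k < i then k else k - 1) =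
          after (codg (Suc r') k) (cofc (Suc (Suc r')) i) ! Suc (if k < i then k else k - 1)"
        using i k r' by auto
    qed
  qed
  finally show "bd Z n (gen (sop Z r (codg r k) x)) \<in> degen Z (n - 1)" .
qed simp

section \<open>The shuffle map\<close>

lemma free_on_ext2:
  fixes F G :: "('a \<Rightarrow>\<^sub>0 bit) \<Rightarrow> ('b \<Rightarrow>\<^sub>0 bit) \<Rightarrow> 'v::ab_group_add"
  assumes "\<And>x y b. F (x + y) b = F x b + F y b" "\<And>a x y. F a (x + y) = F a x + F a y"
    and "\<And>x y b. G (x + y) b = G x b + G y b" "\<And>a x y. G a (x + y) = G a x + G a y"
    and "\<And>x y. x \<in> A \<Longrightarrow> y \<in> B \<Longrightarrow> F (gen x) (gen y) = G (gen x) (gen y)"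
    and a: "a \<in> free_on A" and b: "b \<in> free_on B"
  shows "F a b = G a b"
proof (rule free_on_ext[OF _ _ _ a, of "\<lambda>a. F a b" "\<lambda>a. G a b"])
  fix x assume "x \<in> A"
  then show "F (gen x) b = G (gen x) b"
    by (intro free_on_ext[OF _ _ _ b, of "F (gen x)" "G (gen x)"]) (simp_all add: assms)
qed (simp_all add: assms)

lemma free_on_image2:
  fixes F :: "('a \<Rightarrow>\<^sub>0 bit) \<Rightarrow> ('b \<Rightarrow>\<^sub>0 bit) \<Rightarrow> 'v::ab_group_add"
  assumes "\<And>x y b. F (x + y) b = F x b + F y b" "\<And>a x y. F a (x + y) = F a x + F a y"
    and S: "submodule S" and "\<And>x y. x \<in> A \<Longrightarrow> y \<in> B \<Longrightarrow> F (gen x) (gen y) \<in> S"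
    and a: "a \<in> free_on A" and b: "b \<in> free_on B"
  shows "F a b \<in> S"
proof (rule free_on_image[OF _ S _ a, of "\<lambda>a. F a b"])
  fix x assume "x \<in> A"
  then show "F (gen x) b \<in> S"
    by (intro free_on_image[OF _ S _ b, of "F (gen x)"]) (simp_all add: assms)
qed (simp_all add: assms)

lemma shuffle_add_left [simp]: "shuffle Z W p q (a + a') b = shuffle Z W p q a b + shuffle Z W p q a' b"
  by (simp add: shuffle_def kcross_add_left sum.distrib)

lemma shuffle_add_right [simp]: "shuffle Z W p q a (b + b') = shuffle Z W p q a b + shuffle Z W p q a b'"
  by (simp add: shuffle_def kcross_add_right sum.distrib)

lemma shuffle_zero [simp]: "shuffle Z W p q 0 b = 0" "shuffle Z W p q a 0 = 0"
  by (simp_all add: shuffle_def)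

lemma shuffle_sum_left: "shuffle Z W p q (sum f I) b = (\<Sum>i\<in>I. shuffle Z W p q (f i) b)"
  by (rule additive_sum) simp

lemma shuffle_sum_right: "shuffle Z W p q a (sum f I) = (\<Sum>i\<in>I. shuffle Z W p q a (f i))"
  by (rule additive_sum) simp

lemma shuffle_gen:
  "shuffle Z W p q (gen x) (gen y) = (\<Sum>\<mu> | \<mu> \<subseteq> {..<p + q} \<and> card \<mu> = p.
     gen (sop Z p (collapse (p + q) \<mu>) x, sop W q (collapse (p + q) ({..<p + q} - \<mu>)) y))"
  by (simp add: shuffle_def)

lemma length_collapse [simp]: "length (collapse n \<mu>) = Suc n"
  by (simp add: collapse_def)

lemma nth_collapse [simp]: "i \<le> n \<Longrightarrow> collapse n \<mu> ! i = card (\<mu> \<inter> {..<i})"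
  by (simp add: collapse_def del: upt_Suc)

lemma collapse_in_mono_maps:
  assumes "\<mu> \<subseteq> {..<n}" "card \<mu> = p"
  shows "collapse n \<mu> \<in> mono_maps n p"
proof -
  have "finite \<mu>" using assms(1) finite_subset by blast
  then show ?thesis
    using assms by (intro mono_mapsI) (auto intro!: card_mono)
qed

lemma card_complement_shuffle: "\<mu> \<subseteq> {..<p + q} \<Longrightarrow> card \<mu> = p \<Longrightarrow> card ({..<p + q} - \<mu>) = (q :: nat)"
  by (subst card_Diff_subset) (auto dest: finite_subset)

lemma collapse_complement_in_mono_maps:
  "\<mu> \<subseteq> {..<p + q} \<Longrightarrow> card \<mu> = p \<Longrightarrow> collapse (p + q) ({..<p + q} - \<mu>) \<in> mono_maps (p + q) q"
  by (rule collapse_in_mono_maps) (auto simp: card_complement_shuffle)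

lemma shuffle_in_free_on:
  assumes "simplicial_set Z" "simplicial_set W"
    and "a \<in> free_on (cells Z p)" "b \<in> free_on (cells W q)"
  shows "shuffle Z W p q a b \<in> free_on (cells (sprod Z W) (p + q))"
proof (rule free_on_image2[OF _ _ submodule_free_on _ assms(3,4)])
  fix x y assume "x \<in> cells Z p" "y \<in> cells W q"
  then show "shuffle Z W p q (gen x) (gen y) \<in> free_on (cells (sprod Z W) (p + q))"
    unfolding shuffle_gen
    by (intro submodule_sum submodule_free_on)
       (auto intro!: simplicial_setD(1)[OF assms(1)] simplicial_setD(1)[OF assms(2)]
         collapse_in_mono_maps collapse_complement_in_mono_maps)
qed simp_all

lemma shuffle_natural:
  assumes f: "simplicial_map Z Z' f" and g: "simplicial_map W W' g"
    and "a \<in> free_on (cells Z p)" "b \<in> free_on (cells W q)"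
  shows "kmap (map_prod (f (p + q)) (g (p + q))) (shuffle Z W p q a b) =
    shuffle Z' W' p q (kmap (f p) a) (kmap (g q) b)"
proof (rule free_on_ext2[OF _ _ _ _ _ assms(3,4),
    of "\<lambda>a b. kmap (map_prod (f (p + q)) (g (p + q))) (shuffle Z W p q a b)"
       "\<lambda>a b. shuffle Z' W' p q (kmap (f p) a) (kmap (g q) b)"])
  fix x y assume x: "x \<in> cells Z p" and y: "y \<in> cells W q"
  show "kmap (map_prod (f (p + q)) (g (p + q))) (shuffle Z W p q (gen x) (gen y)) =
      shuffle Z' W' p q (kmap (f p) (gen x)) (kmap (g q) (gen y))"
    unfolding shuffle_gen kmap_gen kmap_sum
    by (rule sum.cong)
       (auto simp: simplicial_mapD(2)[OF f _ x] simplicial_mapD(2)[OF g _ y]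
         collapse_in_mono_maps collapse_complement_in_mono_maps)
qed simp_all

text \<open>
  Exchanging the two factors replaces the subset that describes a shuffle by its complement.
\<close>

lemma shuffle_commute:
  "kmap prod.swap (shuffle Z W p q a b) = shuffle W Z q p b a"
proof (rule free_on_ext2[of "\<lambda>a b. kmap prod.swap (shuffle Z W p q a b)" "\<lambda>a b. shuffle W Z q p b a"
      UNIV UNIV])
  fix x y
  show "kmap prod.swap (shuffle Z W p q (gen x) (gen y)) = shuffle W Z q p (gen y) (gen x)"
    unfolding shuffle_gen kmap_sum
    by (rule sum.reindex_bij_witness[where i = "\<lambda>\<mu>. {..<p + q} - \<mu>" and j = "\<lambda>\<mu>. {..<p + q} - \<mu>"])
       (auto simp: double_diff add.commute[of q p] card_complement_shuffle
         card_complement_shuffle[of _ q p, unfolded add.commute[of q p]])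
qed (simp_all add: free_on_def)

text \<open>
  In a shuffle of \<open>s\<^sub>k x\<close> and \<open>y\<close> there is a step from the vertex \<open>k\<close> to the vertex \<open>k + 1\<close> in the
  first direction. The second coordinate does not move in this step, so both coordinates repeat there.
\<close>

lemma shuffle_degen_left:
  assumes Z: "simplicial_set Z" and W: "simplicial_set W"
    and a: "a \<in> degen Z p" and b: "b \<in> free_on (cells W q)"
  shows "shuffle Z W p q a b \<in> degen (sprod Z W) (p + q)"
proof (rule degen_image[OF _ submodule_degen _ a])
  fix n k x assume p: "p = Suc n" and k: "k \<le> n" and x: "x \<in> cells Z n"
  show "shuffle Z W p q (gen (sop Z n (codg n k) x)) b \<in> degen (sprod Z W) (p + q)"
  proof (rule free_on_image[OF _ submodule_degen _ b])
    fix y assume y: "y \<in> cells W q"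
    let ?N = "n + q"
    show "shuffle Z W p q (gen (sop Z n (codg n k) x)) (gen y) \<in> degen (sprod Z W) (p + q)"
      unfolding shuffle_gen
    proof (rule submodule_sum[OF submodule_degen])
      fix \<mu> assume "\<mu> \<in> {\<mu>. \<mu> \<subseteq> {..<p + q} \<and> card \<mu> = p}"
      then have \<mu>: "\<mu> \<subseteq> {..<p + q}" "card \<mu> = p" by auto
      have fin: "finite \<mu>" using \<mu>(1) finite_subset by blast
      let ?\<nu> = "{..<p + q} - \<mu>" and ?c = "\<lambda>i. card (\<mu> \<inter> {..<i})"
      have int_Suc: "A \<inter> {..<Suc i} = (if i \<in> A then insert i (A \<inter> {..<i}) else A \<inter> {..<i})"
        for A :: "nat set" and i by (auto simp: lessThan_Suc)
      \<comment> \<open>the step \<open>j\<close> leads from the vertex \<open>k\<close> to the vertex \<open>k + 1\<close>\<close>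
      define i where "i = (LEAST i. k < ?c i)"
      have "\<mu> \<inter> {..<p + q} = \<mu>" using \<mu>(1) by auto
      then have "k < ?c (p + q)" using \<mu>(2) k p by simp
      then have i: "k < ?c i" "i \<le> p + q" unfolding i_def by (rule LeastI, rule Least_le)
      then obtain j where j: "i = Suc j" by (cases i) auto
      have "\<not> k < ?c j" using not_less_Least[of j "\<lambda>i. k < ?c i"] j by (simp add: i_def)
      then have jk: "j \<in> \<mu>" "?c j = k" "?c (Suc j) = Suc k"
        using i(1) fin by (auto simp: j int_Suc split: if_splits)
      have jN: "j \<le> ?N" using i(2) j p by simp
      let ?\<theta> = "after (codg n k) (collapse (p + q) \<mu>)" and ?\<eta> = "collapse (p + q) ?\<nu>"
      let ?del = "cofc (Suc ?N) j"
      have \<theta>: "?\<theta> \<in> mono_maps (Suc ?N) n"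
        using after_in_mono_maps[OF codg_in_mono_maps[OF k]] collapse_in_mono_maps[OF \<mu>] p by simp
      have \<eta>: "?\<eta> \<in> mono_maps (Suc ?N) q"
        using collapse_complement_in_mono_maps[OF \<mu>] p by simp
      have "?\<theta> ! j = ?\<theta> ! Suc j" using jk jN k p by simp
      note f\<theta> = factor_through_codg[OF \<theta> jN this]
      have "?\<eta> ! j = ?\<eta> ! Suc j" using jk(1) jN p by (simp add: int_Suc)
      note f\<eta> = factor_through_codg[OF \<eta> jN this]
      have \<theta>': "after ?\<theta> ?del \<in> mono_maps ?N n" and \<eta>': "after ?\<eta> ?del \<in> mono_maps ?N q"
        using \<theta> \<eta> cofc_in_mono_maps by (auto intro: after_in_mono_maps)
      let ?z = "(sop Z n (after ?\<theta> ?del) x, sop W q (after ?\<eta> ?del) y)"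
      have z: "?z \<in> cells (sprod Z W) ?N"
        using simplicial_setD(1)[OF Z \<theta>' x] simplicial_setD(1)[OF W \<eta>' y] by simp
      have "sop Z p (collapse (p + q) \<mu>) (sop Z n (codg n k) x) = sop Z n ?\<theta> x"
        using simplicial_setD(3)[OF Z codg_in_mono_maps[OF k] _ x] collapse_in_mono_maps[OF \<mu>] p by simp
      also have "\<dots> = sop Z ?N (codg ?N j) (sop Z n (after ?\<theta> ?del) x)"
        by (simp only: sop_degeneracy[OF Z \<theta>' x jN] f\<theta>)
      finally have "(sop Z p (collapse (p + q) \<mu>) (sop Z n (codg n k) x), sop W q ?\<eta> y) =
          sop (sprod Z W) ?N (codg ?N j) ?z"
        by (simp only: sop_sprod map_prod_simp sop_degeneracy[OF W \<eta>' y jN] f\<eta>)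
      moreover have "gen (sop (sprod Z W) ?N (codg ?N j) ?z) \<in> degen (sprod Z W) (Suc ?N)"
        by (rule gen_repeat_in_degen[OF simplicial_set_sprod[OF Z W] z codg_in_mono_maps jN])
           (use jN in auto)
      ultimately show "gen (sop Z p (collapse (p + q) \<mu>) (sop Z n (codg n k) x), sop W q ?\<eta> y)
          \<in> degen (sprod Z W) (p + q)"
        by (simp only: p add_Suc)
    qed
  qed simp
qed simp

lemma simplicial_map_swap: "simplicial_map (sprod Z W) (sprod W Z) (\<lambda>n. prod.swap)"
  by (auto simp: simplicial_map_def)

lemma shuffle_degen_right:
  assumes Z: "simplicial_set Z" and W: "simplicial_set W"
    and a: "a \<in> free_on (cells Z p)" and b: "b \<in> degen W q"
  shows "shuffle Z W p q a b \<in> degen (sprod Z W) (p + q)"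
  using kmap_degen[OF _ _ simplicial_map_swap shuffle_degen_left[OF W Z b a]]
  by (simp add: shuffle_commute simplicial_set_sprod Z W add.commute)

subsection \<open>Shuffles of lists\<close>

text \<open>
  The simplices of this simplicial set are nonempty lists of vertices, without any condition. It
  contains all standard simplices, and its products are again of this kind (lists of pairs). So the
  shuffle map can be studied there by recursion on lists.
\<close>

definition Words :: "'a list sspace" where
  "Words = \<lparr>cells = (\<lambda>q. {l. length l = Suc q}), sop = (\<lambda>q \<theta> u. after u \<theta>)\<rparr>"

lemma cells_Words [simp]: "cells Words q = {l. length l = Suc q}"
  by (simp add: Words_def)

lemma sop_Words [simp]: "sop Words q \<theta> u = after u \<theta>"
  by (simp add: Words_def)

lemma sop_Simplex_Words: "sop (Simplex n) = sop Words"
  by (simp add: fun_eq_iff)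

lemma shuffle_Simplex: "shuffle (Simplex m) (Simplex n) = shuffle Words Words"
  by (simp add: fun_eq_iff shuffle_def sop_Simplex_Words)

lemma bd_Simplex: "bd (Simplex n) = bd Words"
  by (simp add: fun_eq_iff bd_def sop_Simplex_Words)

lemma bd_sprod_Simplex: "bd (sprod (Simplex m) (Simplex n)) = bd (sprod Words Words)"
  by (simp add: fun_eq_iff bd_def sop_Simplex_Words)

lemma shuffle_sprod_Simplex:
  "shuffle (sprod (Simplex m) (Simplex n)) (sprod (Simplex m') (Simplex n')) =
   shuffle (sprod Words Words) (sprod Words Words)"
  by (simp add: fun_eq_iff shuffle_def sop_Simplex_Words)

definition unzip :: "('a \<times> 'b) list \<Rightarrow> 'a list \<times> 'b list" where
  "unzip l = (map fst l, map snd l)"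

lemma simplicial_map_unzip: "simplicial_map Words (sprod Words Words) (\<lambda>n. unzip)"
proof -
  have "unzip (after x \<theta>) = (after (map fst x) \<theta>, after (map snd x) \<theta>)"
    if "\<theta> \<in> mono_maps m n" "length x = Suc n" for x :: "('a \<times> 'b) list" and \<theta> m n
    using that mono_mapsD(2)[OF that(1)] by (auto simp: unzip_def after_def nth_map less_Suc_eq_le subset_iff)
  then show ?thesis by (auto simp: simplicial_map_def unzip_def)
qed

text \<open>
  The first step of a shuffle of two lists advances in exactly one of them; a list that is exhausted
  contributes nothing.
\<close>

fun list_shuffle :: "'a list \<Rightarrow> 'b list \<Rightarrow> (('a \<times> 'b) list \<Rightarrow>\<^sub>0 bit)" where
  "list_shuffle [] ys = 0"
| "list_shuffle (x # xs) [] = 0"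
| "list_shuffle (x # xs) (y # ys) = kmap (Cons (x, y))
     (if xs = [] \<and> ys = [] then gen [] else list_shuffle xs (y # ys) + list_shuffle (x # xs) ys)"

lemma list_shuffle_Nil2 [simp]: "list_shuffle xs [] = 0"
  by (cases xs) auto

lemma collapse_Suc_image:
  "collapse (Suc n) (Suc ` \<mu>) = 0 # collapse n \<mu>"
proof -
  have "Suc ` \<mu> \<inter> {..<Suc i} = Suc ` (\<mu> \<inter> {..<i})" for i by auto
  then have "card (Suc ` \<mu> \<inter> {..<Suc i}) = card (\<mu> \<inter> {..<i})" for i
    by (simp add: card_image)
  then show ?thesis
    by (intro nth_equalityI) (auto simp: nth_Cons split: nat.split)
qed

lemma collapse_Suc_insert:
  assumes "finite \<mu>"
  shows "collapse (Suc n) (insert 0 (Suc ` \<mu>)) = 0 # map Suc (collapse n \<mu>)"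
proof -
  have "insert 0 (Suc ` \<mu>) \<inter> {..<Suc i} = insert 0 (Suc ` (\<mu> \<inter> {..<i}))" for i by auto
  then have "card (insert 0 (Suc ` \<mu>) \<inter> {..<Suc i}) = Suc (card (\<mu> \<inter> {..<i}))" for i
    using assms by (simp add: card_image)
  then show ?thesis
    by (intro nth_equalityI) (auto simp: nth_Cons split: nat.split)
qed

text \<open>
  A subset contains \<open>0\<close> iff the first step of the corresponding shuffle is in the first direction.
  Removing this step shifts the remaining elements by one.
\<close>

lemma sum_subsets_Suc:
  fixes F :: "nat set \<Rightarrow> 'v::ab_group_add"
  shows "(\<Sum>\<mu> | \<mu> \<subseteq> {..<Suc n} \<and> card \<mu> = p. F \<mu>) =
    (\<Sum>\<mu> | \<mu> \<subseteq> {..<n} \<and> card \<mu> = p. F (Suc ` \<mu>)) +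
    (if p = 0 then 0 else \<Sum>\<mu> | \<mu> \<subseteq> {..<n} \<and> card \<mu> = p - 1. F (insert 0 (Suc ` \<mu>)))"
proof -
  let ?P = "\<lambda>n p. {\<mu>. \<mu> \<subseteq> {..<n::nat} \<and> card \<mu> = p}"
  have vim: "Suc ` (Suc -` \<mu>) = \<mu> - {0}" for \<mu>
  proof (rule set_eqI)
    fix i show "i \<in> Suc ` (Suc -` \<mu>) \<longleftrightarrow> i \<in> \<mu> - {0}" by (cases i) auto
  qed
  have fin: "finite (?P n p)" for n p by (rule finite_subset[of _ "Pow {..<n}"]) auto
  have "(\<Sum>\<mu>\<in>?P (Suc n) p. F \<mu>) = (\<Sum>\<mu>\<in>?P (Suc n) p \<inter> {\<mu>. 0 \<notin> \<mu>}. F \<mu>) + (\<Sum>\<mu>\<in>?P (Suc n) p - {\<mu>. 0 \<notin> \<mu>}. F \<mu>)"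
    by (rule sum.Int_Diff) (rule fin)
  also have "(\<Sum>\<mu>\<in>?P (Suc n) p \<inter> {\<mu>. 0 \<notin> \<mu>}. F \<mu>) = (\<Sum>\<mu>\<in>?P n p. F (Suc ` \<mu>))"
  proof (rule sum.reindex_bij_witness[where i = "\<lambda>\<mu>. Suc ` \<mu>" and j = "\<lambda>\<mu>. Suc -` \<mu>"])
    fix \<mu> assume \<mu>: "\<mu> \<in> ?P (Suc n) p \<inter> {\<mu>. 0 \<notin> \<mu>}"
    then have eq: "Suc ` (Suc -` \<mu>) = \<mu>"
      unfolding vim by auto
    then show "Suc ` (Suc -` \<mu>) = \<mu>" .
    show "F (Suc ` (Suc -` \<mu>)) = F \<mu>" by (simp only: eq)
    have "card (Suc -` \<mu>) = card (Suc ` (Suc -` \<mu>))" by (rule card_image[symmetric]) simp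
    then have "card (Suc -` \<mu>) = p" unfolding eq using \<mu> by simp
    then show "Suc -` \<mu> \<in> ?P n p" using \<mu> by auto
  qed (auto simp: card_image)
  also have "(\<Sum>\<mu>\<in>?P (Suc n) p - {\<mu>. 0 \<notin> \<mu>}. F \<mu>) =
      (if p = 0 then 0 else \<Sum>\<mu>\<in>?P n (p - 1). F (insert 0 (Suc ` \<mu>)))"
  proof (cases p)
    case 0
    have "\<mu> = {}" if "\<mu> \<in> ?P (Suc n) 0" for \<mu>
      using that finite_subset[of \<mu> "{..<Suc n}"] by auto
    then have "?P (Suc n) p - {\<mu>. 0 \<notin> \<mu>} = {}" unfolding 0 by blast
    then show ?thesis by (simp only: 0) simp
  next
    case (Suc r)
    have "(\<Sum>\<mu>\<in>?P (Suc n) p - {\<mu>. 0 \<notin> \<mu>}. F \<mu>) = (\<Sum>\<mu>\<in>?P n r. F (insert 0 (Suc ` \<mu>)))"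
    proof (rule sum.reindex_bij_witness[where i = "\<lambda>\<mu>. insert 0 (Suc ` \<mu>)" and j = "\<lambda>\<mu>. Suc -` \<mu>"])
      fix \<mu> assume \<mu>: "\<mu> \<in> ?P (Suc n) p - {\<mu>. 0 \<notin> \<mu>}"
      then have eq: "insert 0 (Suc ` (Suc -` \<mu>)) = \<mu>"
        unfolding vim by auto
      then show "insert 0 (Suc ` (Suc -` \<mu>)) = \<mu>" .
      show "F (insert 0 (Suc ` (Suc -` \<mu>))) = F \<mu>" by (simp only: eq)
      have "finite (Suc -` \<mu>)" using \<mu> by (auto intro!: finite_vimageI dest: finite_subset)
      then have "card (insert 0 (Suc ` (Suc -` \<mu>))) = Suc (card (Suc ` (Suc -` \<mu>)))"
        by (intro card_insert_disjoint finite_imageI) auto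
      also have "card (Suc ` (Suc -` \<mu>)) = card (Suc -` \<mu>)" by (rule card_image) simp
      finally have "card (insert 0 (Suc ` (Suc -` \<mu>))) = Suc (card (Suc -` \<mu>))" .
      then have "card (Suc -` \<mu>) = r" unfolding eq using \<mu> Suc by simp
      then show "Suc -` \<mu> \<in> ?P n r" using \<mu> by auto
    next
      fix \<mu> assume \<mu>: "\<mu> \<in> ?P n r"
      then have "finite \<mu>" by (auto dest: finite_subset)
      then show "insert 0 (Suc ` \<mu>) \<in> ?P (Suc n) p - {\<mu>. 0 \<notin> \<mu>}" using \<mu> Suc by (auto simp: card_image)
    qed auto
    then show ?thesis using Suc by simp
  qed
  finally show ?thesis .
qed

lemma after_Cons: "after \<theta> (k # \<eta>) = \<theta> ! k # after \<theta> \<eta>"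
  by (simp add: after_def)

lemma after_Cons_Suc: "after (x # \<theta>) (map Suc \<eta>) = after \<theta> \<eta>"
  by (simp add: after_def)

lemma shuffle_Words:
  assumes "length u = Suc p" "length v = Suc q"
  shows "shuffle Words Words p q (gen u) (gen v) = kmap unzip (list_shuffle u v)"
proof -
  let ?S = "\<lambda>n p u v. \<Sum>\<mu> | \<mu> \<subseteq> {..<n} \<and> card \<mu> = p.
     gen (after u (collapse n \<mu>), after v (collapse n ({..<n} - \<mu>)))"
  have "?S n p u v = kmap unzip (list_shuffle u v)"
    if "length u = Suc p" "length v = Suc q" "n = p + q" for n p q and u :: "'a list" and v :: "'b list"
    using that
  proof (induction n arbitrary: p q u v)
    case 0
    then obtain x y where "u = [x]" "v = [y]" by (auto simp: length_Suc_conv)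
    moreover have "{\<mu>. \<mu> \<subseteq> {..<0::nat} \<and> card \<mu> = p} = {{}}" using 0 by auto
    ultimately show ?case
      by (simp add: after_def collapse_def unzip_def)
  next
    case (Suc n)
    obtain x xs y ys where u: "u = x # xs" and v: "v = y # ys" and l: "length xs = p" "length ys = q"
      using Suc.prems by (auto simp: length_Suc_conv)
    let ?cons = "map_prod (Cons x) (Cons y)"
    have diff1: "{..<Suc n} - Suc ` \<mu> = insert 0 (Suc ` ({..<n} - \<mu>))" for \<mu>
    proof (rule set_eqI)
      fix i show "i \<in> {..<Suc n} - Suc ` \<mu> \<longleftrightarrow> i \<in> insert 0 (Suc ` ({..<n} - \<mu>))" by (cases i) auto
    qed
    have diff2: "{..<Suc n} - insert 0 (Suc ` \<mu>) = Suc ` ({..<n} - \<mu>)" for \<mu>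
    proof (rule set_eqI)
      fix i show "i \<in> {..<Suc n} - insert 0 (Suc ` \<mu>) \<longleftrightarrow> i \<in> Suc ` ({..<n} - \<mu>)" by (cases i) auto
    qed
    note diff = diff1 diff2
    have 1: "(\<Sum>\<mu> | \<mu> \<subseteq> {..<n} \<and> card \<mu> = p. gen (after u (collapse (Suc n) (Suc ` \<mu>)),
          after v (collapse (Suc n) ({..<Suc n} - Suc ` \<mu>)))) = kmap ?cons (kmap unzip (list_shuffle u ys))"
    proof (cases q)
      case 0
      have "card \<mu> \<noteq> p" if "\<mu> \<subseteq> {..<n}" for \<mu>
        using card_mono[OF _ that] 0 Suc.prems(3) by auto
      then have none: "{\<mu>. \<mu> \<subseteq> {..<n} \<and> card \<mu> = p} = {}" by auto
      show ?thesis unfolding none using 0 l by simp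
    next
      case (Suc q')
      have "(\<Sum>\<mu> | \<mu> \<subseteq> {..<n} \<and> card \<mu> = p. gen (after u (collapse (Suc n) (Suc ` \<mu>)),
          after v (collapse (Suc n) ({..<Suc n} - Suc ` \<mu>)))) = kmap ?cons (?S n p u ys)"
        by (simp add: kmap_sum diff collapse_Suc_image collapse_Suc_insert after_Cons after_Cons_Suc u v)
      also have "?S n p u ys = kmap unzip (list_shuffle u ys)"
        by (rule Suc.IH[of _ _ _ q']) (use Suc l Suc.prems in auto)
      finally show ?thesis .
    qed
    have 2: "(if p = 0 then 0 else \<Sum>\<mu> | \<mu> \<subseteq> {..<n} \<and> card \<mu> = p - 1.
          gen (after u (collapse (Suc n) (insert 0 (Suc ` \<mu>))),
            after v (collapse (Suc n) ({..<Suc n} - insert 0 (Suc ` \<mu>))))) =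
          kmap ?cons (kmap unzip (list_shuffle xs v))"
    proof (cases p)
      case 0
      then show ?thesis using l by simp
    next
      case (Suc p')
      have "(\<Sum>\<mu> | \<mu> \<subseteq> {..<n} \<and> card \<mu> = p'. gen (after u (collapse (Suc n) (insert 0 (Suc ` \<mu>))),
            after v (collapse (Suc n) ({..<Suc n} - insert 0 (Suc ` \<mu>))))) = kmap ?cons (?S n p' xs v)"
        unfolding kmap_sum
        by (rule sum.cong)
           (auto simp: diff collapse_Suc_image collapse_Suc_insert finite_subset after_Cons after_Cons_Suc u v)
      also have "?S n p' xs v = kmap unzip (list_shuffle xs v)"
        by (rule Suc.IH[of _ _ _ q]) (use Suc l Suc.prems in auto)
      finally show ?thesis using Suc by simp
    qed
    have "\<not> (xs = [] \<and> ys = [])" using l Suc.prems by auto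
    then have "list_shuffle u v = kmap (Cons (x, y)) (list_shuffle xs v + list_shuffle u ys)"
      by (auto simp: u v)
    then have "kmap unzip (list_shuffle u v) =
        kmap ?cons (kmap unzip (list_shuffle u ys)) + kmap ?cons (kmap unzip (list_shuffle xs v))"
      by (simp add: kmap_kmap unzip_def add.commute)
    then show ?case
      unfolding sum_subsets_Suc 1 2 by simp
  qed
  from this[OF assms refl] show ?thesis by (simp add: shuffle_gen)
qed

subsection \<open>The Leibniz rule\<close>

text \<open>
  This boundary is augmented: the boundary of a list of length one is the empty list. In this form
  the recursion holds without exception.
\<close>

fun list_bd :: "'a list \<Rightarrow> ('a list \<Rightarrow>\<^sub>0 bit)" where
  "list_bd [] = 0"
| "list_bd (x # xs) = gen xs + kmap (Cons x) (list_bd xs)"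

lemma keys_list_bd: "u \<in> Poly_Mapping.keys (list_bd xs) \<Longrightarrow> Suc (length u) = length xs"
proof (induction xs arbitrary: u)
  case (Cons x xs)
  then have "u \<in> Poly_Mapping.keys (gen xs) \<or> u \<in> Poly_Mapping.keys (kmap (Cons x) (list_bd xs))"
    using keys_add_bit by fastforce
  then show ?case using keys_kmap[of "Cons x" "list_bd xs"] Cons.IH by auto
qed simp

lemma list_bd_eq_sum:
  "length xs = Suc n \<Longrightarrow> list_bd xs = (\<Sum>k\<le>n. gen (after xs (cofc n k)))"
proof (induction n arbitrary: xs)
  case 0
  then show ?case by (auto simp: length_Suc_conv after_def cofc_def)
next
  case (Suc n)
  obtain y ys where xs: "xs = y # ys" and l: "length ys = Suc n" using Suc.prems by (auto simp: length_Suc_conv)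
  have 0: "after xs (cofc (Suc n) 0) = ys"
    using l by (intro nth_equalityI) (auto simp: xs)
  have S: "after xs (cofc (Suc n) (Suc k)) = y # after ys (cofc n k)" for k
    by (rule nth_equalityI) (auto simp: xs nth_Cons split: nat.split)
  have "(\<Sum>k\<le>Suc n. gen (after xs (cofc (Suc n) k))) = gen ys + (\<Sum>k\<le>n. gen (y # after ys (cofc n k)))"
    by (simp only: sum.atMost_Suc_shift 0 S)
  then show ?case by (simp add: xs Suc.IH[OF l] kmap_sum)
qed

lemma bd_Words: "length l = Suc (Suc n) \<Longrightarrow> bd Words (Suc n) (gen l) = list_bd l"
  by (simp add: bd_gen list_bd_eq_sum del: sum.atMost_Suc)

text \<open>
  Deleting the initial vertex of a shuffle of \<open>x # xs\<close> and \<open>y # ys\<close> leaves the shuffles of \<open>xs\<close> with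
  \<open>y # ys\<close> and those of \<open>x # xs\<close> with \<open>ys\<close>. In the sum of the boundaries of these two, the shuffles
  of \<open>xs\<close> with \<open>ys\<close> occur twice: they are the diagonal moves, reached by deleting the corner of either
  of the two paths around the initial square. Two lists of length one have to be excluded, because
  the augmentation does not vanish on their shuffle.
\<close>

lemma list_shuffle_Leibniz:
  fixes xs :: "'a list" and ys :: "'b list"
  assumes "2 < length xs + length ys" "xs \<noteq> []" "ys \<noteq> []"
  shows "klin list_bd (list_shuffle xs ys) =
    klin (\<lambda>u. list_shuffle u ys) (list_bd xs) + klin (list_shuffle xs) (list_bd ys)"
  using assms
proof (induction xs ys rule: list_shuffle.induct)
  case (3 x xs y ys)
  let ?X = "x # xs" and ?Y = "y # ys" and ?v = "Cons (x, y)"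
  let ?S1 = "list_shuffle xs ?Y" and ?S2 = "list_shuffle ?X ys"
  have ne: "\<not> (xs = [] \<and> ys = [])" using 3(3) by auto
  consider "length xs = 1" "ys = []" | "xs = []" "length ys = 1"
    | "\<not> (length xs = 1 \<and> ys = [])" "\<not> (xs = [] \<and> length ys = 1)" by blast
  then show ?case
  proof cases
    case 1
    then obtain x' where "xs = [x']" by (auto simp: length_Suc_conv)
    then show ?thesis using 1 by (simp add: klin_add kmap_kmap add.commute)
  next
    case 2
    then obtain y' where "ys = [y']" by (auto simp: length_Suc_conv)
    then show ?thesis using 2 by (simp add: klin_add kmap_kmap add.commute)
  next
    case 3
    note no_corner = this
    have IH1: "klin list_bd ?S1 = klin (\<lambda>u. list_shuffle u ?Y) (list_bd xs) +
        (list_shuffle xs ys + klin (\<lambda>w. list_shuffle xs (y # w)) (list_bd ys))"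
    proof (cases "xs = []")
      case False
      then have "2 < length xs + length ?Y" using no_corner(1) by (cases xs; cases ys) auto
      from "3.IH"(1)[OF ne this False] show ?thesis by (simp add: klin_add klin_kmap)
    qed simp
    have IH2: "klin list_bd ?S2 = (list_shuffle xs ys + klin (\<lambda>u. list_shuffle (x # u) ys) (list_bd xs)) +
        klin (list_shuffle ?X) (list_bd ys)"
    proof (cases "ys = []")
      case False
      then have "2 < length ?X + length ys" using no_corner(2) by (cases xs; cases ys) auto
      from "3.IH"(2)[OF ne this _ False] show ?thesis by (simp add: klin_add klin_kmap)
    qed simp
    have "list_shuffle (x # u) ?Y = kmap ?v (list_shuffle u ?Y + list_shuffle (x # u) ys)"
      if "u \<in> Poly_Mapping.keys (list_bd xs)" for u
      using keys_list_bd[OF that] no_corner(1) by auto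
    then have R1: "klin (\<lambda>u. list_shuffle u ?Y) (list_bd ?X) = ?S1 +
        kmap ?v (klin (\<lambda>u. list_shuffle u ?Y) (list_bd xs) + klin (\<lambda>u. list_shuffle (x # u) ys) (list_bd xs))"
      by (simp add: klin_add klin_kmap kmap_klin klin_fun_add del: list_shuffle.simps cong: klin_cong)
    have "list_shuffle ?X (y # w) = kmap ?v (list_shuffle xs (y # w) + list_shuffle ?X w)"
      if "w \<in> Poly_Mapping.keys (list_bd ys)" for w
      using keys_list_bd[OF that] no_corner(2) by auto
    then have R2: "klin (list_shuffle ?X) (list_bd ?Y) = ?S2 +
        kmap ?v (klin (\<lambda>w. list_shuffle xs (y # w)) (list_bd ys) + klin (list_shuffle ?X) (list_bd ys))"
      by (simp add: klin_add klin_kmap kmap_klin klin_fun_add del: list_shuffle.simps cong: klin_cong)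
    have "list_shuffle ?X ?Y = kmap ?v (?S1 + ?S2)" using ne by auto
    then have "klin list_bd (list_shuffle ?X ?Y) = klin list_bd (kmap ?v (?S1 + ?S2))" by simp
    also have "\<dots> = (?S1 + ?S2) + kmap ?v (klin list_bd ?S1 + klin list_bd ?S2)"
      by (simp only: klin_kmap list_bd.simps klin_fun_add klin_gen_self kmap_klin[symmetric] klin_add kmap_add)
        (simp add: ac_simps)
    finally show ?thesis
      unfolding R1 R2 IH1 IH2 by (simp only: kmap_add) (simp add: ac_simps)
  qed
qed auto

lemma keys_list_shuffle: "l \<in> Poly_Mapping.keys (list_shuffle xs ys) \<Longrightarrow> Suc (length l) = length xs + length ys"
proof (induction xs ys arbitrary: l rule: list_shuffle.induct)
  case (3 x xs y ys)
  let ?c = "if xs = [] \<and> ys = [] then gen [] else list_shuffle xs (y # ys) + list_shuffle (x # xs) ys"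
  obtain l' where l: "l = (x, y) # l'" and l': "l' \<in> Poly_Mapping.keys ?c"
    using 3(3) keys_kmap[of "Cons (x, y)" ?c] by auto
  show ?case
  proof (cases "xs = [] \<and> ys = []")
    case False
    then have "l' \<in> Poly_Mapping.keys (list_shuffle xs (y # ys)) \<or> l' \<in> Poly_Mapping.keys (list_shuffle (x # xs) ys)"
      using l' keys_add_bit by fastforce
    then show ?thesis using "3.IH"(1,2)[OF False] l by auto
  qed (use l l' in auto)
qed auto

lemma shuffle_Leibniz_Words:
  assumes "length u = Suc p" "length v = Suc q"
  shows "bd (sprod Words Words) (p + q) (shuffle Words Words p q (gen u) (gen v)) =
    shuffle Words Words (p - 1) q (bd Words p (gen u)) (gen v) +
    shuffle Words Words p (q - 1) (gen u) (bd Words q (gen v))"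
proof (cases "p + q")
  case (Suc n)
  have keys: "length l = Suc (Suc n)" if "l \<in> Poly_Mapping.keys (list_shuffle u v)" for l
    using keys_list_shuffle[OF that] assms Suc by simp
  have 1: "shuffle Words Words (p - 1) q (bd Words p (gen u)) (gen v) =
      kmap unzip (klin (\<lambda>w. list_shuffle w v) (list_bd u))"
  proof (cases p)
    case 0
    then have "\<exists>x. u = [x]" using assms by (auto simp: length_Suc_conv)
    then show ?thesis using 0 by auto
  next
    case (Suc p')
    then have u: "length u = Suc (Suc p')" using assms by simp
    have "shuffle Words Words p' q (list_bd u) (gen v) =
        klin (\<lambda>w. shuffle Words Words p' q (gen w) (gen v)) (list_bd u)"
      using klin_compose[of "\<lambda>c. shuffle Words Words p' q c (gen v)" gen "list_bd u"]
      by (simp add: klin_gen_self)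
    also have "\<dots> = klin (\<lambda>w. kmap unzip (list_shuffle w v)) (list_bd u)"
      by (rule klin_cong) (use u assms(2) in \<open>auto intro!: shuffle_Words dest!: keys_list_bd\<close>)
    finally show ?thesis using Suc by (simp add: bd_Words u kmap_klin)
  qed
  have 2: "shuffle Words Words p (q - 1) (gen u) (bd Words q (gen v)) =
      kmap unzip (klin (list_shuffle u) (list_bd v))"
  proof (cases q)
    case 0
    then have "\<exists>x. v = [x]" using assms by (auto simp: length_Suc_conv)
    then show ?thesis using 0 by auto
  next
    case (Suc q')
    then have v: "length v = Suc (Suc q')" using assms by simp
    have "shuffle Words Words p q' (gen u) (list_bd v) =
        klin (\<lambda>w. shuffle Words Words p q' (gen u) (gen w)) (list_bd v)"
      using klin_compose[of "\<lambda>c. shuffle Words Words p q' (gen u) c" gen "list_bd v"]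
      by (simp add: klin_gen_self)
    also have "\<dots> = klin (\<lambda>w. kmap unzip (list_shuffle u w)) (list_bd v)"
      by (rule klin_cong) (use v assms(1) in \<open>auto intro!: shuffle_Words dest!: keys_list_bd\<close>)
    finally show ?thesis using Suc by (simp add: bd_Words v kmap_klin)
  qed
  have "list_shuffle u v \<in> free_on (cells Words (p + q))"
    using keys Suc by (auto simp: free_on_def)
  then have "bd (sprod Words Words) (p + q) (kmap unzip (list_shuffle u v)) =
      kmap unzip (bd Words (p + q) (list_shuffle u v))"
    using bd_natural[OF simplicial_map_unzip] by metis
  also have "bd Words (p + q) (list_shuffle u v) = klin (\<lambda>l. bd Words (p + q) (gen l)) (list_shuffle u v)"
    using klin_compose[of "bd Words (p + q)" gen "list_shuffle u v"] by (simp add: klin_gen_self)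
  also have "\<dots> = klin list_bd (list_shuffle u v)"
    by (rule klin_cong) (use keys Suc bd_Words in auto)
  also have "\<dots> = klin (\<lambda>w. list_shuffle w v) (list_bd u) + klin (list_shuffle u) (list_bd v)"
    by (rule list_shuffle_Leibniz) (use assms Suc in auto)
  finally show ?thesis
    by (simp only: shuffle_Words[OF assms] 1 2 kmap_add)
qed (use assms in auto)

text \<open>
  By naturality an identity of shuffles of simplices only has to be known for the fundamental
  simplices of standard simplices.
\<close>

lemma gen_eq_classifying:
  "simplicial_set Z \<Longrightarrow> x \<in> cells Z n \<Longrightarrow> gen x = kmap (\<lambda>u. sop Z n u x) (gen (id_map n))"
  by (simp add: simplicial_setD(2))

lemma id_map_in_free_on: "gen (id_map n) \<in> free_on (cells (Simplex n) n)"
  by simp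

theorem shuffle_Leibniz:
  assumes Z: "simplicial_set Z" and W: "simplicial_set W"
    and "a \<in> free_on (cells Z p)" "b \<in> free_on (cells W q)"
  shows "bd (sprod Z W) (p + q) (shuffle Z W p q a b) =
    shuffle Z W (p - 1) q (bd Z p a) b + shuffle Z W p (q - 1) a (bd W q b)"
proof (rule free_on_ext2[OF _ _ _ _ _ assms(3,4),
    of "\<lambda>a b. bd (sprod Z W) (p + q) (shuffle Z W p q a b)"
       "\<lambda>a b. shuffle Z W (p - 1) q (bd Z p a) b + shuffle Z W p (q - 1) a (bd W q b)"])
  fix x y assume x: "x \<in> cells Z p" and y: "y \<in> cells W q"
  let ?f = "\<lambda>u. sop Z p u x" and ?g = "\<lambda>u. sop W q u y"
  let ?D = "Simplex p" and ?E = "Simplex q"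
  let ?i = "gen (id_map p)" and ?j = "gen (id_map q)"
  note f = simplicial_map_classifying[OF Z x] and g = simplicial_map_classifying[OF W y]
  note D = simplicial_set_Simplex[of p] and E = simplicial_set_Simplex[of q]
  note i = id_map_in_free_on[of p] and j = id_map_in_free_on[of q]
  note bi = bd_in_free_on[OF D i] and bj = bd_in_free_on[OF E j]
  have "bd (sprod Z W) (p + q) (shuffle Z W p q (gen x) (gen y)) =
      bd (sprod Z W) (p + q) (kmap (map_prod ?f ?g) (shuffle ?D ?E p q ?i ?j))"
    by (simp only: gen_eq_classifying[OF Z x] gen_eq_classifying[OF W y] shuffle_natural[OF f g i j])
  also have "\<dots> = kmap (map_prod ?f ?g) (bd (sprod ?D ?E) (p + q) (shuffle ?D ?E p q ?i ?j))"
    using bd_natural[OF simplicial_map_sprod[OF f g] shuffle_in_free_on[OF D E i j]] by simp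
  also have "bd (sprod ?D ?E) (p + q) (shuffle ?D ?E p q ?i ?j) =
      shuffle ?D ?E (p - 1) q (bd ?D p ?i) ?j + shuffle ?D ?E p (q - 1) ?i (bd ?E q ?j)"
    unfolding bd_sprod_Simplex shuffle_Simplex bd_Simplex by (rule shuffle_Leibniz_Words) simp_all
  also have "kmap (map_prod ?f ?g) \<dots> =
      shuffle Z W (p - 1) q (kmap ?f (bd ?D p ?i)) (kmap ?g ?j) +
      shuffle Z W p (q - 1) (kmap ?f ?i) (kmap ?g (bd ?E q ?j))"
    using shuffle_natural[OF f g bi j] shuffle_natural[OF f g i bj] by simp
  also have "\<dots> = shuffle Z W (p - 1) q (bd Z p (gen x)) (gen y) + shuffle Z W p (q - 1) (gen x) (bd W q (gen y))"
    by (simp only: gen_eq_classifying[OF Z x] gen_eq_classifying[OF W y] bd_natural[OF f i] bd_natural[OF g j])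
  finally show "bd (sprod Z W) (p + q) (shuffle Z W p q (gen x) (gen y)) =
      shuffle Z W (p - 1) q (bd Z p (gen x)) (gen y) + shuffle Z W p (q - 1) (gen x) (bd W q (gen y))" .
qed simp_all

subsection \<open>The interchange of factors\<close>

definition mid_swap :: "('a \<times> 'b) \<times> ('c \<times> 'd) \<Rightarrow> ('a \<times> 'c) \<times> ('b \<times> 'd)" where
  "mid_swap = (\<lambda>((a, b), (c, d)). ((a, c), (b, d)))"

definition list_shuffle4 ::
  "'a list \<Rightarrow> 'b list \<Rightarrow> 'c list \<Rightarrow> 'd list \<Rightarrow> ((('a \<times> 'b) \<times> ('c \<times> 'd)) list \<Rightarrow>\<^sub>0 bit)" where
  "list_shuffle4 xs ys zs ws = klin (\<lambda>l. klin (list_shuffle l) (list_shuffle zs ws)) (list_shuffle xs ys)"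

lemma list_shuffle4_Nil [simp]:
  "list_shuffle4 [] ys zs ws = 0" "list_shuffle4 xs [] zs ws = 0"
  "list_shuffle4 xs ys [] ws = 0" "list_shuffle4 xs ys zs [] = 0"
  by (simp_all add: list_shuffle4_def)

text \<open>
  An iterated shuffle of four lists advances in exactly one of them at each step. This description
  does not depend on how the four lists are bracketed.
\<close>

lemma list_shuffle4_Cons:
  "list_shuffle4 (x # xs) (y # ys) (z # zs) (w # ws) = kmap (Cons ((x, y), (z, w)))
    (if xs = [] \<and> ys = [] \<and> zs = [] \<and> ws = [] then gen [] else
      list_shuffle4 xs (y # ys) (z # zs) (w # ws) + list_shuffle4 (x # xs) ys (z # zs) (w # ws) +
      list_shuffle4 (x # xs) (y # ys) zs (w # ws) + list_shuffle4 (x # xs) (y # ys) (z # zs) ws)"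
proof (cases "xs = [] \<and> ys = [] \<and> zs = [] \<and> ws = []")
  case True
  then show ?thesis by (simp add: list_shuffle4_def)
next
  case False
  let ?XY = "list_shuffle (x # xs) (y # ys)" and ?ZW = "list_shuffle (z # zs) (w # ws)"
  let ?a = "list_shuffle xs (y # ys) + list_shuffle (x # xs) ys"
  let ?b = "list_shuffle zs (w # ws) + list_shuffle (z # zs) ws"
  define A where "A = (if xs = [] \<and> ys = [] then gen [] else ?a)"
  define B where "B = (if zs = [] \<and> ws = [] then gen [] else ?b)"
  have XY: "?XY = kmap (Cons (x, y)) A" and ZW: "?ZW = kmap (Cons (z, w)) B"
    by (simp_all only: A_def B_def list_shuffle.simps)
  have A: "klin (\<lambda>l. F l) A = klin F ?a" if "F [] = 0" for F :: "('a \<times> 'b) list \<Rightarrow> ((('a \<times> 'b) \<times> ('c \<times> 'd)) list \<Rightarrow>\<^sub>0 bit)"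
    using that by (auto simp: A_def)
  have B: "klin (\<lambda>l. F l) B = klin F ?b" if "F [] = 0" for F :: "('c \<times> 'd) list \<Rightarrow> ((('a \<times> 'b) \<times> ('c \<times> 'd)) list \<Rightarrow>\<^sub>0 bit)"
    using that by (auto simp: B_def)
  have nonempty: "\<not> (l = [] \<and> l' = [])" if "l \<in> Poly_Mapping.keys A" "l' \<in> Poly_Mapping.keys B" for l l'
  proof
    assume l: "l = [] \<and> l' = []"
    have "[] \<notin> Poly_Mapping.keys ?a" if "\<not> (xs = [] \<and> ys = [])"
      using that keys_list_shuffle[of "[]" xs "y # ys"] keys_list_shuffle[of "[]" "x # xs" ys]
      unfolding keys_add_bit by (cases xs; cases ys) auto
    moreover have "[] \<notin> Poly_Mapping.keys ?b" if "\<not> (zs = [] \<and> ws = [])"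
      using that keys_list_shuffle[of "[]" zs "w # ws"] keys_list_shuffle[of "[]" "z # zs" ws]
      unfolding keys_add_bit by (cases zs; cases ws) auto
    ultimately show False using False that l by (auto simp: A_def B_def split: if_splits)
  qed
  have "list_shuffle4 (x # xs) (y # ys) (z # zs) (w # ws) =
      klin (\<lambda>l. klin (\<lambda>l'. list_shuffle ((x, y) # l) ((z, w) # l')) B) A"
    unfolding list_shuffle4_def XY ZW klin_kmap ..
  also have "\<dots> = klin (\<lambda>l. klin (\<lambda>l'. kmap (Cons ((x, y), (z, w)))
      (list_shuffle l ((z, w) # l') + list_shuffle ((x, y) # l) l')) B) A"
    by (intro klin_cong refl) (use nonempty in auto)
  also have "\<dots> = kmap (Cons ((x, y), (z, w)))
      (klin (\<lambda>l. klin (\<lambda>l'. list_shuffle l ((z, w) # l')) B) A +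
       klin (\<lambda>l. klin (\<lambda>l'. list_shuffle ((x, y) # l) l') B) A)"
    by (simp only: kmap_klin klin_fun_add kmap_add)
  also have "klin (\<lambda>l. klin (\<lambda>l'. list_shuffle l ((z, w) # l')) B) A = klin (\<lambda>l. klin (list_shuffle l) ?ZW) ?a"
    unfolding ZW klin_kmap by (rule A) simp
  also have "klin (\<lambda>l. klin (\<lambda>l'. list_shuffle ((x, y) # l) l') B) A =
      klin (\<lambda>l. klin (list_shuffle ((x, y) # l)) ?b) A"
    by (intro klin_cong refl B) simp
  also have "\<dots> = klin (\<lambda>l. klin (list_shuffle l) ?b) ?XY"
    unfolding XY klin_kmap ..
  finally show ?thesis
    using False by (simp only: list_shuffle4_def klin_add klin_fun_add if_False add.assoc)
qed

lemma list_shuffle4_interchange: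
  "list_shuffle4 xs ys zs ws = kmap (map mid_swap) (list_shuffle4 xs zs ys ws)"
proof (induction "length xs + length ys + length zs + length ws" arbitrary: xs ys zs ws rule: less_induct)
  case less
  show ?case
  proof (cases "xs = [] \<or> ys = [] \<or> zs = [] \<or> ws = []")
    case False
    then obtain x xs' y ys' z zs' w ws' where "xs = x # xs'" "ys = y # ys'" "zs = z # zs'" "ws = w # ws'"
      by (metis neq_Nil_conv)
    note eq = this
    have IH: "list_shuffle4 a b c d = kmap (map mid_swap) (list_shuffle4 a c b d)"
      if "length a + length b + length c + length d < length xs + length ys + length zs + length ws"
      for a :: "'a list" and b :: "'b list" and c :: "'c list" and d :: "'d list"
      using less that by blast
    show ?thesis
    proof (cases "xs' = [] \<and> ys' = [] \<and> zs' = [] \<and> ws' = []")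
      case True
      then show ?thesis by (simp add: eq list_shuffle4_Cons mid_swap_def)
    next
      case False
      have "list_shuffle4 xs ys zs ws = kmap (Cons ((x, y), (z, w)))
          (kmap (map mid_swap) (list_shuffle4 xs' zs ys ws + list_shuffle4 xs zs ys' ws +
            list_shuffle4 xs zs' ys ws + list_shuffle4 xs zs ys ws'))"
        unfolding kmap_add
        by (subst IH[symmetric], simp add: eq)+ (use False in \<open>simp only: eq list_shuffle4_Cons if_False kmap_add\<close>)
      also have "\<dots> = kmap (map mid_swap) (kmap (Cons ((x, z), (y, w)))
          (list_shuffle4 xs' zs ys ws + list_shuffle4 xs zs ys' ws +
            list_shuffle4 xs zs' ys ws + list_shuffle4 xs zs ys ws'))"
        by (simp only: kmap_kmap list.map) (simp add: mid_swap_def)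
      also have "kmap (Cons ((x, z), (y, w)))
          (list_shuffle4 xs' zs ys ws + list_shuffle4 xs zs ys' ws +
            list_shuffle4 xs zs' ys ws + list_shuffle4 xs zs ys ws') = list_shuffle4 xs zs ys ws"
        using False by (auto simp: eq list_shuffle4_Cons ac_simps)
      finally show ?thesis .
    qed
  qed auto
qed

lemma shuffle_shuffle_Words:
  assumes "length xs = Suc p1" "length ys = Suc p2" "length zs = Suc p3" "length ws = Suc p4"
  shows "shuffle (sprod Words Words) (sprod Words Words) (p1 + p2) (p3 + p4)
      (shuffle Words Words p1 p2 (gen xs) (gen ys)) (shuffle Words Words p3 p4 (gen zs) (gen ws)) =
    kmap (\<lambda>l. map_prod unzip unzip (unzip l)) (list_shuffle4 xs ys zs ws)"
proof -
  have l: "list_shuffle xs ys \<in> free_on (cells Words (p1 + p2))" "list_shuffle zs ws \<in> free_on (cells Words (p3 + p4))"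
    using keys_list_shuffle[of _ xs ys] keys_list_shuffle[of _ zs ws] assms by (auto simp: free_on_def)
  have "shuffle (sprod Words Words) (sprod Words Words) (p1 + p2) (p3 + p4)
      (shuffle Words Words p1 p2 (gen xs) (gen ys)) (shuffle Words Words p3 p4 (gen zs) (gen ws)) =
    kmap (map_prod unzip unzip) (shuffle Words Words (p1 + p2) (p3 + p4) (list_shuffle xs ys) (list_shuffle zs ws))"
    by (simp only: shuffle_Words assms shuffle_natural[OF simplicial_map_unzip simplicial_map_unzip l])
  also have "shuffle Words Words (p1 + p2) (p3 + p4) (list_shuffle xs ys) (list_shuffle zs ws) =
      klin (\<lambda>l. klin (\<lambda>l'. kmap unzip (list_shuffle l l')) (list_shuffle zs ws)) (list_shuffle xs ys)"
    by (rule free_on_ext2[OF _ _ _ _ _ l]) (simp_all add: klin_add klin_fun_add shuffle_Words)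
  also have "\<dots> = kmap unzip (list_shuffle4 xs ys zs ws)"
    by (simp add: list_shuffle4_def kmap_klin)
  finally show ?thesis by (simp add: kmap_kmap)
qed

text \<open>
  By naturality this is the corresponding statement about iterated shuffles of four lists of vertices.
\<close>

theorem shuffle_interchange:
  assumes Z: "simplicial_set Z1" "simplicial_set Z2" "simplicial_set Z3" "simplicial_set Z4"
    and a: "a1 \<in> free_on (cells Z1 p1)" "a2 \<in> free_on (cells Z2 p2)"
      "a3 \<in> free_on (cells Z3 p3)" "a4 \<in> free_on (cells Z4 p4)"
  shows "kmap mid_swap (shuffle (sprod Z1 Z2) (sprod Z3 Z4) (p1 + p2) (p3 + p4)
      (shuffle Z1 Z2 p1 p2 a1 a2) (shuffle Z3 Z4 p3 p4 a3 a4)) =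
    shuffle (sprod Z1 Z3) (sprod Z2 Z4) (p1 + p3) (p2 + p4)
      (shuffle Z1 Z3 p1 p3 a1 a3) (shuffle Z2 Z4 p2 p4 a2 a4)" (is "?L a1 a2 a3 a4 = ?R a1 a2 a3 a4")
proof (rule free_on_ext2[OF _ _ _ _ _ a(1,2), of "\<lambda>a1 a2. ?L a1 a2 a3 a4" "\<lambda>a1 a2. ?R a1 a2 a3 a4"])
  fix x1 x2 assume x12: "x1 \<in> cells Z1 p1" "x2 \<in> cells Z2 p2"
  show "?L (gen x1) (gen x2) a3 a4 = ?R (gen x1) (gen x2) a3 a4"
  proof (rule free_on_ext2[OF _ _ _ _ _ a(3,4), of "?L (gen x1) (gen x2)" "?R (gen x1) (gen x2)"])
    fix x3 x4 assume x34: "x3 \<in> cells Z3 p3" "x4 \<in> cells Z4 p4"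
    let ?f1 = "\<lambda>u. sop Z1 p1 u x1" and ?f2 = "\<lambda>u. sop Z2 p2 u x2"
      and ?f3 = "\<lambda>u. sop Z3 p3 u x3" and ?f4 = "\<lambda>u. sop Z4 p4 u x4"
    let ?i = "\<lambda>n. gen (id_map n)"
    note f1 = simplicial_map_classifying[OF Z(1) x12(1)] and f2 = simplicial_map_classifying[OF Z(2) x12(2)]
    note f3 = simplicial_map_classifying[OF Z(3) x34(1)] and f4 = simplicial_map_classifying[OF Z(4) x34(2)]
    note S = simplicial_set_Simplex and i = id_map_in_free_on
    note x = gen_eq_classifying[OF Z(1) x12(1)] gen_eq_classifying[OF Z(2) x12(2)]
      gen_eq_classifying[OF Z(3) x34(1)] gen_eq_classifying[OF Z(4) x34(2)]
    have "?L (gen x1) (gen x2) (gen x3) (gen x4) = kmap mid_swap (kmap (map_prod (map_prod ?f1 ?f2) (map_prod ?f3 ?f4))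
        (shuffle (sprod (Simplex p1) (Simplex p2)) (sprod (Simplex p3) (Simplex p4)) (p1 + p2) (p3 + p4)
          (shuffle (Simplex p1) (Simplex p2) p1 p2 (?i p1) (?i p2))
          (shuffle (Simplex p3) (Simplex p4) p3 p4 (?i p3) (?i p4))))"
      unfolding x
      by (simp only: shuffle_natural[OF f1 f2 i i, symmetric] shuffle_natural[OF f3 f4 i i, symmetric]
          shuffle_natural[OF simplicial_map_sprod[OF f1 f2] simplicial_map_sprod[OF f3 f4]
            shuffle_in_free_on[OF S S i i] shuffle_in_free_on[OF S S i i]])
    also have "\<dots> = kmap (map_prod (map_prod ?f1 ?f3) (map_prod ?f2 ?f4))
        (kmap mid_swap (kmap (\<lambda>l. map_prod unzip unzip (unzip l))
          (list_shuffle4 (id_map p1) (id_map p2) (id_map p3) (id_map p4))))"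
      unfolding shuffle_Simplex shuffle_sprod_Simplex
      by (subst shuffle_shuffle_Words) (auto simp: kmap_kmap mid_swap_def unzip_def split_beta)
    also have "\<dots> = kmap (map_prod (map_prod ?f1 ?f3) (map_prod ?f2 ?f4))
        (kmap (\<lambda>l. map_prod unzip unzip (unzip l))
          (list_shuffle4 (id_map p1) (id_map p3) (id_map p2) (id_map p4)))"
      by (subst list_shuffle4_interchange) (simp add: kmap_kmap unzip_def mid_swap_def split_beta comp_def)
    also have "\<dots> = kmap (map_prod (map_prod ?f1 ?f3) (map_prod ?f2 ?f4))
        (shuffle (sprod (Simplex p1) (Simplex p3)) (sprod (Simplex p2) (Simplex p4)) (p1 + p3) (p2 + p4)
          (shuffle (Simplex p1) (Simplex p3) p1 p3 (?i p1) (?i p3))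
          (shuffle (Simplex p2) (Simplex p4) p2 p4 (?i p2) (?i p4)))"
      unfolding shuffle_Simplex shuffle_sprod_Simplex
      by (subst shuffle_shuffle_Words) auto
    also have "\<dots> = ?R (gen x1) (gen x2) (gen x3) (gen x4)"
      unfolding x
      by (simp only: shuffle_natural[OF f1 f3 i i, symmetric] shuffle_natural[OF f2 f4 i i, symmetric]
          shuffle_natural[OF simplicial_map_sprod[OF f1 f3] simplicial_map_sprod[OF f2 f4]
            shuffle_in_free_on[OF S S i i] shuffle_in_free_on[OF S S i i]])
    finally show "?L (gen x1) (gen x2) (gen x3) (gen x4) = ?R (gen x1) (gen x2) (gen x3) (gen x4)" .
  qed simp_all
qed simp_all

section \<open>Chains in integral degrees\<close>

text \<open>
  Degrees are integers from here on, as in the total complex. There are no nonzero chains in negative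
  degrees. So the formulas for boundaries and shuffles, with \<open>nat i\<close> in place of the degree, hold for
  all integers.
\<close>

definition chn :: "'a sspace \<Rightarrow> int \<Rightarrow> ('a \<Rightarrow>\<^sub>0 bit) set" where
  "chn Z i = (if i < 0 then {0} else free_on (cells Z (nat i)))"

definition dgn :: "'a sspace \<Rightarrow> int \<Rightarrow> ('a \<Rightarrow>\<^sub>0 bit) set" where
  "dgn Z i = (if i < 0 then {0} else degen Z (nat i))"

lemma chain_S_space:
  "carr (chain (S_space Z) i) = chn Z i" "rel (chain (S_space Z) i) = dgn Z i"
  by (simp_all add: S_space_def Norm_def KS_def zero_kmod_def chn_def dgn_def degen_def free_on_def Let_def)

lemma bdry_S_space: "bdry (S_space Z) i x = bd Z (nat i) x"
  by (simp add: S_space_def Norm_def KS_def bd_def Let_def)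

lemma submodule_zero_only: "submodule {0}"
  by (simp add: submodule_def)

lemma submodule_chn: "submodule (chn Z i)"
  by (simp add: chn_def submodule_free_on submodule_zero_only)

lemma submodule_dgn: "submodule (dgn Z i)"
  by (simp add: dgn_def submodule_degen submodule_zero_only)

lemma dgn_subset_chn: "simplicial_set Z \<Longrightarrow> dgn Z i \<subseteq> chn Z i"
  by (simp add: dgn_def chn_def degen_subset_free_on)

lemma kmap_chn:
  assumes "simplicial_map Z W h" "a \<in> chn Z i"
  shows "kmap (h (nat i)) a \<in> chn W i"
  using assms by (auto simp: chn_def split: if_splits intro!: kmap_in_free_on[where A = "cells Z (nat i)"] dest: simplicial_mapD(1))

lemma kmap_dgn:
  assumes "simplicial_set Z" "simplicial_set W" "simplicial_map Z W h" "a \<in> dgn Z i"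
  shows "kmap (h (nat i)) a \<in> dgn W i"
  using assms by (auto simp: dgn_def split: if_splits intro: kmap_degen)

lemma chn_free_on: "a \<in> chn Z i \<Longrightarrow> a \<in> free_on (cells Z (nat i))"
  by (auto simp: chn_def submodule_zero[OF submodule_free_on] split: if_splits)

lemma bd_chn: "simplicial_set Z \<Longrightarrow> a \<in> chn Z i \<Longrightarrow> bd Z (nat i) a \<in> chn Z (i - 1)"
  using bd_in_free_on[of Z a "nat i"]
  by (cases "i \<le> 0") (auto simp: chn_def nat_diff_distrib' split: if_splits intro: submodule_zero[OF submodule_free_on])

lemma bd_dgn: "simplicial_set Z \<Longrightarrow> a \<in> dgn Z i \<Longrightarrow> bd Z (nat i) a \<in> dgn Z (i - 1)"
  using bd_degen[of Z a "nat i"]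
  by (cases "i \<le> 0") (auto simp: dgn_def nat_diff_distrib' split: if_splits intro: submodule_zero[OF submodule_degen])

lemma nat_minus_one: "nat (i - 1) = nat i - 1"
  by simp

lemma bd_natural_int:
  "simplicial_map Z W h \<Longrightarrow> a \<in> chn Z i \<Longrightarrow> kmap (h (nat (i - 1))) (bd Z (nat i) a) = bd W (nat i) (kmap (h (nat i)) a)"
  unfolding nat_minus_one by (intro bd_natural chn_free_on)

lemma bd_bd_int: "simplicial_set Z \<Longrightarrow> a \<in> chn Z i \<Longrightarrow> bd Z (nat (i - 1)) (bd Z (nat i) a) = 0"
  unfolding nat_minus_one by (intro bd_bd chn_free_on)

lemma shuffle_chn:
  assumes "simplicial_set Z" "simplicial_set W" "a \<in> chn Z i" "b \<in> chn W i'"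
  shows "shuffle Z W (nat i) (nat i') a b \<in> chn (sprod Z W) (i + i')"
proof (cases "i < 0 \<or> i' < 0")
  case True
  then have "a = 0 \<or> b = 0" using assms by (auto simp: chn_def)
  then show ?thesis by (auto intro: submodule_zero[OF submodule_chn])
next
  case False
  then show ?thesis
    using shuffle_in_free_on[OF assms(1,2), of a "nat i" b "nat i'"] assms(3,4)
    by (simp add: chn_def nat_add_distrib)
qed

lemma shuffle_dgn_left:
  assumes "simplicial_set Z" "simplicial_set W" "a \<in> dgn Z i" "b \<in> chn W i'"
  shows "shuffle Z W (nat i) (nat i') a b \<in> dgn (sprod Z W) (i + i')"
proof (cases "i < 0 \<or> i' < 0")
  case True
  then have "a = 0 \<or> b = 0" using assms by (auto simp: chn_def dgn_def)
  then show ?thesis by (auto intro: submodule_zero[OF submodule_dgn])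
next
  case False
  then show ?thesis
    using shuffle_degen_left[OF assms(1,2), of a "nat i" b "nat i'"] assms(3,4)
    by (simp add: chn_def dgn_def nat_add_distrib)
qed

lemma shuffle_dgn_right:
  assumes "simplicial_set Z" "simplicial_set W" "a \<in> chn Z i" "b \<in> dgn W i'"
  shows "shuffle Z W (nat i) (nat i') a b \<in> dgn (sprod Z W) (i + i')"
proof (cases "i < 0 \<or> i' < 0")
  case True
  then have "a = 0 \<or> b = 0" using assms by (auto simp: chn_def dgn_def)
  then show ?thesis by (auto intro: submodule_zero[OF submodule_dgn])
next
  case False
  then show ?thesis
    using shuffle_degen_right[OF assms(1,2), of a "nat i" b "nat i'"] assms(3,4)
    by (simp add: chn_def dgn_def nat_add_distrib)
qed

lemma shuffle_natural_int:
  assumes "simplicial_map Z Z' f" "simplicial_map W W' g" "a \<in> chn Z i" "b \<in> chn W i'"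
  shows "kmap (map_prod (f (nat (i + i'))) (g (nat (i + i')))) (shuffle Z W (nat i) (nat i') a b) =
    shuffle Z' W' (nat i) (nat i') (kmap (f (nat i)) a) (kmap (g (nat i')) b)"
proof (cases "i < 0 \<or> i' < 0")
  case True
  then have "a = 0 \<or> b = 0" using assms by (auto simp: chn_def)
  then show ?thesis by auto
next
  case False
  then have n: "nat (i + i') = nat i + nat i'" by (simp add: nat_add_distrib)
  show ?thesis unfolding n by (intro shuffle_natural assms chn_free_on)
qed

lemma shuffle_Leibniz_int:
  assumes "simplicial_set Z" "simplicial_set W" "a \<in> chn Z i" "b \<in> chn W i'"
  shows "bd (sprod Z W) (nat (i + i')) (shuffle Z W (nat i) (nat i') a b) =
    shuffle Z W (nat (i - 1)) (nat i') (bd Z (nat i) a) b + shuffle Z W (nat i) (nat (i' - 1)) a (bd W (nat i') b)"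
proof (cases "i < 0 \<or> i' < 0")
  case True
  then have "a = 0 \<or> b = 0" using assms by (auto simp: chn_def)
  then show ?thesis by auto
next
  case False
  then have n: "nat (i + i') = nat i + nat i'" by (simp add: nat_add_distrib)
  show ?thesis unfolding n nat_minus_one by (intro shuffle_Leibniz assms chn_free_on)
qed


section \<open>Conormalization\<close>

abbreviation cm :: "'a cospace \<Rightarrow> nat \<Rightarrow> nat list \<Rightarrow> int \<Rightarrow> ('a \<Rightarrow>\<^sub>0 bit) \<Rightarrow> ('a \<Rightarrow>\<^sub>0 bit)" where
  "cm X n \<theta> i \<equiv> kmap (cop X n \<theta> (nat i))"

lemma cosimplicial_spaceD:
  assumes "cosimplicial_space X"
  shows "simplicial_set (lev X p)"
    and "\<theta> \<in> mono_maps m n \<Longrightarrow> simplicial_map (lev X m) (lev X n) (cop X n \<theta>)"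
    and "x \<in> cells (lev X n) q \<Longrightarrow> cop X n (id_map n) q x = x"
    and "\<theta> \<in> mono_maps m n \<Longrightarrow> \<eta> \<in> mono_maps l m \<Longrightarrow> x \<in> cells (lev X l) q \<Longrightarrow>
      cop X n \<theta> q (cop X m \<eta> q x) = cop X n (after \<theta> \<eta>) q x"
  using assms unfolding cosimplicial_space_def by blast+

lemma clev_S_co: "clev (S_co X) p = S_space (lev X p)"
  by (simp add: S_co_def Norm_co_def KC_def S_space_def)

lemma ccop_S_co: "ccop (S_co X) n \<theta> i = cm X n \<theta> i"
  by (simp add: S_co_def Norm_co_def KC_def)

lemma cm_chn: "cosimplicial_space X \<Longrightarrow> \<theta> \<in> mono_maps m n \<Longrightarrow> a \<in> chn (lev X m) i \<Longrightarrow> cm X n \<theta> i a \<in> chn (lev X n) i"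
  by (rule kmap_chn[OF cosimplicial_spaceD(2)])

lemma cm_dgn: "cosimplicial_space X \<Longrightarrow> \<theta> \<in> mono_maps m n \<Longrightarrow> a \<in> dgn (lev X m) i \<Longrightarrow> cm X n \<theta> i a \<in> dgn (lev X n) i"
  by (rule kmap_dgn[OF cosimplicial_spaceD(1) cosimplicial_spaceD(1) cosimplicial_spaceD(2)])

lemma cm_comp:
  assumes "cosimplicial_space X" "\<theta> \<in> mono_maps m n" "\<eta> \<in> mono_maps l m" "a \<in> chn (lev X l) i"
  shows "cm X n \<theta> i (cm X m \<eta> i a) = cm X n (after \<theta> \<eta>) i a"
  unfolding kmap_kmap
  by (rule kmap_cong) (use cosimplicial_spaceD(4)[OF assms(1-3)] free_on_keys[OF chn_free_on[OF assms(4)]] in auto)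

lemma cm_id: "cosimplicial_space X \<Longrightarrow> a \<in> chn (lev X n) i \<Longrightarrow> cm X n (id_map n) i a = a"
  by (rule kmap_id) (blast intro: cosimplicial_spaceD(3) free_on_keys chn_free_on)

lemma cm_bd:
  assumes "cosimplicial_space X" "\<theta> \<in> mono_maps m n" "a \<in> chn (lev X m) i"
  shows "cm X n \<theta> (i - 1) (bd (lev X m) (nat i) a) = bd (lev X n) (nat i) (cm X n \<theta> i a)"
  by (rule bd_natural_int[OF cosimplicial_spaceD(2)[OF assms(1,2)] assms(3)])

abbreviation coface :: "'a cospace \<Rightarrow> nat \<Rightarrow> nat \<Rightarrow> int \<Rightarrow> ('a \<Rightarrow>\<^sub>0 bit) \<Rightarrow> ('a \<Rightarrow>\<^sub>0 bit)" where
  "coface X p k \<equiv> cm X p (cofc p k)"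

abbreviation codeg :: "'a cospace \<Rightarrow> nat \<Rightarrow> nat \<Rightarrow> int \<Rightarrow> ('a \<Rightarrow>\<^sub>0 bit) \<Rightarrow> ('a \<Rightarrow>\<^sub>0 bit)" where
  "codeg X p k \<equiv> cm X p (codg p k)"

lemma coface_chn: "cosimplicial_space X \<Longrightarrow> a \<in> chn (lev X p) i \<Longrightarrow> coface X (Suc p) k i a \<in> chn (lev X (Suc p)) i"
  by (rule cm_chn[OF _ cofc_in_mono_maps])

lemma coface_dgn: "cosimplicial_space X \<Longrightarrow> a \<in> dgn (lev X p) i \<Longrightarrow> coface X (Suc p) k i a \<in> dgn (lev X (Suc p)) i"
  by (rule cm_dgn[OF _ cofc_in_mono_maps])

lemma codeg_chn: "cosimplicial_space X \<Longrightarrow> k \<le> p \<Longrightarrow> a \<in> chn (lev X (Suc p)) i \<Longrightarrow> codeg X p k i a \<in> chn (lev X p) i"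
  by (rule cm_chn[OF _ codg_in_mono_maps])

lemma codeg_dgn: "cosimplicial_space X \<Longrightarrow> k \<le> p \<Longrightarrow> a \<in> dgn (lev X (Suc p)) i \<Longrightarrow> codeg X p k i a \<in> dgn (lev X p) i"
  by (rule cm_dgn[OF _ codg_in_mono_maps])

lemma coface_coface:
  assumes "cosimplicial_space X" "a \<in> chn (lev X p) i" "k < j"
  shows "coface X (Suc (Suc p)) j i (coface X (Suc p) k i a) = coface X (Suc (Suc p)) k i (coface X (Suc p) (j - 1) i a)"
  by (simp only: cm_comp[OF assms(1) cofc_in_mono_maps cofc_in_mono_maps assms(2)] cofc_cofc[OF assms(3)])

lemma codeg_coface_id:
  assumes "cosimplicial_space X" "a \<in> chn (lev X p) i" "j \<le> p" "k = j \<or> k = Suc j"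
  shows "codeg X p j i (coface X (Suc p) k i a) = a"
  by (simp only: cm_comp[OF assms(1) codg_in_mono_maps[OF assms(3)] cofc_in_mono_maps assms(2)]
      codg_cofc_id[OF assms(4)] cm_id[OF assms(1,2)])

lemma codeg_coface_less:
  assumes "cosimplicial_space X" "a \<in> chn (lev X (Suc p)) i" "k < j" "j \<le> Suc p"
  shows "codeg X (Suc p) j i (coface X (Suc (Suc p)) k i a) = coface X (Suc p) k i (codeg X p (j - 1) i a)"
proof -
  have "j - 1 \<le> p" using assms by simp
  then show ?thesis
    by (simp only: cm_comp[OF assms(1) codg_in_mono_maps[OF assms(4)] cofc_in_mono_maps assms(2)]
      cm_comp[OF assms(1) cofc_in_mono_maps codg_in_mono_maps assms(2)] codg_cofc_less[OF assms(3,4)])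
qed

lemma codeg_coface_greater:
  assumes "cosimplicial_space X" "a \<in> chn (lev X (Suc p)) i" "Suc j < k" "k \<le> Suc (Suc p)"
  shows "codeg X (Suc p) j i (coface X (Suc (Suc p)) k i a) = coface X (Suc p) (k - 1) i (codeg X p j i a)"
proof -
  have j: "j \<le> p" "j \<le> Suc p" using assms by simp_all
  show ?thesis
    by (simp only: cm_comp[OF assms(1) codg_in_mono_maps[OF j(2)] cofc_in_mono_maps assms(2)]
      cm_comp[OF assms(1) cofc_in_mono_maps codg_in_mono_maps[OF j(1)] assms(2)] codg_cofc_greater[OF assms(3,4)])
qed

lemma codeg_codeg:
  assumes "cosimplicial_space X" "a \<in> chn (lev X (Suc (Suc p))) i" "k < j" "j \<le> Suc p"
  shows "codeg X p k i (codeg X (Suc p) j i a) = codeg X p (j - 1) i (codeg X (Suc p) k i a)"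
proof -
  have k: "k \<le> p" "k \<le> Suc p" "j - 1 \<le> p" using assms by simp_all
  show ?thesis
    by (simp only: cm_comp[OF assms(1) codg_in_mono_maps[OF k(1)] codg_in_mono_maps[OF assms(4)] assms(2)]
      cm_comp[OF assms(1) codg_in_mono_maps[OF k(3)] codg_in_mono_maps[OF k(2)] assms(2)] codg_codg[OF assms(3,4)])
qed

definition conorm_rel :: "'a cospace \<Rightarrow> nat \<Rightarrow> int \<Rightarrow> ('a \<Rightarrow>\<^sub>0 bit) set" where
  "conorm_rel X p i = kspan (dgn (lev X p) i \<union> (\<Union>k\<in>{1..p}. coface X p k i ` chn (lev X (p - 1)) i))"

lemma bimod_conorm:
  "bimod (conorm (S_co X)) (- int p) i = \<lparr>carr = chn (lev X p) i, rel = conorm_rel X p i\<rparr>"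
  by (simp add: conorm_def clev_S_co ccop_S_co chain_S_space conorm_rel_def)

lemma submodule_conorm_rel: "submodule (conorm_rel X p i)"
  unfolding conorm_rel_def by (rule submodule_kspan)

lemma dgn_subset_conorm_rel: "dgn (lev X p) i \<subseteq> conorm_rel X p i"
  unfolding conorm_rel_def using kspan_base by blast

lemma coface_in_conorm_rel: "a \<in> chn (lev X p) i \<Longrightarrow> 1 \<le> k \<Longrightarrow> k \<le> Suc p \<Longrightarrow> coface X (Suc p) k i a \<in> conorm_rel X (Suc p) i"
  unfolding conorm_rel_def by (intro kspan_base UnI2 UN_I[of k]) auto

lemma conorm_rel_image:
  fixes F :: "('a \<Rightarrow>\<^sub>0 bit) \<Rightarrow> 'v::ab_group_add"
  assumes "\<And>x y. F (x + y) = F x + F y" "submodule S"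
    and "\<And>a. a \<in> dgn (lev X p) i \<Longrightarrow> F a \<in> S"
    and "\<And>p' k a. p = Suc p' \<Longrightarrow> 1 \<le> k \<Longrightarrow> k \<le> p \<Longrightarrow> a \<in> chn (lev X p') i \<Longrightarrow> F (coface X p k i a) \<in> S"
    and a: "a \<in> conorm_rel X p i"
  shows "F a \<in> S"
proof (rule kspan_image[OF assms(1,2) _ a[unfolded conorm_rel_def]])
  fix b assume "b \<in> dgn (lev X p) i \<union> (\<Union>k\<in>{1..p}. coface X p k i ` chn (lev X (p - 1)) i)"
  then show "F b \<in> S"
  proof
    assume "b \<in> (\<Union>k\<in>{1..p}. coface X p k i ` chn (lev X (p - 1)) i)"
    then obtain k c where "1 \<le> k" "k \<le> p" "c \<in> chn (lev X (p - 1)) i" "b = coface X p k i c" by auto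
    then show ?thesis using assms(4)[of "p - 1" k c] by simp
  qed (rule assms(3))
qed

lemma conorm_rel_subset_chn:
  assumes X: "cosimplicial_space X"
  shows "conorm_rel X p i \<subseteq> chn (lev X p) i"
proof
  fix a assume "a \<in> conorm_rel X p i"
  then show "a \<in> chn (lev X p) i"
  proof (rule conorm_rel_image[OF _ submodule_chn, rotated -1, of a X p i "\<lambda>x. x"])
    show "b \<in> chn (lev X p) i" if "b \<in> dgn (lev X p) i" for b
      using that dgn_subset_chn[OF cosimplicial_spaceD(1)[OF X]] by blast
    show "coface X p k i b \<in> chn (lev X p) i" if "p = Suc p'" "b \<in> chn (lev X p') i" for p' k b
      unfolding that(1) by (rule coface_chn[OF X that(2)])
  qed simp
qed

subsection \<open>Normalized representatives\<close>

definition normalized :: "'a cospace \<Rightarrow> nat \<Rightarrow> int \<Rightarrow> ('a \<Rightarrow>\<^sub>0 bit) \<Rightarrow> bool" where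
  "normalized X p i y \<longleftrightarrow> y \<in> chn (lev X p) i \<and>
     (\<forall>k<p. codeg X (p - 1) k i y \<in> dgn (lev X (p - 1)) i)"

lemma normalized_add: "normalized X p i y \<Longrightarrow> normalized X p i z \<Longrightarrow> normalized X p i (y + z)"
  by (simp add: normalized_def submodule_add[OF submodule_chn] submodule_add[OF submodule_dgn])

text \<open>
  The factors \<open>1 + d\<^sup>k\<^sup>+\<^sup>1 s\<^sup>k\<close>, multiplied in this order, give the projection onto the common kernel of
  the codegeneracies along the images of the cofaces \<open>d\<^sup>k\<close> with \<open>k \<ge> 1\<close>.
\<close>

primrec conorm_proj :: "'a cospace \<Rightarrow> nat \<Rightarrow> int \<Rightarrow> nat \<Rightarrow> ('a \<Rightarrow>\<^sub>0 bit) \<Rightarrow> ('a \<Rightarrow>\<^sub>0 bit)" where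
  "conorm_proj X p i 0 y = y"
| "conorm_proj X p i (Suc k) y = conorm_proj X p i k y +
     coface X p (Suc k) i (codeg X (p - 1) k i (conorm_proj X p i k y))"

lemma conorm_proj_add: "conorm_proj X p i k (y + z) = conorm_proj X p i k y + conorm_proj X p i k z"
  by (induction k) (simp_all add: ac_simps)

context
  fixes X :: "'a cospace"
  assumes X: "cosimplicial_space X"
begin

lemma conorm_proj_chn: "y \<in> chn (lev X p) i \<Longrightarrow> k \<le> p \<Longrightarrow> conorm_proj X p i k y \<in> chn (lev X p) i"
proof (induction k)
  case (Suc k)
  then show ?case
    by (cases p) (auto intro!: submodule_add[OF submodule_chn] coface_chn codeg_chn X)
qed simp

lemma conorm_proj_dgn: "y \<in> dgn (lev X p) i \<Longrightarrow> k \<le> p \<Longrightarrow> conorm_proj X p i k y \<in> dgn (lev X p) i"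
proof (induction k)
  case (Suc k)
  then show ?case
    by (cases p) (auto intro!: submodule_add[OF submodule_dgn] coface_dgn codeg_dgn X)
qed simp

lemma conorm_proj_congruent: "y \<in> chn (lev X p) i \<Longrightarrow> k \<le> p \<Longrightarrow> conorm_proj X p i k y + y \<in> conorm_rel X p i"
proof (induction k)
  case 0
  then show ?case by (simp add: submodule_zero[OF submodule_conorm_rel])
next
  case (Suc k)
  then obtain p' where p: "p = Suc p'" by (cases p) auto
  let ?z = "conorm_proj X p i k y"
  have "?z \<in> chn (lev X p) i" using Suc by (intro conorm_proj_chn) auto
  then have "coface X p (Suc k) i (codeg X (p - 1) k i ?z) \<in> conorm_rel X p i"
    using Suc.prems unfolding p by (intro coface_in_conorm_rel) (auto intro!: codeg_chn X)
  then have "(?z + y) + coface X p (Suc k) i (codeg X (p - 1) k i ?z) \<in> conorm_rel X p i"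
    by (rule submodule_add[OF submodule_conorm_rel, rotated]) (use Suc in auto)
  then show ?case by (simp add: ac_simps)
qed

lemma codeg_conorm_proj:
  "y \<in> chn (lev X p) i \<Longrightarrow> k \<le> p \<Longrightarrow> j < k \<Longrightarrow> codeg X (p - 1) j i (conorm_proj X p i k y) = 0"
proof (induction k)
  case (Suc k)
  then obtain p' where p: "p = Suc p'" by (cases p) auto
  let ?z = "conorm_proj X p i k y"
  have z: "?z \<in> chn (lev X (Suc p')) i" using Suc.prems conorm_proj_chn[of y p i k] p by simp
  have kp: "k \<le> p'" using Suc.prems p by simp
  show ?case
  proof (cases "j = k")
    case True
    have "codeg X p' k i (coface X (Suc p') (Suc k) i (codeg X p' k i ?z)) = codeg X p' k i ?z"
      using z kp by (intro codeg_coface_id X codeg_chn) auto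
    then show ?thesis using True p by simp
  next
    case False
    then have jk: "j < k" using Suc.prems by simp
    then obtain p'' where p': "p' = Suc p''" using kp by (cases p') auto
    have 0: "codeg X p' j i ?z = 0" using Suc.IH[OF Suc.prems(1)] Suc.prems(2) jk p by simp
    have "codeg X p' j i (coface X (Suc p') (Suc k) i (codeg X p' k i ?z)) =
        coface X p' k i (codeg X p'' j i (codeg X p' k i ?z))"
      using codeg_coface_greater[OF X codeg_chn[OF X kp z, unfolded p'], of j "Suc k"] jk kp p' by simp
    also have "codeg X p'' j i (codeg X p' k i ?z) = codeg X p'' (k - 1) i (codeg X p' j i ?z)"
      using codeg_codeg[OF X z[unfolded p'] jk] kp p' by simp
    finally show ?thesis using 0 p by simp
  qed
qed simp

lemma conorm_proj_normalized: "y \<in> chn (lev X p) i \<Longrightarrow> normalized X p i (conorm_proj X p i p y)"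
  by (simp add: normalized_def conorm_proj_chn codeg_conorm_proj[unfolded One_nat_def] submodule_zero[OF submodule_dgn])

lemma conorm_proj_of_normalized:
  assumes "normalized X p i y"
  shows "k \<le> p \<Longrightarrow> conorm_proj X p i k y + y \<in> dgn (lev X p) i"
proof (induction k)
  case 0
  then show ?case by (simp add: submodule_zero[OF submodule_dgn])
next
  case (Suc k)
  then obtain p' where p: "p = Suc p'" by (cases p) auto
  let ?z = "conorm_proj X p i k y"
  have IH: "?z + y \<in> dgn (lev X p) i" using Suc by simp
  have kp: "k \<le> p'" using Suc.prems p by simp
  have "codeg X p' k i (?z + y) \<in> dgn (lev X p') i"
    using IH p kp by (intro codeg_dgn X) auto
  moreover have "codeg X p' k i y \<in> dgn (lev X p') i"
    using assms Suc.prems p by (auto simp: normalized_def)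
  ultimately have "codeg X p' k i ?z \<in> dgn (lev X p') i"
    using submodule_cong[OF submodule_dgn] by (metis kmap_add)
  then have "coface X p (Suc k) i (codeg X p' k i ?z) \<in> dgn (lev X p) i"
    unfolding p by (intro coface_dgn X)
  then have "(?z + y) + coface X p (Suc k) i (codeg X p' k i ?z) \<in> dgn (lev X p) i"
    by (rule submodule_add[OF submodule_dgn IH])
  then show ?case using p by (simp add: ac_simps)
qed

lemma conorm_proj_coface:
  assumes "w \<in> chn (lev X p) i" "1 \<le> k" "k \<le> Suc p"
  shows "conorm_proj X (Suc p) i (Suc p) (coface X (Suc p) k i w) = 0"
proof -
  let ?P = "conorm_proj X (Suc p) i"
  \<comment> \<open>the factors before the one with \<open>d\<^sup>k s\<^sup>k\<^sup>-\<^sup>1\<close> can be moved past \<open>d\<^sup>k\<close>\<close>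
  have **: "\<exists>v\<in>chn (lev X p) i. ?P j (coface X (Suc p) k i w) = coface X (Suc p) k i v" if "j < k" for j
    using that
  proof (induction j)
    case 0
    then show ?case using assms(1) by auto
  next
    case (Suc j)
    then obtain v where v: "v \<in> chn (lev X p) i" "?P j (coface X (Suc p) k i w) = coface X (Suc p) k i v" by auto
    obtain p' where p: "p = Suc p'" using Suc.prems assms(3) by (cases p) auto
    have jp: "j \<le> p'" using Suc.prems assms(3) p by simp
    have jk: "Suc j < k" using Suc.prems by simp
    have "codeg X p j i (coface X (Suc p) k i v) = coface X p (k - 1) i (codeg X p' j i v)"
      using codeg_coface_greater[OF X v(1)[unfolded p] jk] assms(3) p by simp
    moreover have "coface X (Suc p) (Suc j) i (coface X p (k - 1) i (codeg X p' j i v)) =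
        coface X (Suc p) k i (coface X p (Suc j) i (codeg X p' j i v))"
      using coface_coface[OF X codeg_chn[OF X jp v(1)[unfolded p]] jk] p by simp
    ultimately have "?P (Suc j) (coface X (Suc p) k i w) =
        coface X (Suc p) k i (v + coface X p (Suc j) i (codeg X p' j i v))"
      using v(2) by simp
    moreover have "v + coface X p (Suc j) i (codeg X p' j i v) \<in> chn (lev X p) i"
      using v(1) jp unfolding p by (intro submodule_add[OF submodule_chn] coface_chn codeg_chn X)
    ultimately show ?case by blast
  qed
  obtain k' where k: "k = Suc k'" using assms(2) by (cases k) auto
  from ** k obtain v where v: "v \<in> chn (lev X p) i"
    "?P k' (coface X (Suc p) k i w) = coface X (Suc p) k i v" by blast
  have "codeg X p k' i (coface X (Suc p) k i v) = v"
    using assms k by (intro codeg_coface_id X v) auto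
  then have "?P k (coface X (Suc p) k i w) = 0"
    using v(2) by (simp add: k)
  then have "?P (k + j) (coface X (Suc p) k i w) = 0" for j
    by (induction j) simp_all
  from this[of "Suc p - k"] show ?thesis using assms by simp
qed

text \<open>
  The projection annihilates the images of the \<open>d\<^sup>k\<close> with \<open>k \<ge> 1\<close> and fixes normalized chains up to
  degenerate ones.
\<close>

lemma normalized_in_conorm_rel:
  assumes "normalized X p i y" "y \<in> conorm_rel X p i"
  shows "y \<in> dgn (lev X p) i"
proof -
  have "conorm_proj X p i p y \<in> dgn (lev X p) i"
    by (rule conorm_rel_image[OF _ submodule_dgn _ _ assms(2)])
       (auto simp: conorm_proj_add conorm_proj_dgn conorm_proj_coface submodule_zero[OF submodule_dgn]
         simp del: conorm_proj.simps)
  then show ?thesis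
    using conorm_proj_of_normalized[OF assms(1) order_refl] submodule_cong[OF submodule_dgn] by blast
qed

lemma conorm_rep_spec:
  assumes "y \<in> chn (lev X p) i"
  shows "normalized X p i (conorm_rep (S_co X) p i y)" "conorm_rep (S_co X) p i y + y \<in> conorm_rel X p i"
proof -
  have "\<exists>y'. normalized X p i y' \<and> y' + y \<in> conorm_rel X p i"
    using conorm_proj_normalized[OF assms] conorm_proj_congruent[OF assms order_refl] by blast
  moreover have "conorm_rep (S_co X) p i y = (SOME y'. normalized X p i y' \<and> y' + y \<in> conorm_rel X p i)"
    by (simp add: conorm_rep_def normalized_def clev_S_co ccop_S_co chain_S_space eq_in_def bimod_conorm conj_assoc)
  ultimately show "normalized X p i (conorm_rep (S_co X) p i y)" "conorm_rep (S_co X) p i y + y \<in> conorm_rel X p i"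
    by (metis (mono_tags, lifting) someI_ex)+
qed

text \<open>
  Although \<open>conorm_rep\<close> is chosen arbitrarily, modulo degenerate chains it is canonical. Hence it is
  additive and compatible with the differentials in this sense.
\<close>

lemma conorm_rep_unique:
  assumes "y \<in> chn (lev X p) i" "normalized X p i z" "z + y \<in> conorm_rel X p i"
  shows "conorm_rep (S_co X) p i y + z \<in> dgn (lev X p) i"
proof (rule normalized_in_conorm_rel)
  show "normalized X p i (conorm_rep (S_co X) p i y + z)"
    by (intro normalized_add conorm_rep_spec assms)
  show "conorm_rep (S_co X) p i y + z \<in> conorm_rel X p i"
    using submodule_trans[OF submodule_conorm_rel conorm_rep_spec(2)[OF assms(1)]] assms(3) by (simp add: add.commute)
qed

end

text \<open>
  The full cosimplicial differential agrees with \<open>d\<^sup>0\<close> in the conormalization. In contrast to \<open>d\<^sup>0\<close> it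
  preserves normalized representatives.
\<close>

definition codiff :: "'a cospace \<Rightarrow> nat \<Rightarrow> int \<Rightarrow> ('a \<Rightarrow>\<^sub>0 bit) \<Rightarrow> ('a \<Rightarrow>\<^sub>0 bit)" where
  "codiff X p i y = (\<Sum>k\<le>Suc p. coface X (Suc p) k i y)"

lemma codiff_add: "codiff X p i (y + z) = codiff X p i y + codiff X p i z"
  by (simp add: codiff_def sum.distrib del: sum.atMost_Suc)

lemma codiff_congruent:
  assumes "y \<in> chn (lev X p) i"
  shows "codiff X p i y + coface X (Suc p) 0 i y \<in> conorm_rel X (Suc p) i"
proof -
  have "codiff X p i y = coface X (Suc p) 0 i y + (\<Sum>k\<le>p. coface X (Suc p) (Suc k) i y)"
    unfolding codiff_def by (rule sum.atMost_Suc_shift)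
  then have "codiff X p i y + coface X (Suc p) 0 i y = (\<Sum>k\<le>p. coface X (Suc p) (Suc k) i y)"
    by (simp add: ac_simps)
  also have "\<dots> \<in> conorm_rel X (Suc p) i"
    by (intro submodule_sum submodule_conorm_rel coface_in_conorm_rel assms) auto
  finally show ?thesis .
qed

text \<open>
  In \<open>s\<^sup>k \<Sum>\<^sub>j d\<^sup>j y\<close> the terms \<open>j = k\<close> and \<open>j = k + 1\<close> are both equal to \<open>y\<close> and cancel. In each of the other
  ones a codegeneracy can be moved to \<open>y\<close>.
\<close>

lemma codiff_normalized:
  assumes X: "cosimplicial_space X" and y: "normalized X p i y"
  shows "normalized X (Suc p) i (codiff X p i y)"
proof -
  have y': "y \<in> chn (lev X p) i" using y by (simp add: normalized_def)
  have "codeg X p k i (codiff X p i y) \<in> dgn (lev X p) i" if k: "k \<le> p" for k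
  proof -
    let ?g = "\<lambda>j. codeg X p k i (coface X (Suc p) j i y)"
    have "codeg X p k i (codiff X p i y) = (\<Sum>j\<le>Suc p. ?g j)"
      unfolding codiff_def by (rule kmap_sum)
    also have "\<dots> = (\<Sum>j\<in>{k, Suc k}. ?g j) + (\<Sum>j\<in>{..Suc p} - {k, Suc k}. ?g j)"
      by (subst sum.subset_diff[of "{k, Suc k}"]) (use k in \<open>auto simp: add.commute simp del: sum.atMost_Suc\<close>)
    also have "(\<Sum>j\<in>{k, Suc k}. ?g j) = 0"
      using codeg_coface_id[OF X y' k] by simp
    also have "0 + (\<Sum>j\<in>{..Suc p} - {k, Suc k}. ?g j) \<in> dgn (lev X p) i"
    proof (simp only: add_0, rule submodule_sum[OF submodule_dgn])
      fix j assume j: "j \<in> {..Suc p} - {k, Suc k}"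
      then obtain p' where p: "p = Suc p'" using k by (cases p) auto
      have norm: "codeg X p' l i y \<in> dgn (lev X p') i" if "l \<le> p'" for l
        using y that p by (auto simp: normalized_def)
      consider "j < k" | "Suc k < j" using j by fastforce
      then show "?g j \<in> dgn (lev X p) i"
      proof cases
        case 1
        then have "?g j = coface X p j i (codeg X p' (k - 1) i y)"
          using codeg_coface_less[OF X y'[unfolded p], of j k] k p by simp
        then show ?thesis using norm[of "k - 1"] k p 1 by (auto intro!: coface_dgn X)
      next
        case 2
        then have "?g j = coface X p (j - 1) i (codeg X p' k i y)"
          using codeg_coface_greater[OF X y'[unfolded p], of k j] j p by simp
        then show ?thesis using norm[of k] j p 2 by (auto intro!: coface_dgn X)
      qed
    qed
    finally show ?thesis .
  qed
  moreover have "codiff X p i y \<in> chn (lev X (Suc p)) i"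
    unfolding codiff_def by (intro submodule_sum submodule_chn coface_chn X y')
  ultimately show ?thesis by (simp add: normalized_def less_Suc_eq_le)
qed

lemma bd_normalized:
  assumes X: "cosimplicial_space X" and y: "normalized X p i y"
  shows "normalized X p (i - 1) (bd (lev X p) (nat i) y)"
proof -
  have y': "y \<in> chn (lev X p) i" using y by (simp add: normalized_def)
  have "codeg X (p - 1) k (i - 1) (bd (lev X p) (nat i) y) \<in> dgn (lev X (p - 1)) (i - 1)" if k: "k < p" for k
  proof -
    have "codg (p - 1) k \<in> mono_maps p (p - 1)" using codg_in_mono_maps[of k "p - 1"] k by simp
    then have "codeg X (p - 1) k (i - 1) (bd (lev X p) (nat i) y) = bd (lev X (p - 1)) (nat i) (codeg X (p - 1) k i y)"
      by (rule cm_bd[OF X _ y'])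
    also have "\<dots> \<in> dgn (lev X (p - 1)) (i - 1)"
      using y k by (intro bd_dgn cosimplicial_spaceD X) (auto simp: normalized_def)
    finally show ?thesis .
  qed
  then show ?thesis by (simp add: normalized_def bd_chn[OF cosimplicial_spaceD(1)[OF X] y'])
qed

section \<open>The Alexander--Whitney map\<close>

text \<open>
  The inclusion of \<open>[q]\<close> as the back face of \<open>[p + q]\<close>. The list \<open>id_map p\<close> also is the inclusion of \<open>[p]\<close>
  as the front face.
\<close>

definition shift_map :: "nat \<Rightarrow> nat \<Rightarrow> nat list" where
  "shift_map p q = map ((+) p) (id_map q)"

lemma length_shift_map [simp]: "length (shift_map p q) = Suc q"
  by (simp add: shift_map_def)

lemma nth_shift_map [simp]: "k \<le> q \<Longrightarrow> shift_map p q ! k = p + k"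
  by (simp add: shift_map_def)

lemma shift_map_in_mono_maps: "n = p + q \<Longrightarrow> shift_map p q \<in> mono_maps q n"
  by (rule mono_mapsI) auto

lemma id_map_in_mono_maps': "p \<le> n \<Longrightarrow> id_map p \<in> mono_maps p n"
  by (rule mono_mapsI) auto

lemma AW_left_eq:
  assumes X: "cosimplicial_space X" and a: "a \<in> chn (lev X p) i"
  shows "AW_left (S_co X) p q i a = cm X (p + q) (id_map p) i a"
proof (induction q)
  case 0
  then show ?case using cm_id[OF X a] by (simp add: AW_left_def)
next
  case (Suc q)
  have *: "after (cofc (Suc (p + q)) (Suc (p + q))) (id_map p) = id_map p"
    by (rule nth_equalityI) auto
  have "AW_left (S_co X) p (Suc q) i a = coface X (Suc (p + q)) (Suc (p + q)) i (AW_left (S_co X) p q i a)"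
    by (simp add: AW_left_def ccop_S_co)
  also have "\<dots> = cm X (Suc (p + q)) (id_map p) i a"
    unfolding Suc by (simp only: cm_comp[OF X cofc_in_mono_maps id_map_in_mono_maps' a] le_add1 *)
  finally show ?case by simp
qed

lemma AW_right_eq:
  assumes X: "cosimplicial_space X" and a: "a \<in> chn (lev X q) i"
  shows "AW_right (S_co X) p q i a = cm X (p + q) (shift_map p q) i a"
proof (induction p)
  case 0
  have "shift_map 0 q = id_map q" by (rule nth_equalityI) auto
  then show ?case using cm_id[OF X a] by (simp add: AW_right_def)
next
  case (Suc p)
  have *: "after (cofc (Suc (p + q)) p) (shift_map p q) = shift_map (Suc p) q"
    by (rule nth_equalityI) auto
  have "AW_right (S_co X) (Suc p) q i a = coface X (Suc (p + q)) p i (AW_right (S_co X) p q i a)"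
    by (simp add: AW_right_def ccop_S_co add.commute)
  also have "\<dots> = cm X (Suc (p + q)) (shift_map (Suc p) q) i a"
    unfolding Suc by (simp only: cm_comp[OF X cofc_in_mono_maps shift_map_in_mono_maps[OF refl] a] *)
  finally show ?case by simp
qed

text \<open>
  Let \<open>\<beta> \<theta> \<eta>\<close> be the value of a pairing on the images of two cochains under \<open>\<theta>\<close> and \<open>\<eta>\<close>. The front
  \<open>p\<close>-face and the back \<open>q\<close>-face of the \<open>(p+q+1)\<close>-simplex do not meet. Extending one of them by a
  vertex and omitting a vertex from it amounts to omitting a vertex of the whole simplex, except that
  the added vertex may be the omitted one. This term occurs in both sums.
\<close>

lemma Alexander_Whitney_Leibniz:
  fixes \<beta> :: "nat list \<Rightarrow> nat list \<Rightarrow> 'v::exponent_two" and p q :: nat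
  defines "n \<equiv> Suc (p + q)"
  shows "(\<Sum>k\<le>n. \<beta> (after (cofc n k) (id_map p)) (after (cofc n k) (shift_map p q))) =
    (\<Sum>i\<le>Suc p. \<beta> (after (id_map (Suc p)) (cofc (Suc p) i)) (shift_map (Suc p) q)) +
    (\<Sum>i\<le>Suc q. \<beta> (id_map p) (after (shift_map p (Suc q)) (cofc (Suc q) i)))"
proof -
  let ?\<gamma> = "\<lambda>k. \<beta> (after (cofc n k) (id_map p)) (after (cofc n k) (shift_map p q))"
  let ?corner = "\<beta> (id_map p) (shift_map (Suc p) q)"
  have e1: "after (id_map (Suc p)) (cofc (Suc p) i) = after (cofc n i) (id_map p)"
    "shift_map (Suc p) q = after (cofc n i) (shift_map p q)" if "i \<le> p" for i
    using that by (auto intro!: nth_equalityI simp: n_def)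
  have e2: "after (id_map (Suc p)) (cofc (Suc p) (Suc p)) = id_map p"
    "after (shift_map p (Suc q)) (cofc (Suc q) 0) = shift_map (Suc p) q"
    by (auto intro!: nth_equalityI)
  have e3: "id_map p = after (cofc n (Suc (p + i))) (id_map p)"
    "after (shift_map p (Suc q)) (cofc (Suc q) (Suc i)) = after (cofc n (Suc (p + i))) (shift_map p q)" if "i \<le> q" for i
    using that by (auto intro!: nth_equalityI simp: n_def)
  have "(\<Sum>i\<le>Suc p. \<beta> (after (id_map (Suc p)) (cofc (Suc p) i)) (shift_map (Suc p) q)) = (\<Sum>i\<le>p. ?\<gamma> i) + ?corner"
    unfolding sum.atMost_Suc e2 by (intro arg_cong2[where f = "(+)"] sum.cong refl) (simp add: e1[symmetric])
  moreover have "(\<Sum>i\<le>Suc q. \<beta> (id_map p) (after (shift_map p (Suc q)) (cofc (Suc q) i))) = ?corner + (\<Sum>i\<le>q. ?\<gamma> (Suc (p + i)))"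
    unfolding sum.atMost_Suc_shift e2 by (intro arg_cong2[where f = "(+)"] sum.cong refl) (simp add: e3[symmetric])
  moreover have "(\<Sum>k\<le>n. ?\<gamma> k) = (\<Sum>k\<le>p. ?\<gamma> k) + (\<Sum>i\<le>q. ?\<gamma> (Suc (p + i)))"
  proof -
    have "(\<Sum>k\<le>n. ?\<gamma> k) = (\<Sum>k\<in>{..p} \<union> {Suc p..n}. ?\<gamma> k)"
      by (rule sum.cong) (auto simp: n_def)
    also have "\<dots> = (\<Sum>k\<le>p. ?\<gamma> k) + (\<Sum>k\<in>{Suc p..n}. ?\<gamma> k)"
      by (rule sum.union_disjoint) auto
    also have "(\<Sum>k\<in>{Suc p..n}. ?\<gamma> k) = (\<Sum>i\<le>q. ?\<gamma> (Suc (p + i)))"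
      by (rule sum.reindex_bij_witness[where i = "\<lambda>i. Suc (p + i)" and j = "\<lambda>k. k - Suc p"]) (auto simp: n_def)
    finally show ?thesis .
  qed
  ultimately show ?thesis by (simp add: add.assoc)
qed

lemma lev_cprod [simp]: "lev (cprod X Y) n = sprod (lev X n) (lev Y n)"
  by (simp add: cprod_def)

lemma cop_cprod [simp]: "cop (cprod X Y) n \<theta> q = map_prod (cop X n \<theta> q) (cop Y n \<theta> q)"
  by (simp add: cprod_def)

lemma cosimplicial_space_cprod:
  assumes X: "cosimplicial_space X" and Y: "cosimplicial_space Y"
  shows "cosimplicial_space (cprod X Y)"
proof -
  have 1: "simplicial_map (lev (cprod X Y) m) (lev (cprod X Y) n) (cop (cprod X Y) n \<theta>)" if "\<theta> \<in> mono_maps m n" for m n \<theta>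
    using simplicial_map_sprod[OF cosimplicial_spaceD(2)[OF X that] cosimplicial_spaceD(2)[OF Y that]]
    by (simp add: cprod_def)
  show ?thesis
    unfolding cosimplicial_space_def
    by (intro conjI allI ballI 1)
       (auto simp: simplicial_set_sprod cosimplicial_spaceD(1,3)[OF X] cosimplicial_spaceD(1,3)[OF Y]
         cosimplicial_spaceD(4)[OF X] cosimplicial_spaceD(4)[OF Y])
qed

text \<open>
  The Alexander--Whitney map followed by the shuffle map, in cosimplicial degree \<open>n\<close>. The families
  consist of chains of total degrees \<open>m\<close> and \<open>m'\<close>.
\<close>

definition aw_shuffle :: "'a cospace \<Rightarrow> 'b cospace \<Rightarrow> int \<Rightarrow> int \<Rightarrow>
    (nat \<Rightarrow> 'a \<Rightarrow>\<^sub>0 bit) \<Rightarrow> (nat \<Rightarrow> 'b \<Rightarrow>\<^sub>0 bit) \<Rightarrow> nat \<Rightarrow> ('a \<times> 'b \<Rightarrow>\<^sub>0 bit)" where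
  "aw_shuffle X X' m m' r t n = (\<Sum>p\<le>n.
     shuffle (lev X n) (lev X' n) (nat (m + int p)) (nat (m' + int (n - p)))
       (cm X n (id_map p) (m + int p) (r p)) (cm X' n (shift_map p (n - p)) (m' + int (n - p)) (t (n - p))))"

text \<open>
  The differential of the total complex, with the full cosimplicial differential in place of \<open>d\<^sup>0\<close>.
\<close>

definition family_bd :: "'a cospace \<Rightarrow> int \<Rightarrow> (nat \<Rightarrow> 'a \<Rightarrow>\<^sub>0 bit) \<Rightarrow> nat \<Rightarrow> ('a \<Rightarrow>\<^sub>0 bit)" where
  "family_bd X m r p = bd (lev X p) (nat (m + int p)) (r p) +
     (case p of 0 \<Rightarrow> 0 | Suc p' \<Rightarrow> codiff X p' (m + int p') (r p'))"

lemma aw_shuffle_add_left: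
  "aw_shuffle X X' m m' (\<lambda>p. r p + r' p) t n = aw_shuffle X X' m m' r t n + aw_shuffle X X' m m' r' t n"
  by (simp add: aw_shuffle_def sum.distrib)

lemma aw_shuffle_add_right:
  "aw_shuffle X X' m m' r (\<lambda>p. t p + t' p) n = aw_shuffle X X' m m' r t n + aw_shuffle X X' m m' r t' n"
  by (simp add: aw_shuffle_def sum.distrib)

context
  fixes X :: "'a cospace" and X' :: "'b cospace"
  assumes X: "cosimplicial_space X" and X': "cosimplicial_space X'"
begin

lemma aw_shuffle_chn:
  assumes r: "\<And>p. r p \<in> chn (lev X p) (m + int p)" and t: "\<And>p. t p \<in> chn (lev X' p) (m' + int p)"
  shows "aw_shuffle X X' m m' r t n \<in> chn (lev (cprod X X') n) (m + m' + int n)"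
  unfolding aw_shuffle_def
proof (rule submodule_sum[OF submodule_chn])
  fix p assume "p \<in> {..n}"
  then have p: "p \<le> n" by simp
  have deg: "m + m' + int n = (m + int p) + (m' + int (n - p))" using p by simp
  show "shuffle (lev X n) (lev X' n) (nat (m + int p)) (nat (m' + int (n - p)))
       (cm X n (id_map p) (m + int p) (r p)) (cm X' n (shift_map p (n - p)) (m' + int (n - p)) (t (n - p)))
       \<in> chn (lev (cprod X X') n) (m + m' + int n)"
    unfolding deg lev_cprod
    by (intro shuffle_chn cosimplicial_spaceD(1) X X' cm_chn[OF X id_map_in_mono_maps'[OF p] r]
        cm_chn[OF X' shift_map_in_mono_maps t]) (simp add: p)
qed

lemma aw_shuffle_dgn:
  assumes r: "\<And>p. r p \<in> chn (lev X p) (m + int p)" and t: "\<And>p. t p \<in> chn (lev X' p) (m' + int p)"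
    and rt: "\<And>p. p \<le> n \<Longrightarrow> r p \<in> dgn (lev X p) (m + int p) \<or> t (n - p) \<in> dgn (lev X' (n - p)) (m' + int (n - p))"
  shows "aw_shuffle X X' m m' r t n \<in> dgn (lev (cprod X X') n) (m + m' + int n)"
  unfolding aw_shuffle_def
proof (rule submodule_sum[OF submodule_dgn])
  fix p assume "p \<in> {..n}"
  then have p: "p \<le> n" by simp
  have deg: "m + m' + int n = (m + int p) + (m' + int (n - p))" using p by simp
  have sh: "shift_map p (n - p) \<in> mono_maps (n - p) n" by (rule shift_map_in_mono_maps) (simp add: p)
  note id = id_map_in_mono_maps'[OF p]
  from rt[OF p] show "shuffle (lev X n) (lev X' n) (nat (m + int p)) (nat (m' + int (n - p)))
       (cm X n (id_map p) (m + int p) (r p)) (cm X' n (shift_map p (n - p)) (m' + int (n - p)) (t (n - p)))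
       \<in> dgn (lev (cprod X X') n) (m + m' + int n)"
  proof
    assume "r p \<in> dgn (lev X p) (m + int p)"
    then show ?thesis
      unfolding deg lev_cprod
      by (intro shuffle_dgn_left cosimplicial_spaceD(1) X X' cm_dgn[OF X id] cm_chn[OF X' sh t])
  next
    assume "t (n - p) \<in> dgn (lev X' (n - p)) (m' + int (n - p))"
    then show ?thesis
      unfolding deg lev_cprod
      by (intro shuffle_dgn_right cosimplicial_spaceD(1) X X' cm_chn[OF X id r] cm_dgn[OF X' sh])
  qed
qed

lemma cm_shuffle:
  assumes "\<theta> \<in> mono_maps k n" "a \<in> chn (lev X k) i" "b \<in> chn (lev X' k) i'"
  shows "cm (cprod X X') n \<theta> (i + i') (shuffle (lev X k) (lev X' k) (nat i) (nat i') a b) =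
    shuffle (lev X n) (lev X' n) (nat i) (nat i') (cm X n \<theta> i a) (cm X' n \<theta> i' b)"
  unfolding cop_cprod
  by (intro shuffle_natural_int[of _ _ "cop X n \<theta>" _ _ "cop X' n \<theta>"] cosimplicial_spaceD(2) X X' assms)

text \<open>
  Cosimplicial operators commute with the boundary, so this is the Leibniz rule for the shuffle map in
  each summand.
\<close>

lemma aw_shuffle_vertical:
  assumes r: "\<And>p. r p \<in> chn (lev X p) (m + int p)" and t: "\<And>p. t p \<in> chn (lev X' p) (m' + int p)"
  shows "bd (lev (cprod X X') n) (nat (m + m' + int n)) (aw_shuffle X X' m m' r t n) =
    aw_shuffle X X' (m - 1) m' (\<lambda>p. bd (lev X p) (nat (m + int p)) (r p)) t n +
    aw_shuffle X X' m (m' - 1) r (\<lambda>p. bd (lev X' p) (nat (m' + int p)) (t p)) n"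
  unfolding aw_shuffle_def bd_sum sum.distrib[symmetric]
proof (rule sum.cong[OF refl])
  fix p assume "p \<in> {..n}"
  then have p: "p \<le> n" by simp
  let ?i = "m + int p" and ?i' = "m' + int (n - p)"
  have deg: "m + m' + int n = ?i + ?i'" "m - 1 + int p = ?i - 1" "m' - 1 + int (n - p) = ?i' - 1" using p by simp_all
  have sh: "shift_map p (n - p) \<in> mono_maps (n - p) n" by (rule shift_map_in_mono_maps) (simp add: p)
  note id = id_map_in_mono_maps'[OF p]
  show "bd (lev (cprod X X') n) (nat (m + m' + int n)) (shuffle (lev X n) (lev X' n) (nat ?i) (nat ?i')
       (cm X n (id_map p) ?i (r p)) (cm X' n (shift_map p (n - p)) ?i' (t (n - p)))) =
    shuffle (lev X n) (lev X' n) (nat (m - 1 + int p)) (nat ?i')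
       (cm X n (id_map p) (m - 1 + int p) (bd (lev X p) (nat ?i) (r p))) (cm X' n (shift_map p (n - p)) ?i' (t (n - p))) +
    shuffle (lev X n) (lev X' n) (nat ?i) (nat (m' - 1 + int (n - p)))
       (cm X n (id_map p) ?i (r p)) (cm X' n (shift_map p (n - p)) (m' - 1 + int (n - p)) (bd (lev X' (n - p)) (nat ?i') (t (n - p))))"
    unfolding deg lev_cprod cm_bd[OF X id r] cm_bd[OF X' sh t]
    by (intro shuffle_Leibniz_int cosimplicial_spaceD(1) X X' cm_chn[OF X id r] cm_chn[OF X' sh t])
qed

text \<open>
  The Leibniz rule for front and back faces, applied to the pairing that is given by the shuffle map.
\<close>

lemma aw_shuffle_horizontal:
  assumes r: "\<And>p. r p \<in> chn (lev X p) (m + int p)" and t: "\<And>p. t p \<in> chn (lev X' p) (m' + int p)"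
  shows "codiff (cprod X X') n (m + m' + int n) (aw_shuffle X X' m m' r t n) =
    aw_shuffle X X' (m - 1) m' (case_nat 0 (\<lambda>p. codiff X p (m + int p) (r p))) t (Suc n) +
    aw_shuffle X X' m (m' - 1) r (case_nat 0 (\<lambda>p. codiff X' p (m' + int p) (t p))) (Suc n)"
proof -
  let ?S = "\<lambda>k i i'. shuffle (lev X k) (lev X' k) (nat i) (nat i')"
  have 1: "aw_shuffle X X' (m - 1) m' (case_nat 0 (\<lambda>p. codiff X p (m + int p) (r p))) t (Suc n) =
      (\<Sum>p\<le>n. ?S (Suc n) (m + int p) (m' + int (n - p)) (cm X (Suc n) (id_map (Suc p)) (m + int p) (codiff X p (m + int p) (r p)))
        (cm X' (Suc n) (shift_map (Suc p) (n - p)) (m' + int (n - p)) (t (n - p))))"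
    unfolding aw_shuffle_def sum.atMost_Suc_shift by (simp del: sum.atMost_Suc)
  have 2: "aw_shuffle X X' m (m' - 1) r (case_nat 0 (\<lambda>p. codiff X' p (m' + int p) (t p))) (Suc n) =
      (\<Sum>p\<le>n. ?S (Suc n) (m + int p) (m' + int (n - p)) (cm X (Suc n) (id_map p) (m + int p) (r p))
        (cm X' (Suc n) (shift_map p (Suc (n - p))) (m' + int (n - p)) (codiff X' (n - p) (m' + int (n - p)) (t (n - p)))))"
    unfolding aw_shuffle_def sum.atMost_Suc by (simp add: Suc_diff_le del: sum.atMost_Suc of_nat_diff)
  show ?thesis
    unfolding 1 2
    unfolding sum.distrib[symmetric]
    unfolding aw_shuffle_def codiff_def kmap_sum shuffle_sum_left shuffle_sum_right
  proof (subst sum.swap, rule sum.cong[OF refl])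
    fix p assume "p \<in> {..n}"
    then have p: "p \<le> n" by simp
    define q where "q = n - p"
    have n: "n = p + q" using p by (simp add: q_def)
    let ?i = "m + int p" and ?i' = "m' + int q"
    have deg: "m + m' + int n = ?i + ?i'" by (simp add: n)
    let ?\<beta> = "\<lambda>\<theta> \<eta>. ?S (Suc n) ?i ?i' (cm X (Suc n) \<theta> ?i (r p)) (cm X' (Suc n) \<eta> ?i' (t q))"
    have id: "id_map p \<in> mono_maps p n" "id_map (Suc p) \<in> mono_maps (Suc p) (Suc n)"
      by (intro id_map_in_mono_maps'; simp add: n)+
    have sh: "shift_map p q \<in> mono_maps q n" "shift_map p (Suc q) \<in> mono_maps (Suc q) (Suc n)"
      by (intro shift_map_in_mono_maps; simp add: n)+
    have L: "coface (cprod X X') (Suc n) k (m + m' + int n)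
        (?S n ?i ?i' (cm X n (id_map p) ?i (r p)) (cm X' n (shift_map p q) ?i' (t q))) =
        ?\<beta> (after (cofc (Suc n) k) (id_map p)) (after (cofc (Suc n) k) (shift_map p q))" for k
      unfolding deg cm_shuffle[OF cofc_in_mono_maps cm_chn[OF X id(1) r] cm_chn[OF X' sh(1) t]]
        cm_comp[OF X cofc_in_mono_maps id(1) r] cm_comp[OF X' cofc_in_mono_maps sh(1) t] ..
    have R1: "cm X (Suc n) (id_map (Suc p)) ?i (coface X (Suc p) k ?i (r p)) =
        cm X (Suc n) (after (id_map (Suc p)) (cofc (Suc p) k)) ?i (r p)" for k
      by (rule cm_comp[OF X id(2) cofc_in_mono_maps r])
    have R2: "cm X' (Suc n) (shift_map p (Suc q)) ?i' (coface X' (Suc q) k ?i' (t q)) =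
        cm X' (Suc n) (after (shift_map p (Suc q)) (cofc (Suc q) k)) ?i' (t q)" for k
      by (rule cm_comp[OF X' sh(2) cofc_in_mono_maps t])
    show "(\<Sum>k\<le>Suc n. coface (cprod X X') (Suc n) k (m + m' + int n) (?S n (m + int p) (m' + int (n - p))
          (cm X n (id_map p) (m + int p) (r p)) (cm X' n (shift_map p (n - p)) (m' + int (n - p)) (t (n - p))))) =
      (\<Sum>k\<le>Suc p. ?S (Suc n) (m + int p) (m' + int (n - p))
        (cm X (Suc n) (id_map (Suc p)) (m + int p) (coface X (Suc p) k (m + int p) (r p)))
        (cm X' (Suc n) (shift_map (Suc p) (n - p)) (m' + int (n - p)) (t (n - p)))) +
      (\<Sum>k\<le>Suc (n - p). ?S (Suc n) (m + int p) (m' + int (n - p)) (cm X (Suc n) (id_map p) (m + int p) (r p))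
        (cm X' (Suc n) (shift_map p (Suc (n - p))) (m' + int (n - p)) (coface X' (Suc (n - p)) k (m' + int (n - p)) (t (n - p)))))"
      unfolding q_def[symmetric] L R1 R2
      using Alexander_Whitney_Leibniz[of ?\<beta> p q, folded n] .
  qed
qed

lemma aw_shuffle_Leibniz:
  assumes r: "\<And>p. r p \<in> chn (lev X p) (m + int p)" and t: "\<And>p. t p \<in> chn (lev X' p) (m' + int p)"
  shows "aw_shuffle X X' (m - 1) m' (family_bd X m r) t n + aw_shuffle X X' m (m' - 1) r (family_bd X' m' t) n =
    family_bd (cprod X X') (m + m') (aw_shuffle X X' m m' r t) n"
proof -
  have fb: "family_bd X m r = (\<lambda>p. bd (lev X p) (nat (m + int p)) (r p) + case_nat 0 (\<lambda>p. codiff X p (m + int p) (r p)) p)"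
    "family_bd X' m' t = (\<lambda>p. bd (lev X' p) (nat (m' + int p)) (t p) + case_nat 0 (\<lambda>p. codiff X' p (m' + int p) (t p)) p)"
    by (simp_all add: family_bd_def fun_eq_iff)
  have "aw_shuffle X X' (m - 1) m' (case_nat 0 (\<lambda>p. codiff X p (m + int p) (r p))) t n +
      aw_shuffle X X' m (m' - 1) r (case_nat 0 (\<lambda>p. codiff X' p (m' + int p) (t p))) n =
      (case n of 0 \<Rightarrow> 0 | Suc k \<Rightarrow> codiff (cprod X X') k (m + m' + int k) (aw_shuffle X X' m m' r t k))"
    by (cases n) (simp add: aw_shuffle_def, simp only: aw_shuffle_horizontal[OF r t] nat.case)
  then show ?thesis
    unfolding fb aw_shuffle_add_left aw_shuffle_add_right family_bd_def aw_shuffle_vertical[OF r t]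
    by (simp add: ac_simps)
qed

end


section \<open>The total complex\<close>

abbreviation tch :: "'a cospace \<Rightarrow> int \<Rightarrow> (int \<Rightarrow> 'a \<Rightarrow>\<^sub>0 bit) set" where
  "tch X m \<equiv> carr (chain (TC (S_co X)) m)"

abbreviation trl :: "'a cospace \<Rightarrow> int \<Rightarrow> (int \<Rightarrow> 'a \<Rightarrow>\<^sub>0 bit) set" where
  "trl X m \<equiv> rel (chain (TC (S_co X)) m)"

abbreviation tbd :: "'a cospace \<Rightarrow> int \<Rightarrow> (int \<Rightarrow> 'a \<Rightarrow>\<^sub>0 bit) \<Rightarrow> (int \<Rightarrow> 'a \<Rightarrow>\<^sub>0 bit)" where
  "tbd X m \<equiv> bdry (TC (S_co X)) m"

lemma all_columns_iff: "(\<forall>j. P j) \<longleftrightarrow> (\<forall>j>0. P j) \<and> (\<forall>p. P (- int p))"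
proof safe
  fix j assume *: "\<forall>j>0. P j" "\<forall>p. P (- int p)"
  show "P j"
  proof (cases "j > 0")
    case False
    then have "j = - int (nat (- j))" by simp
    then show ?thesis using *(2) by metis
  qed (use * in blast)
qed blast+

lemma bimod_conorm_pos: "j > 0 \<Longrightarrow> bimod (conorm Y) j q = zero_kmod"
  by (simp add: conorm_def)

lemma tch_iff: "y \<in> tch X m \<longleftrightarrow> (\<forall>j>0. y j = 0) \<and> (\<forall>p. y (- int p) \<in> chn (lev X p) (m + int p))"
proof -
  have "y \<in> tch X m \<longleftrightarrow> (\<forall>j. y j \<in> carr (bimod (conorm (S_co X)) j (m - j)))"
    by (simp add: total_def)
  then show ?thesis
    by (subst (asm) all_columns_iff) (simp add: bimod_conorm bimod_conorm_pos zero_kmod_def)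
qed

lemma trl_iff: "y \<in> trl X m \<longleftrightarrow> (\<forall>j>0. y j = 0) \<and> (\<forall>p. y (- int p) \<in> conorm_rel X p (m + int p))"
proof -
  have "y \<in> trl X m \<longleftrightarrow> (\<forall>j. y j \<in> rel (bimod (conorm (S_co X)) j (m - j)))"
    by (simp add: total_def)
  then show ?thesis
    by (subst (asm) all_columns_iff) (simp add: bimod_conorm bimod_conorm_pos zero_kmod_def)
qed

lemma filt_iff: "y \<in> filt (conorm (S_co X)) (- s) m \<longleftrightarrow>
    y \<in> tch X m \<and> (\<forall>p. int p < s \<longrightarrow> y (- int p) \<in> conorm_rel X p (m + int p))"
proof -
  have "(\<forall>j>-s. y j \<in> rel (bimod (conorm (S_co X)) j (m - j))) \<longleftrightarrow>
      (\<forall>p. int p < s \<longrightarrow> y (- int p) \<in> conorm_rel X p (m + int p))" if "y \<in> tch X m"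
  proof -
    have "(\<forall>j. j > -s \<longrightarrow> y j \<in> rel (bimod (conorm (S_co X)) j (m - j))) \<longleftrightarrow>
      (\<forall>j>0. j > -s \<longrightarrow> y j \<in> rel (bimod (conorm (S_co X)) j (m - j))) \<and>
      (\<forall>p. - int p > -s \<longrightarrow> y (- int p) \<in> rel (bimod (conorm (S_co X)) (- int p) (m - - int p)))"
      by (rule all_columns_iff)
    then show ?thesis
      using that by (simp add: bimod_conorm bimod_conorm_pos zero_kmod_def tch_iff)
  qed
  then show ?thesis unfolding filt_def by blast
qed

lemma tbd_pos: "j > 0 \<Longrightarrow> tbd X m y j = 0"
  by (simp add: total_def conorm_def)

lemma tbd_column:
  "tbd X m y (- int p) = (case p of 0 \<Rightarrow> 0 | Suc p' \<Rightarrow> coface X (Suc p') 0 (m + int p') (y (- int p'))) +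
     bd (lev X p) (nat (m + int p)) (y (- int p))"
proof -
  have e: "m - (- 1 - int q) = m + (1 + int q)" "nat (int q + 1) = Suc q" for q by simp_all
  show ?thesis
    by (cases p) (simp_all add: total_def conorm_def clev_S_co ccop_S_co bdry_S_space e)
qed

lemma tbd_add: "tbd X m (y + z) = tbd X m y + tbd X m z"
proof
  fix j
  have "\<forall>j. tbd X m (y + z) j = tbd X m y j + tbd X m z j"
    by (subst all_columns_iff) (auto simp: tbd_pos tbd_column split: nat.split)
  then show "tbd X m (y + z) j = (tbd X m y + tbd X m z) j" by simp
qed

lemma submodule_tch: "submodule (tch X m)"
  by (auto simp: submodule_def tch_iff intro: submodule_add[OF submodule_chn] submodule_zero[OF submodule_chn])

lemma submodule_trl: "submodule (trl X m)"
  by (auto simp: submodule_def trl_iff intro: submodule_add[OF submodule_conorm_rel] submodule_zero[OF submodule_conorm_rel])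

lemma submodule_filt: "submodule (filt (conorm (S_co X)) (- s) m)"
  by (auto simp: submodule_def filt_iff intro: submodule_add[OF submodule_conorm_rel] submodule_zero[OF submodule_conorm_rel]
      submodule_add[OF submodule_tch] submodule_zero[OF submodule_tch])

context
  fixes X :: "'a cospace"
  assumes X: "cosimplicial_space X"
begin

lemma trl_subset_tch: "trl X m \<subseteq> tch X m"
  using conorm_rel_subset_chn[OF X] unfolding subset_iff trl_iff tch_iff by blast

lemma trl_subset_filt: "trl X m \<subseteq> filt (conorm (S_co X)) (- s) m"
  using subsetD[OF trl_subset_tch[of m]] by (simp add: subset_iff filt_iff trl_iff)

lemma coface_zero_conorm_rel:
  assumes "a \<in> conorm_rel X p i"
  shows "coface X (Suc p) 0 i a \<in> conorm_rel X (Suc p) i"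
proof (rule conorm_rel_image[OF _ submodule_conorm_rel _ _ assms])
  fix b assume "b \<in> dgn (lev X p) i"
  then show "coface X (Suc p) 0 i b \<in> conorm_rel X (Suc p) i"
    using coface_dgn[OF X] dgn_subset_conorm_rel by blast
next
  fix p' k b assume *: "p = Suc p'" "1 \<le> k" "k \<le> p" "b \<in> chn (lev X p') i"
  have "coface X (Suc p) 0 i (coface X p k i b) = coface X (Suc p) (Suc k) i (coface X p 0 i b)"
    using coface_coface[OF X *(4), of 0 "Suc k"] *(1) by simp
  also have "\<dots> \<in> conorm_rel X (Suc p) i"
    using * by (intro coface_in_conorm_rel) (auto intro!: coface_chn X)
  finally show "coface X (Suc p) 0 i (coface X p k i b) \<in> conorm_rel X (Suc p) i" .
qed simp

lemma bd_conorm_rel: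
  assumes "a \<in> conorm_rel X p i"
  shows "bd (lev X p) (nat i) a \<in> conorm_rel X p (i - 1)"
proof (rule conorm_rel_image[OF _ submodule_conorm_rel _ _ assms])
  fix b assume "b \<in> dgn (lev X p) i"
  then show "bd (lev X p) (nat i) b \<in> conorm_rel X p (i - 1)"
    using bd_dgn[OF cosimplicial_spaceD(1)[OF X]] dgn_subset_conorm_rel by blast
next
  fix p' k b assume *: "p = Suc p'" "1 \<le> k" "k \<le> p" "b \<in> chn (lev X p') i"
  have "bd (lev X p) (nat i) (coface X p k i b) = coface X p k (i - 1) (bd (lev X p') (nat i) b)"
    using cm_bd[OF X cofc_in_mono_maps *(4)] *(1) by simp
  also have "\<dots> \<in> conorm_rel X p (i - 1)"
    using * bd_chn[OF cosimplicial_spaceD(1)[OF X] *(4)] by (auto intro!: coface_in_conorm_rel)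
  finally show "bd (lev X p) (nat i) (coface X p k i b) \<in> conorm_rel X p (i - 1)" .
qed simp

lemma tbd_tch:
  assumes "y \<in> tch X m"
  shows "tbd X m y \<in> tch X (m - 1)"
  unfolding tch_iff
proof (intro conjI allI impI)
  fix p
  have y: "y (- int q) \<in> chn (lev X q) (m + int q)" for q using assms by (simp add: tch_iff)
  have deg: "m - 1 + int p = (m + int p) - 1" by simp
  have "(case p of 0 \<Rightarrow> 0 | Suc p' \<Rightarrow> coface X (Suc p') 0 (m + int p') (y (- int p'))) \<in> chn (lev X p) (m - 1 + int p)"
    by (cases p) (auto intro!: submodule_zero[OF submodule_chn] coface_chn[OF X y])
  moreover have "bd (lev X p) (nat (m + int p)) (y (- int p)) \<in> chn (lev X p) (m - 1 + int p)"
    unfolding deg by (intro bd_chn cosimplicial_spaceD(1) X y)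
  ultimately show "tbd X m y (- int p) \<in> chn (lev X p) (m - 1 + int p)"
    unfolding tbd_column by (rule submodule_add[OF submodule_chn])
qed (rule tbd_pos)

lemma tbd_trl:
  assumes "y \<in> trl X m"
  shows "tbd X m y \<in> trl X (m - 1)"
  unfolding trl_iff
proof (intro conjI allI impI)
  fix p
  have y: "y (- int q) \<in> conorm_rel X q (m + int q)" for q using assms by (simp add: trl_iff)
  have deg: "m - 1 + int p = (m + int p) - 1" by simp
  have "(case p of 0 \<Rightarrow> 0 | Suc p' \<Rightarrow> coface X (Suc p') 0 (m + int p') (y (- int p'))) \<in> conorm_rel X p (m - 1 + int p)"
    by (cases p) (auto intro!: submodule_zero[OF submodule_conorm_rel] coface_zero_conorm_rel[OF y])
  moreover have "bd (lev X p) (nat (m + int p)) (y (- int p)) \<in> conorm_rel X p (m - 1 + int p)"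
    unfolding deg by (intro bd_conorm_rel y)
  ultimately show "tbd X m y (- int p) \<in> conorm_rel X p (m - 1 + int p)"
    unfolding tbd_column by (rule submodule_add[OF submodule_conorm_rel])
qed (rule tbd_pos)

text \<open>
  The square of the horizontal differential is \<open>d\<^sup>0 d\<^sup>0 = d\<^sup>1 d\<^sup>0\<close>, which is a relation.
\<close>

lemma tbd_tbd:
  assumes "y \<in> tch X m"
  shows "tbd X (m - 1) (tbd X m y) \<in> trl X (m - 1 - 1)"
  unfolding trl_iff
proof (intro conjI allI impI)
  fix p
  have y: "y (- int q) \<in> chn (lev X q) (m + int q)" for q using assms by (simp add: tch_iff)
  let ?h = "case p of 0 \<Rightarrow> 0 | Suc p' \<Rightarrow> coface X (Suc p') 0 (m + int p') (y (- int p'))"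
  have deg: "m - 1 + int p = m + int p - 1" by simp
  have bb: "bd (lev X p) (nat (m - 1 + int p)) (bd (lev X p) (nat (m + int p)) (y (- int p))) = 0"
    unfolding deg by (rule bd_bd_int[OF cosimplicial_spaceD(1)[OF X] y])
  have "tbd X (m - 1) (tbd X m y) (- int p) =
      (case p of 0 \<Rightarrow> 0 | Suc p' \<Rightarrow> coface X (Suc p') 0 (m - 1 + int p') (tbd X m y (- int p'))) +
      bd (lev X p) (nat (m - 1 + int p)) ?h"
    by (subst tbd_column, subst tbd_column[of X m y p]) (simp add: bb)
  also have "\<dots> \<in> conorm_rel X p (m - 1 - 1 + int p)"
  proof (cases p)
    case 0
    then show ?thesis by (simp add: submodule_zero[OF submodule_conorm_rel])
  next
    case (Suc p')
    have deg': "m - 1 + int p' = m + int p' - 1" "m - 1 + int (Suc p') = m + int p'" by simp_all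
    have "coface X (Suc p') 0 (m - 1 + int p') (bd (lev X p') (nat (m + int p')) (y (- int p'))) =
        bd (lev X p) (nat (m - 1 + int p)) ?h"
      unfolding Suc nat.case deg' by (rule cm_bd[OF X cofc_in_mono_maps y])
    then have "(case p of 0 \<Rightarrow> 0 | Suc p' \<Rightarrow> coface X (Suc p') 0 (m - 1 + int p') (tbd X m y (- int p'))) +
        bd (lev X p) (nat (m - 1 + int p)) ?h =
        coface X (Suc p') 0 (m - 1 + int p') (case p' of 0 \<Rightarrow> 0 | Suc p'' \<Rightarrow> coface X (Suc p'') 0 (m + int p'') (y (- int p'')))"
      by (simp add: Suc tbd_column[of X m y p'] add.assoc)
    also have "\<dots> \<in> conorm_rel X p (m - 1 - 1 + int p)"
    proof (cases p')
      case 0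
      then show ?thesis by (simp add: submodule_zero[OF submodule_conorm_rel])
    next
      case (Suc p'')
      have "coface X (Suc p') 0 (m + int p'') (coface X p' 0 (m + int p'') (y (- int p''))) =
          coface X (Suc p') 1 (m + int p'') (coface X p' 0 (m + int p'') (y (- int p'')))"
        using coface_coface[OF X y, of 0 1 p''] Suc by simp
      also have "\<dots> \<in> conorm_rel X p (m + int p'')"
        unfolding \<open>p = Suc p'\<close> using Suc y by (auto intro!: coface_in_conorm_rel coface_chn X)
      finally show ?thesis using Suc \<open>p = Suc p'\<close> by simp
    qed
    finally show ?thesis .
  qed
  finally show "tbd X (m - 1) (tbd X m y) (- int p) \<in> conorm_rel X p (m - 1 - 1 + int p)" .
qed (rule tbd_pos)

end

subsection \<open>Families of representatives\<close>

text \<open>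
  The formulas for products and differentials hold strictly for suitable families of chains, one in
  each column, but for the elements of the total complex only modulo the relations of the
  conormalization. Calculations are therefore done with families.
\<close>

definition represents :: "'a cospace \<Rightarrow> int \<Rightarrow> (int \<Rightarrow> 'a \<Rightarrow>\<^sub>0 bit) \<Rightarrow> (nat \<Rightarrow> 'a \<Rightarrow>\<^sub>0 bit) \<Rightarrow> bool" where
  "represents X m y r \<longleftrightarrow> (\<forall>j>0. y j = 0) \<and>
     (\<forall>p. r p \<in> chn (lev X p) (m + int p) \<and> r p + y (- int p) \<in> conorm_rel X p (m + int p))"

lemma represents_chn: "represents X m y r \<Longrightarrow> r p \<in> chn (lev X p) (m + int p)"
  by (simp add: represents_def)

lemma represents_add:
  "represents X m y r \<Longrightarrow> represents X m z t \<Longrightarrow> represents X m (y + z) (\<lambda>p. r p + t p)"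
  using submodule_add[OF submodule_conorm_rel]
  by (fastforce simp: represents_def submodule_add[OF submodule_chn] ac_simps)

lemma represents_dgn_iff:
  assumes "represents X m y r" "\<And>p. r p \<in> dgn (lev X p) (m + int p)"
  shows "y \<in> trl X m"
  unfolding trl_iff
proof (intro conjI allI impI)
  show "y j = 0" if "j > 0" for j using assms(1) that by (simp add: represents_def)
  show "y (- int p) \<in> conorm_rel X p (m + int p)" for p
  proof -
    have "r p + y (- int p) \<in> conorm_rel X p (m + int p)" using assms(1) by (simp add: represents_def)
    moreover have "r p \<in> conorm_rel X p (m + int p)" using assms(2) dgn_subset_conorm_rel by blast
    ultimately show ?thesis using submodule_cong[OF submodule_conorm_rel] by blast
  qed
qed

context
  fixes X :: "'a cospace"
  assumes X: "cosimplicial_space X"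
begin

lemma represents_tch:
  assumes "represents X m y r"
  shows "y \<in> tch X m"
  unfolding tch_iff
proof (intro conjI allI impI)
  show "y j = 0" if "j > 0" for j using assms that by (simp add: represents_def)
  show "y (- int p) \<in> chn (lev X p) (m + int p)" for p
  proof -
    have "r p + y (- int p) \<in> chn (lev X p) (m + int p)"
      using assms conorm_rel_subset_chn[OF X] unfolding represents_def by blast
    then show ?thesis using represents_chn[OF assms] submodule_cong[OF submodule_chn] by blast
  qed
qed

lemma represents_tbd:
  assumes y: "represents X m y r"
  shows "represents X (m - 1) (tbd X m y) (family_bd X m r)"
  unfolding represents_def
proof (intro conjI allI impI)
  fix p
  have r: "r q \<in> chn (lev X q) (m + int q)" for q by (rule represents_chn[OF y])
  have rel: "r q + y (- int q) \<in> conorm_rel X q (m + int q)" for q using y by (simp add: represents_def)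
  have deg: "m - 1 + int p = (m + int p) - 1" by simp
  have deg': "m - 1 + int (Suc q) = m + int q" for q by simp
  have "(case p of 0 \<Rightarrow> 0 | Suc p' \<Rightarrow> codiff X p' (m + int p') (r p')) \<in> chn (lev X p) (m - 1 + int p)"
  proof (cases p)
    case (Suc q)
    show ?thesis
      unfolding Suc nat.case deg' codiff_def
      by (rule submodule_sum[OF submodule_chn], rule coface_chn[OF X r])
  qed (simp add: submodule_zero[OF submodule_chn])
  moreover have "bd (lev X p) (nat (m + int p)) (r p) \<in> chn (lev X p) (m - 1 + int p)"
    unfolding deg by (rule bd_chn[OF cosimplicial_spaceD(1)[OF X] r])
  ultimately show "family_bd X m r p \<in> chn (lev X p) (m - 1 + int p)"
    unfolding family_bd_def by (intro submodule_add[OF submodule_chn])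
  have 1: "bd (lev X p) (nat (m + int p)) (r p) + bd (lev X p) (nat (m + int p)) (y (- int p)) \<in> conorm_rel X p (m - 1 + int p)"
    unfolding deg bd_add[symmetric] by (rule bd_conorm_rel[OF X rel])
  have 2: "(case p of 0 \<Rightarrow> 0 | Suc p' \<Rightarrow> codiff X p' (m + int p') (r p')) +
      (case p of 0 \<Rightarrow> 0 | Suc p' \<Rightarrow> coface X (Suc p') 0 (m + int p') (y (- int p'))) \<in> conorm_rel X p (m - 1 + int p)"
  proof (cases p)
    case (Suc q)
    have "coface X (Suc q) 0 (m + int q) (r q) + coface X (Suc q) 0 (m + int q) (y (- int q)) \<in> conorm_rel X (Suc q) (m + int q)"
      unfolding kmap_add[symmetric] by (rule coface_zero_conorm_rel[OF X rel])
    then show ?thesis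
      unfolding Suc nat.case deg' by (rule submodule_trans[OF submodule_conorm_rel codiff_congruent[OF r]])
  qed (simp add: submodule_zero[OF submodule_conorm_rel])
  show "family_bd X m r p + tbd X m y (- int p) \<in> conorm_rel X p (m - 1 + int p)"
    using submodule_add[OF submodule_conorm_rel 1 2] unfolding family_bd_def tbd_column by (simp add: ac_simps)
qed (rule tbd_pos)

lemma represents_conorm_rep:
  assumes "y \<in> tch X m"
  shows "represents X m y (\<lambda>p. conorm_rep (S_co X) p (m + int p) (y (- int p)))"
    and "normalized X p (m + int p) (conorm_rep (S_co X) p (m + int p) (y (- int p)))"
  using assms conorm_rep_spec[OF X] by (auto simp: represents_def tch_iff normalized_def)

lemma represents_zero_iff: "represents X m y (\<lambda>p. 0) \<longleftrightarrow> y \<in> trl X m"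
  by (auto simp: represents_def trl_iff submodule_zero[OF submodule_chn])

end

subsection \<open>The product of the total complexes\<close>

context
  fixes X :: "'a cospace" and X' :: "'b cospace"
  assumes X: "cosimplicial_space X" and X': "cosimplicial_space X'"
begin

lemma TC_mult_column:
  assumes y: "y \<in> tch X m" and z: "z \<in> tch X' m'"
  shows "TC_mult X X' m m' y z (- int n) = aw_shuffle X X' m m'
    (\<lambda>p. conorm_rep (S_co X) p (m + int p) (y (- int p))) (\<lambda>p. conorm_rep (S_co X') p (m' + int p) (z (- int p))) n"
proof -
  have "AW_left (S_co X) p (n - p) (m + int p) (conorm_rep (S_co X) p (m + int p) (y (- int p))) =
      cm X n (id_map p) (m + int p) (conorm_rep (S_co X) p (m + int p) (y (- int p)))"
    "AW_right (S_co X') p (n - p) (m' + int (n - p)) (conorm_rep (S_co X') (n - p) (m' + int (n - p)) (z (- int (n - p)))) =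
      cm X' n (shift_map p (n - p)) (m' + int (n - p)) (conorm_rep (S_co X') (n - p) (m' + int (n - p)) (z (- int (n - p))))"
    if "p \<le> n" for p
    using that AW_left_eq[OF X represents_chn[OF represents_conorm_rep(1)[OF X y]], of p "n - p"]
      AW_right_eq[OF X' represents_chn[OF represents_conorm_rep(1)[OF X' z]], of p "n - p"] by simp_all
  then show ?thesis
    by (simp add: TC_mult_def aw_shuffle_def Let_def del: of_nat_diff)
qed

text \<open>
  Two normalized representatives differ by degenerate chains, and so do the products that are formed
  with them. So any normalized representatives compute the product.
\<close>

lemma TC_mult_represents:
  assumes y: "represents X m y r" "\<And>p. normalized X p (m + int p) (r p)"
    and z: "represents X' m' z t" "\<And>p. normalized X' p (m' + int p) (t p)"
  shows "represents (cprod X X') (m + m') (TC_mult X X' m m' y z) (aw_shuffle X X' m m' r t)"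
  unfolding represents_def
proof (intro conjI allI impI)
  show "TC_mult X X' m m' y z j = 0" if "j > 0" for j using that by (simp add: TC_mult_def)
  fix n
  define R where "R = (\<lambda>p. conorm_rep (S_co X) p (m + int p) (y (- int p)))"
  define T where "T = (\<lambda>p. conorm_rep (S_co X') p (m' + int p) (z (- int p)))"
  have y': "y \<in> tch X m" and z': "z \<in> tch X' m'"
    using y z represents_tch X X' by blast+
  have chn: "r p \<in> chn (lev X p) (m + int p)" "t p \<in> chn (lev X' p) (m' + int p)"
    "R p \<in> chn (lev X p) (m + int p)" "T p \<in> chn (lev X' p) (m' + int p)" for p
    using represents_conorm_rep(1)[OF X y'] represents_conorm_rep(1)[OF X' z'] y z
    unfolding R_def T_def by (simp_all add: represents_def)
  have R: "R p + r p \<in> dgn (lev X p) (m + int p)" for p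
    unfolding R_def using y y' by (intro conorm_rep_unique X) (auto simp: represents_def tch_iff)
  have T: "T p + t p \<in> dgn (lev X' p) (m' + int p)" for p
    unfolding T_def using z z' by (intro conorm_rep_unique X') (auto simp: represents_def tch_iff)
  show "aw_shuffle X X' m m' r t n \<in> chn (lev (cprod X X') n) (m + m' + int n)"
    by (rule aw_shuffle_chn[OF X X']) (rule chn)+
  have "aw_shuffle X X' m m' (\<lambda>p. R p + r p) T n \<in> dgn (lev (cprod X X') n) (m + m' + int n)"
    by (rule aw_shuffle_dgn[OF X X']) (intro chn submodule_add[OF submodule_chn] disjI1 R)+
  moreover have "aw_shuffle X X' m m' r (\<lambda>p. T p + t p) n \<in> dgn (lev (cprod X X') n) (m + m' + int n)"
    by (rule aw_shuffle_dgn[OF X X']) (intro chn submodule_add[OF submodule_chn] disjI2 T)+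
  ultimately have "aw_shuffle X X' m m' (\<lambda>p. R p + r p) T n + aw_shuffle X X' m m' r (\<lambda>p. T p + t p) n \<in>
      dgn (lev (cprod X X') n) (m + m' + int n)"
    by (rule submodule_add[OF submodule_dgn])
  then have "aw_shuffle X X' m m' r t n + aw_shuffle X X' m m' R T n \<in> dgn (lev (cprod X X') n) (m + m' + int n)"
    by (simp add: aw_shuffle_add_left aw_shuffle_add_right ac_simps)
  then show "aw_shuffle X X' m m' r t n + TC_mult X X' m m' y z (- int n) \<in> conorm_rel (cprod X X') n (m + m' + int n)"
    unfolding TC_mult_column[OF y' z'] R_def T_def by (rule subsetD[OF dgn_subset_conorm_rel])
qed

lemma TC_mult_tch: "y \<in> tch X m \<Longrightarrow> z \<in> tch X' m' \<Longrightarrow> TC_mult X X' m m' y z \<in> tch (cprod X X') (m + m')"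
  by (rule represents_tch[OF cosimplicial_space_cprod[OF X X']
        TC_mult_represents[OF represents_conorm_rep[OF X] represents_conorm_rep[OF X']]])

lemma TC_mult_add_left:
  assumes y: "y \<in> tch X m" "y' \<in> tch X m" and z: "z \<in> tch X' m'"
  shows "TC_mult X X' m m' (y + y') z + (TC_mult X X' m m' y z + TC_mult X X' m m' y' z) \<in> trl (cprod X X') (m + m')"
proof -
  note XX' = cosimplicial_space_cprod[OF X X']
  note r = represents_conorm_rep[OF X y(1)] and r' = represents_conorm_rep[OF X y(2)]
    and t = represents_conorm_rep[OF X' z]
  have "represents (cprod X X') (m + m') (TC_mult X X' m m' (y + y') z + (TC_mult X X' m m' y z + TC_mult X X' m m' y' z)) (\<lambda>p. 0)"
    using represents_add[OF TC_mult_represents[OF represents_add[OF r(1) r'(1)] normalized_add[OF r(2) r'(2)] t]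
      represents_add[OF TC_mult_represents[OF r t] TC_mult_represents[OF r' t]]]
    by (simp add: aw_shuffle_add_left)
  then show ?thesis by (simp only: represents_zero_iff[OF XX'])
qed

lemma TC_mult_add_right:
  assumes y: "y \<in> tch X m" and z: "z \<in> tch X' m'" "z' \<in> tch X' m'"
  shows "TC_mult X X' m m' y (z + z') + (TC_mult X X' m m' y z + TC_mult X X' m m' y z') \<in> trl (cprod X X') (m + m')"
proof -
  note XX' = cosimplicial_space_cprod[OF X X']
  note r = represents_conorm_rep[OF X y]
    and t = represents_conorm_rep[OF X' z(1)] and t' = represents_conorm_rep[OF X' z(2)]
  have "represents (cprod X X') (m + m') (TC_mult X X' m m' y (z + z') + (TC_mult X X' m m' y z + TC_mult X X' m m' y z')) (\<lambda>p. 0)"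
    using represents_add[OF TC_mult_represents[OF r represents_add[OF t(1) t'(1)] normalized_add[OF t(2) t'(2)]]
      represents_add[OF TC_mult_represents[OF r t] TC_mult_represents[OF r t']]]
    by (simp add: aw_shuffle_add_right)
  then show ?thesis by (simp only: represents_zero_iff[OF XX'])
qed

text \<open>
  Both differentials preserve normalized representatives, so the product of families computes all
  three terms.
\<close>

lemma TC_mult_Leibniz:
  assumes y: "y \<in> tch X m" and z: "z \<in> tch X' m'"
  shows "tbd (cprod X X') (m + m') (TC_mult X X' m m' y z) +
    (TC_mult X X' (m - 1) m' (tbd X m y) z + TC_mult X X' m (m' - 1) y (tbd X' m' z)) \<in> trl (cprod X X') (m + m' - 1)"
proof -
  note XX' = cosimplicial_space_cprod[OF X X']
  define r where "r = (\<lambda>p. conorm_rep (S_co X) p (m + int p) (y (- int p)))"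
  define t where "t = (\<lambda>p. conorm_rep (S_co X') p (m' + int p) (z (- int p)))"
  have r: "represents X m y r" "normalized X p (m + int p) (r p)" for p
    using represents_conorm_rep[OF X y] by (auto simp: r_def)
  have t: "represents X' m' z t" "normalized X' p (m' + int p) (t p)" for p
    using represents_conorm_rep[OF X' z] by (auto simp: t_def)
  have normalized_bd: "normalized Y p (i - 1 + int p) (family_bd Y i u p)"
    if Y: "cosimplicial_space Y" and u: "\<And>p. normalized Y p (i + int p) (u p)" for Y :: "'c cospace" and u i p
  proof -
    have deg: "i - 1 + int p = (i + int p) - 1" "i - 1 + int (Suc q) = i + int q" for q by simp_all
    have "normalized Y p (i - 1 + int p) (case p of 0 \<Rightarrow> 0 | Suc p' \<Rightarrow> codiff Y p' (i + int p') (u p'))"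
    proof (cases p)
      case 0 then show ?thesis by (simp add: normalized_def submodule_zero[OF submodule_chn])
    next
      case (Suc q) show ?thesis unfolding Suc nat.case deg by (rule codiff_normalized[OF Y u])
    qed
    moreover have "normalized Y p (i - 1 + int p) (bd (lev Y p) (nat (i + int p)) (u p))"
      unfolding deg by (rule bd_normalized[OF Y u])
    ultimately show ?thesis unfolding family_bd_def by (intro normalized_add)
  qed
  have deg: "m - 1 + m' = m + m' - 1" "m + (m' - 1) = m + m' - 1" by simp_all
  let ?fb = "family_bd (cprod X X') (m + m') (aw_shuffle X X' m m' r t)"
  let ?a1 = "aw_shuffle X X' (m - 1) m' (family_bd X m r) t" and ?a2 = "aw_shuffle X X' m (m' - 1) r (family_bd X' m' t)"
  have "represents (cprod X X') (m + m' - 1) (tbd (cprod X X') (m + m') (TC_mult X X' m m' y z)) ?fb"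
    by (rule represents_tbd[OF XX' TC_mult_represents[OF r t]])
  moreover have "represents (cprod X X') (m + m' - 1) (TC_mult X X' (m - 1) m' (tbd X m y) z) ?a1"
    using TC_mult_represents[OF represents_tbd[OF X r(1)] normalized_bd[OF X r(2)] t] unfolding deg .
  moreover have "represents (cprod X X') (m + m' - 1) (TC_mult X X' m (m' - 1) y (tbd X' m' z)) ?a2"
    using TC_mult_represents[OF r represents_tbd[OF X' t(1)] normalized_bd[OF X' t(2)]] unfolding deg .
  ultimately have "represents (cprod X X') (m + m' - 1) (tbd (cprod X X') (m + m') (TC_mult X X' m m' y z) +
    (TC_mult X X' (m - 1) m' (tbd X m y) z + TC_mult X X' m (m' - 1) y (tbd X' m' z))) (\<lambda>p. ?fb p + (?a1 p + ?a2 p))"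
    by (intro represents_add)
  moreover have "(\<lambda>p. ?fb p + (?a1 p + ?a2 p)) = (\<lambda>p. 0)"
    by (simp add: aw_shuffle_Leibniz[OF X X' represents_chn[OF r(1)] represents_chn[OF t(1)]])
  ultimately show ?thesis by (simp only: represents_zero_iff[OF XX'])
qed

text \<open>
  In a column below \<open>s + s'\<close> each summand has one factor from a column in which the respective element
  vanishes modulo relations, so that its normalized representative is degenerate.
\<close>

lemma TC_mult_filt:
  assumes y: "y \<in> filt (conorm (S_co X)) (- s) m" and z: "z \<in> filt (conorm (S_co X')) (- s') m'"
  shows "TC_mult X X' m m' y z \<in> filt (conorm (S_co (cprod X X'))) (- (s + s')) (m + m')"
  unfolding filt_iff
proof (intro conjI allI impI)
  have y': "y \<in> tch X m" and z': "z \<in> tch X' m'" using y z by (simp_all add: filt_iff)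
  then show "TC_mult X X' m m' y z \<in> tch (cprod X X') (m + m')" by (rule TC_mult_tch)
  fix n assume n: "int n < s + s'"
  define R where "R = (\<lambda>p. conorm_rep (S_co X) p (m + int p) (y (- int p)))"
  define T where "T = (\<lambda>p. conorm_rep (S_co X') p (m' + int p) (z (- int p)))"
  have R: "R p \<in> dgn (lev X p) (m + int p)" if "int p < s" for p
  proof (rule normalized_in_conorm_rel[OF X])
    show "normalized X p (m + int p) (R p)" unfolding R_def by (rule represents_conorm_rep(2)[OF X y'])
    have "R p + y (- int p) \<in> conorm_rel X p (m + int p)"
      using represents_conorm_rep(1)[OF X y'] by (simp add: represents_def R_def)
    then show "R p \<in> conorm_rel X p (m + int p)"
      using submodule_cong[OF submodule_conorm_rel] y that by (fastforce simp: filt_iff)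
  qed
  have T: "T p \<in> dgn (lev X' p) (m' + int p)" if "int p < s'" for p
  proof (rule normalized_in_conorm_rel[OF X'])
    show "normalized X' p (m' + int p) (T p)" unfolding T_def by (rule represents_conorm_rep(2)[OF X' z'])
    have "T p + z (- int p) \<in> conorm_rel X' p (m' + int p)"
      using represents_conorm_rep(1)[OF X' z'] by (simp add: represents_def T_def)
    then show "T p \<in> conorm_rel X' p (m' + int p)"
      using submodule_cong[OF submodule_conorm_rel] z that by (fastforce simp: filt_iff)
  qed
  have "aw_shuffle X X' m m' R T n \<in> dgn (lev (cprod X X') n) (m + m' + int n)"
  proof (rule aw_shuffle_dgn[OF X X'])
    show "R p \<in> dgn (lev X p) (m + int p) \<or> T (n - p) \<in> dgn (lev X' (n - p)) (m' + int (n - p))" if "p \<le> n" for p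
      using R[of p] T[of "n - p"] n that by (cases "int p < s") auto
  qed (use represents_conorm_rep(1)[OF X y'] represents_conorm_rep(1)[OF X' z'] in \<open>auto simp: represents_def R_def T_def\<close>)
  then show "TC_mult X X' m m' y z (- int n) \<in> conorm_rel (cprod X X') n (m + m' + int n)"
    using dgn_subset_conorm_rel unfolding TC_mult_column[OF y' z'] R_def T_def by blast
qed

lemma TC_mult_trl_left:
  assumes y: "y \<in> trl X m" and z: "z \<in> tch X' m'"
  shows "TC_mult X X' m m' y z \<in> trl (cprod X X') (m + m')"
proof -
  have "represents (cprod X X') (m + m') (TC_mult X X' m m' y z) (aw_shuffle X X' m m' (\<lambda>p. 0) (\<lambda>p. conorm_rep (S_co X') p (m' + int p) (z (- int p))))"
    using y represents_conorm_rep[OF X' z]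
    by (intro TC_mult_represents) (auto simp: represents_zero_iff[OF X] normalized_def submodule_zero[OF submodule_chn] submodule_zero[OF submodule_dgn])
  then show ?thesis
    by (rule represents_dgn_iff) (simp add: aw_shuffle_def submodule_zero[OF submodule_dgn])
qed

lemma TC_mult_trl_right:
  assumes y: "y \<in> tch X m" and z: "z \<in> trl X' m'"
  shows "TC_mult X X' m m' y z \<in> trl (cprod X X') (m + m')"
proof -
  have "represents (cprod X X') (m + m') (TC_mult X X' m m' y z) (aw_shuffle X X' m m' (\<lambda>p. conorm_rep (S_co X) p (m + int p) (y (- int p))) (\<lambda>p. 0))"
    using z represents_conorm_rep[OF X y]
    by (intro TC_mult_represents) (auto simp: represents_zero_iff[OF X'] normalized_def submodule_zero[OF submodule_chn] submodule_zero[OF submodule_dgn])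
  then show ?thesis
    by (rule represents_dgn_iff) (simp add: aw_shuffle_def submodule_zero[OF submodule_dgn])
qed

end

section \<open>Pairings\<close>

text \<open>
  The evaluation of simplices of \<open>Tot X\<close> at simplices of a standard simplex is a simplicial map
  \<open>E : U \<times> T \<rightarrow> R\<close>. For any such map, the properties of the shuffle map make the induced pairing of
  chains compatible with boundaries and degenerate chains.
\<close>

definition pairing :: "(nat \<Rightarrow> 'u \<times> 't \<Rightarrow> 'r) \<Rightarrow> 'u sspace \<Rightarrow> 't sspace \<Rightarrow> int \<Rightarrow> int \<Rightarrow>
    ('u \<Rightarrow>\<^sub>0 bit) \<Rightarrow> ('t \<Rightarrow>\<^sub>0 bit) \<Rightarrow> ('r \<Rightarrow>\<^sub>0 bit)" where
  "pairing E U T i m c a = kmap (E (nat (i + m))) (shuffle U T (nat i) (nat m) c a)"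

lemma pairing_add:
  "pairing E U T i m (c + c') a = pairing E U T i m c a + pairing E U T i m c' a"
  "pairing E U T i m c (a + a') = pairing E U T i m c a + pairing E U T i m c a'"
  by (simp_all add: pairing_def)

lemma pairing_zero [simp]: "pairing E U T i m 0 a = 0" "pairing E U T i m c 0 = 0"
  by (simp_all add: pairing_def)

lemma pairing_sum_left: "pairing E U T i m (sum f I) a = (\<Sum>x\<in>I. pairing E U T i m (f x) a)"
  by (rule additive_sum) (rule pairing_add)

context
  fixes E :: "nat \<Rightarrow> 'u \<times> 't \<Rightarrow> 'r" and U :: "'u sspace" and T :: "'t sspace" and R :: "'r sspace"
  assumes U: "simplicial_set U" and T: "simplicial_set T" and R: "simplicial_set R"
    and E: "simplicial_map (sprod U T) R E"
begin

lemma pairing_chn: "c \<in> chn U i \<Longrightarrow> a \<in> chn T m \<Longrightarrow> pairing E U T i m c a \<in> chn R (i + m)"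
  unfolding pairing_def by (rule kmap_chn[OF E shuffle_chn[OF U T]])

lemma pairing_dgn_left: "c \<in> dgn U i \<Longrightarrow> a \<in> chn T m \<Longrightarrow> pairing E U T i m c a \<in> dgn R (i + m)"
  unfolding pairing_def by (rule kmap_dgn[OF simplicial_set_sprod[OF U T] R E shuffle_dgn_left[OF U T]])

lemma pairing_dgn_right: "c \<in> chn U i \<Longrightarrow> a \<in> dgn T m \<Longrightarrow> pairing E U T i m c a \<in> dgn R (i + m)"
  unfolding pairing_def by (rule kmap_dgn[OF simplicial_set_sprod[OF U T] R E shuffle_dgn_right[OF U T]])

lemma pairing_Leibniz:
  assumes "c \<in> chn U i" "a \<in> chn T m"
  shows "bd R (nat (i + m)) (pairing E U T i m c a) =
    pairing E U T (i - 1) m (bd U (nat i) c) a + pairing E U T i (m - 1) c (bd T (nat m) a)"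
proof -
  have deg: "i - 1 + m = i + m - 1" "i + (m - 1) = i + m - 1" by simp_all
  show ?thesis
    unfolding pairing_def bd_natural_int[OF E shuffle_chn[OF U T assms], symmetric]
      shuffle_Leibniz_int[OF U T assms] kmap_add deg ..
qed

end

lemma pairing_natural:
  assumes f: "simplicial_map U U' f" and E: "\<And>n u t. u \<in> cells U n \<Longrightarrow> t \<in> cells T n \<Longrightarrow> g n (E n (u, t)) = E' n (f n u, t)"
    and U: "simplicial_set U" and T: "simplicial_set T" and c: "c \<in> chn U i" and a: "a \<in> chn T m"
  shows "kmap (g (nat (i + m))) (pairing E U T i m c a) = pairing E' U' T i m (kmap (f (nat i)) c) a"
proof -
  have "pairing E' U' T i m (kmap (f (nat i)) c) a =
      kmap (E' (nat (i + m))) (kmap (map_prod (f (nat (i + m))) (\<lambda>x. x)) (shuffle U T (nat i) (nat m) c a))"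
    unfolding pairing_def using shuffle_natural_int[OF f simplicial_map_id c a]
    by (simp add: kmap_id)
  also have "\<dots> = kmap (g (nat (i + m))) (kmap (E (nat (i + m))) (shuffle U T (nat i) (nat m) c a))"
    unfolding kmap_kmap
  proof (rule kmap_cong[OF refl])
    fix w assume "w \<in> Poly_Mapping.keys (shuffle U T (nat i) (nat m) c a)"
    then have "w \<in> cells (sprod U T) (nat (i + m))"
      using free_on_keys[OF chn_free_on[OF shuffle_chn[OF U T c a]]] by blast
    then show "E' (nat (i + m)) (map_prod (f (nat (i + m))) (\<lambda>x. x) w) = g (nat (i + m)) (E (nat (i + m)) w)"
      using E by auto
  qed
  finally show ?thesis unfolding pairing_def ..
qed

section \<open>The simplicial set Tot\<close>

lemma nat_one_plus_int [simp]: "nat (1 + int n) = Suc n"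
  by linarith

lemma cells_tot_dom: "cells (lev (tot_dom q) p) k = mono_maps k p \<times> mono_maps k q"
  by (simp add: tot_dom_def Simplex_co_def const_co_def)

lemma on_dom_eq:
  "on_dom q e f p k (u, v) = (if u \<in> mono_maps k p \<and> v \<in> mono_maps k q then f p k (u, v) else e)"
  by (simp add: on_dom_def cells_tot_dom)

lemma on_dom_on_dom: "on_dom q e (on_dom q e f) = on_dom q e f"
  by (intro ext) (simp add: on_dom_def)

lemma on_dom_ext:
  assumes "\<And>p k u v. u \<in> mono_maps k p \<Longrightarrow> v \<in> mono_maps k q \<Longrightarrow> f p k (u, v) = g p k (u, v)"
  shows "on_dom q e f = on_dom q e g"
proof (intro ext)
  fix p k w show "on_dom q e f p k w = on_dom q e g p k w"
    by (cases w) (simp add: on_dom_eq assms)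
qed

text \<open>
  The conditions on a cosimplicial map \<open>\<Delta>\<^sup>\<bullet> \<times> \<Delta>\<^sup>q \<rightarrow> X\<close>, written out for the two components of a
  simplex of the domain.
\<close>

definition tot_simplex :: "'a cospace \<Rightarrow> nat \<Rightarrow> 'a tot \<Rightarrow> bool" where
  "tot_simplex X q f \<longleftrightarrow>
     (\<forall>p k u v. u \<in> mono_maps k p \<longrightarrow> v \<in> mono_maps k q \<longrightarrow> f p k (u, v) \<in> cells (lev X p) k) \<and>
     (\<forall>p k l u v \<eta>. u \<in> mono_maps k p \<longrightarrow> v \<in> mono_maps k q \<longrightarrow> \<eta> \<in> mono_maps l k \<longrightarrow>
        f p l (after u \<eta>, after v \<eta>) = sop (lev X p) k \<eta> (f p k (u, v))) \<and>
     (\<forall>p p' k u v \<theta>. u \<in> mono_maps k p \<longrightarrow> v \<in> mono_maps k q \<longrightarrow> \<theta> \<in> mono_maps p p' \<longrightarrow>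
        f p' k (after \<theta> u, v) = cop X p' \<theta> k (f p k (u, v)))"

lemma cosimplicial_map_tot_dom: "cosimplicial_map (tot_dom q) X f \<longleftrightarrow> tot_simplex X q f"
  unfolding cosimplicial_map_def simplicial_map_def tot_simplex_def
  by (simp add: tot_dom_def Simplex_co_def const_co_def) blast

lemma cells_Tot: "f \<in> cells (Tot_ext e X) q \<longleftrightarrow> tot_simplex X q f \<and> on_dom q e f = f"
  by (simp add: Tot_ext_def cosimplicial_map_tot_dom)

lemma tot_simplexD:
  assumes "tot_simplex X q f" "u \<in> mono_maps k p" "v \<in> mono_maps k q"
  shows "f p k (u, v) \<in> cells (lev X p) k"
    and "\<eta> \<in> mono_maps l k \<Longrightarrow> f p l (after u \<eta>, after v \<eta>) = sop (lev X p) k \<eta> (f p k (u, v))"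
    and "\<theta> \<in> mono_maps p p' \<Longrightarrow> f p' k (after \<theta> u, v) = cop X p' \<theta> k (f p k (u, v))"
  using assms unfolding tot_simplex_def by blast+

lemma tot_simplex_on_dom: "tot_simplex X q (on_dom q e f) \<longleftrightarrow> tot_simplex X q f"
  unfolding tot_simplex_def by (simp add: on_dom_eq after_in_mono_maps cong: imp_cong)

lemma sop_Tot:
  assumes "\<theta> \<in> mono_maps m n"
  shows "sop (Tot_ext e X) n \<theta> f = on_dom m e (\<lambda>p k (u, v). f p k (u, after \<theta> v))"
  using mono_mapsD(1)[OF assms] by (simp add: Tot_ext_def)

lemma simplicial_set_Tot: "simplicial_set (Tot_ext e X)"
  unfolding simplicial_set_def
proof (intro conjI allI ballI)
  fix m n \<theta> f assume \<theta>: "\<theta> \<in> mono_maps m n" and f: "f \<in> cells (Tot_ext e X) n"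
  then have f': "tot_simplex X n f" by (simp add: cells_Tot)
  have "tot_simplex X m (\<lambda>p k (u, v). f p k (u, after \<theta> v))"
    unfolding tot_simplex_def prod.case
  proof (intro conjI allI impI)
    fix p k l u v \<eta>
    assume u: "u \<in> mono_maps k p" and v: "v \<in> mono_maps k m"
    note v' = after_in_mono_maps[OF \<theta> v]
    show "f p k (u, after \<theta> v) \<in> cells (lev X p) k" by (rule tot_simplexD(1)[OF f' u v'])
    show "f p l (after u \<eta>, after \<theta> (after v \<eta>)) = sop (lev X p) k \<eta> (f p k (u, after \<theta> v))"
      if "\<eta> \<in> mono_maps l k"
      using tot_simplexD(2)[OF f' u v' that] by (simp add: after_assoc_mono[OF v that])
    show "f p' k (after \<eta> u, after \<theta> v) = cop X p' \<eta> k (f p k (u, after \<theta> v))"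
      if "\<eta> \<in> mono_maps p p'" for p'
      by (rule tot_simplexD(3)[OF f' u v' that])
  qed
  then show "sop (Tot_ext e X) n \<theta> f \<in> cells (Tot_ext e X) m"
    by (simp add: sop_Tot[OF \<theta>] cells_Tot tot_simplex_on_dom on_dom_on_dom)
next
  fix n f assume f: "f \<in> cells (Tot_ext e X) n"
  have "on_dom n e (\<lambda>p k (u, v). f p k (u, after (id_map n) v)) = on_dom n e f"
    by (rule on_dom_ext) (simp add: id_map_after mono_mapsD(2))
  then show "sop (Tot_ext e X) n (id_map n) f = f"
    using f by (simp add: sop_Tot[OF id_map_in_mono_maps] cells_Tot)
next
  fix l m n \<theta> \<eta> f assume \<theta>: "\<theta> \<in> mono_maps m n" and \<eta>: "\<eta> \<in> mono_maps l m" and f: "f \<in> cells (Tot_ext e X) n"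
  show "sop (Tot_ext e X) m \<eta> (sop (Tot_ext e X) n \<theta> f) = sop (Tot_ext e X) n (after \<theta> \<eta>) f"
    unfolding sop_Tot[OF \<theta>] sop_Tot[OF \<eta>] sop_Tot[OF after_in_mono_maps[OF \<theta> \<eta>]]
    by (rule on_dom_ext) (simp add: on_dom_eq after_in_mono_maps[OF \<eta>] after_assoc_mono[OF \<eta>])
qed

lemma simplicial_map_Tot_prod_iso:
  "simplicial_map (sprod (Tot X) (Tot Y)) (Tot (cprod X Y)) Tot_prod_iso"
  unfolding simplicial_map_def
proof (intro conjI allI ballI)
  fix n x assume "x \<in> cells (sprod (Tot X) (Tot Y)) n"
  then obtain f g where "x = (f, g)" "tot_simplex X n f" "tot_simplex Y n g" by (auto simp: cells_Tot)
  moreover from this have "tot_simplex (cprod X Y) n (\<lambda>p k w. (f p k w, g p k w))"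
    unfolding tot_simplex_def by simp
  ultimately show "Tot_prod_iso n x \<in> cells (Tot (cprod X Y)) n"
    by (simp add: Tot_prod_iso_def cells_Tot tot_simplex_on_dom on_dom_on_dom)
next
  fix m n \<theta> x assume \<theta>: "\<theta> \<in> mono_maps m n" and "x \<in> cells (sprod (Tot X) (Tot Y)) n"
  then obtain f g where x: "x = (f, g)" by (cases x)
  show "Tot_prod_iso m (sop (sprod (Tot X) (Tot Y)) n \<theta> x) = sop (Tot (cprod X Y)) n \<theta> (Tot_prod_iso n x)"
    unfolding x Tot_prod_iso_def sop_sprod map_prod_simp prod.case sop_Tot[OF \<theta>]
    by (rule on_dom_ext) (simp add: on_dom_eq after_in_mono_maps[OF \<theta>])
qed

lemma simplicial_map_Tot_map:
  assumes h: "cosimplicial_map X Y h"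
  shows "simplicial_map (Tot X) (Tot Y) (Tot_map h)"
  unfolding simplicial_map_def
proof (intro conjI allI ballI)
  fix n f assume f: "f \<in> cells (Tot X) n"
  have hs: "simplicial_map (lev X p) (lev Y p) (h p)" for p
    using h by (simp add: cosimplicial_map_def)
  have hc: "h p' q (cop X p' \<theta> q x) = cop Y p' \<theta> q (h p q x)" if "\<theta> \<in> mono_maps p p'" "x \<in> cells (lev X p) q" for p p' q \<theta> x
    using h that unfolding cosimplicial_map_def by blast
  have f': "tot_simplex X n f" using f by (simp add: cells_Tot)
  have "tot_simplex Y n (\<lambda>p k w. h p k (f p k w))"
    unfolding tot_simplex_def
    using tot_simplexD[OF f'] simplicial_mapD[OF hs] hc by auto
  then show "Tot_map h n f \<in> cells (Tot Y) n"
    by (simp add: Tot_map_def cells_Tot tot_simplex_on_dom on_dom_on_dom)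
next
  fix m n \<theta> f assume \<theta>: "\<theta> \<in> mono_maps m n" and "f \<in> cells (Tot X) n"
  show "Tot_map h m (sop (Tot X) n \<theta> f) = sop (Tot Y) n \<theta> (Tot_map h n f)"
    unfolding Tot_map_def sop_Tot[OF \<theta>]
    by (rule on_dom_ext) (simp add: on_dom_eq after_in_mono_maps[OF \<theta>])
qed

subsection \<open>Evaluation\<close>

text \<open>
  A \<open>k\<close>-simplex \<open>u\<close> of \<open>\<Delta>\<^sup>n\<close> and a \<open>k\<close>-simplex \<open>f\<close> of \<open>Tot X\<close> have the value \<open>f u\<close> in \<open>X\<^sup>n\<close>, taken at
  the fundamental simplex of the parameter space \<open>\<Delta>\<^sup>k\<close> of \<open>f\<close>. The map from chains on \<open>Tot X\<close> to the
  total complex is the pairing with the fundamental simplices of the \<open>\<Delta>\<^sup>n\<close> that is induced by this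
  evaluation.
\<close>

definition eval :: "nat \<Rightarrow> nat \<Rightarrow> nat list \<times> 'a tot \<Rightarrow> 'a" where
  "eval n k = (\<lambda>(u, f). f n k (u, id_map k))"

lemma simplicial_map_eval: "simplicial_map (sprod (Simplex n) (Tot X)) (lev X n) (eval n)"
  unfolding simplicial_map_def
proof (intro conjI allI ballI)
  fix k x assume "x \<in> cells (sprod (Simplex n) (Tot X)) k"
  then show "eval n k x \<in> cells (lev X n) k"
    by (auto simp: eval_def cells_Tot intro: tot_simplexD(1))
next
  fix l k \<theta> x assume \<theta>: "\<theta> \<in> mono_maps l k" and "x \<in> cells (sprod (Simplex n) (Tot X)) k"
  then obtain u f where x: "x = (u, f)" "u \<in> mono_maps k n" "tot_simplex X k f" by (auto simp: cells_Tot)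
  have "eval n l (sop (sprod (Simplex n) (Tot X)) k \<theta> x) = f n l (after u \<theta>, after (id_map k) \<theta>)"
    using x \<theta> mono_mapsD(1,2)[OF \<theta>]
    by (simp add: eval_def sop_Tot[OF \<theta>] on_dom_eq after_in_mono_maps after_id_map id_map_after)
  then show "eval n l (sop (sprod (Simplex n) (Tot X)) k \<theta> x) = sop (lev X n) k \<theta> (eval n k x)"
    using tot_simplexD(2)[OF x(3,2) id_map_in_mono_maps \<theta>] by (simp add: x(1) eval_def)
qed

lemma eval_cosimplicial:
  assumes "\<theta> \<in> mono_maps m n" "u \<in> mono_maps k m" "f \<in> cells (Tot X) k"
  shows "cop X n \<theta> k (eval m k (u, f)) = eval n k (after \<theta> u, f)"
proof -
  have "tot_simplex X k f" using assms(3) by (simp add: cells_Tot)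
  from tot_simplexD(3)[OF this assms(2) id_map_in_mono_maps assms(1)] show ?thesis
    by (simp add: eval_def)
qed

lemma eval_sop_Tot:
  assumes "u \<in> mono_maps k n" "v \<in> mono_maps k q"
  shows "eval n k (u, sop (Tot X) q v f) = f n k (u, v)"
  using assms by (simp add: eval_def sop_Tot[OF assms(2)] on_dom_eq after_id_map mono_mapsD(1)[OF assms(2)])

definition phi :: "'a cospace \<Rightarrow> int \<Rightarrow> ('a tot \<Rightarrow>\<^sub>0 bit) \<Rightarrow> nat \<Rightarrow> ('a \<Rightarrow>\<^sub>0 bit)" where
  "phi X m a n = pairing (eval n) (Simplex n) (Tot X) (int n) m (gen (id_map n)) a"

lemma phi_add: "phi X m (a + b) n = phi X m a n + phi X m b n"
  by (simp add: phi_def pairing_add)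

lemma id_map_in_chn: "gen (id_map n) \<in> chn (Simplex n) (int n)"
  by (simp add: chn_def)

lemma to_TC_pos: "j > 0 \<Longrightarrow> to_TC m a j = 0"
  by (simp add: to_TC_def phi_inf_def)

lemma to_TC_add: "to_TC m (a + b) = to_TC m a + to_TC m b"
proof -
  have "klin (f + g) c = klin f c + klin g c" for f g :: "nat list \<times> nat list \<Rightarrow> 'a \<Rightarrow>\<^sub>0 bit" and c
    using klin_fun_add[of f g c] by (simp add: plus_fun_def)
  then show ?thesis
    by (simp add: to_TC_def K_to_TotK_def klin_add phi_inf_def fun_eq_iff Let_def)
qed

lemma to_TC_zero: "to_TC m 0 = 0"
  by (rule additive_zero) (rule to_TC_add)

text \<open>
  A simplex \<open>f\<close> of \<open>Tot X\<close> classifies a map from \<open>\<Delta>\<^sup>q\<close> to \<open>Tot X\<close>, and its values at \<open>\<Delta>\<^sup>n \<times> \<Delta>\<^sup>q\<close> are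
  obtained from this map by evaluation. So both sides are images of the same shuffle of two fundamental
  simplices.
\<close>

lemma to_TC_column:
  assumes "a \<in> chn (Tot X) m"
  shows "to_TC m a (- int n) = phi X m a n"
proof (cases "m < 0")
  case True
  then have "a = 0" using assms by (simp add: chn_def)
  then show ?thesis
    by (simp add: to_TC_zero phi_def)
next
  case False
  define q where "q = nat m"
  have m: "m = int q" using False by (simp add: q_def)
  have "a \<in> free_on (cells (Tot X) q)" using chn_free_on[OF assms] m by simp
  then show ?thesis
  proof (rule free_on_ext[rotated -1, of a _ "\<lambda>a. to_TC m a (- int n)" "\<lambda>a. phi X m a n"])
    fix f assume f: "f \<in> cells (Tot X) q"
    let ?S = "shuffle (Simplex n) (Simplex q) n q (gen (id_map n)) (gen (id_map q))"
    have S: "u \<in> mono_maps (n + q) n \<and> v \<in> mono_maps (n + q) q" if "(u, v) \<in> Poly_Mapping.keys ?S" for u v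
      using free_on_keys[OF shuffle_in_free_on[OF simplicial_set_Simplex simplicial_set_Simplex
        id_map_in_free_on id_map_in_free_on] that] by simp
    have "to_TC m (gen f) (- int n) = klin (on_dom q 0 (\<lambda>p k w. gen (f p k w)) n (n + q)) ?S"
      by (simp add: to_TC_def phi_inf_def K_to_TotK_def m)
    also have "\<dots> = kmap (f n (n + q)) ?S"
      unfolding kmap_def
    proof (rule klin_cong[OF refl])
      fix w assume "w \<in> Poly_Mapping.keys ?S"
      then show "on_dom q 0 (\<lambda>p k w. gen (f p k w)) n (n + q) w = gen (f n (n + q) w)"
        using S by (cases w) (auto simp: on_dom_eq)
    qed
    also have "\<dots> = kmap (eval n (n + q)) (kmap (map_prod (\<lambda>x. x) (\<lambda>v. sop (Tot X) q v f)) ?S)"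
      unfolding kmap_kmap
    proof (rule kmap_cong[OF refl])
      fix w assume "w \<in> Poly_Mapping.keys ?S"
      then show "f n (n + q) w = eval n (n + q) (map_prod (\<lambda>x. x) (\<lambda>v. sop (Tot X) q v f) w)"
        using S by (cases w) (auto simp: eval_sop_Tot)
    qed
    also have "kmap (map_prod (\<lambda>x. x) (\<lambda>v. sop (Tot X) q v f)) ?S =
        shuffle (Simplex n) (Tot X) n q (gen (id_map n)) (gen f)"
      using shuffle_natural[OF simplicial_map_id simplicial_map_classifying[OF simplicial_set_Tot f]
          id_map_in_free_on id_map_in_free_on, of n]
      by (simp add: simplicial_setD(2)[OF simplicial_set_Tot f])
    finally show "to_TC m (gen f) (- int n) = phi X m (gen f) n"
      by (simp add: phi_def pairing_def m nat_int_add)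
  qed (simp_all add: to_TC_add phi_add)
qed

lemma sum_cofaces_id_map:
  "bd (Simplex (Suc n)) (Suc n) (gen (id_map (Suc n))) = (\<Sum>k\<le>Suc n. gen (cofc (Suc n) k))"
  using id_map_after[OF mono_mapsD(2)[OF cofc_in_mono_maps]] by (simp add: bd_gen del: sum.atMost_Suc)

context
  fixes X :: "'a cospace"
  assumes X: "cosimplicial_space X"
begin

lemmas eval_pairing = simplicial_set_Simplex simplicial_set_Tot[of undefined X] cosimplicial_spaceD(1)[OF X] simplicial_map_eval[of _ X]

lemma phi_chn:
  assumes "a \<in> chn (Tot X) m"
  shows "phi X m a n \<in> chn (lev X n) (m + int n)"
  using pairing_chn[OF eval_pairing id_map_in_chn assms] by (simp add: phi_def add.commute)

lemma phi_dgn: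
  assumes "a \<in> dgn (Tot X) m"
  shows "phi X m a n \<in> dgn (lev X n) (m + int n)"
  using pairing_dgn_right[OF eval_pairing id_map_in_chn assms] by (simp add: phi_def add.commute)

lemma cm_phi:
  assumes "\<theta> \<in> mono_maps k n" "a \<in> chn (Tot X) m"
  shows "cm X n \<theta> (m + int k) (phi X m a k) = pairing (eval n) (Simplex n) (Tot X) (int k) m (gen \<theta>) a"
proof -
  have "cm X n \<theta> (int k + m) (phi X m a k) =
      pairing (eval n) (Simplex n) (Tot X) (int k) m (kmap (after \<theta>) (gen (id_map k))) a"
    unfolding phi_def
  proof (rule pairing_natural[where g = "cop X n \<theta>" and f = "\<lambda>j. after \<theta>"])
    show "cop X n \<theta> j (eval k j (u, f)) = eval n j (after \<theta> u, f)"
      if "u \<in> cells (Simplex k) j" "f \<in> cells (Tot X) j" for j u f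
      using eval_cosimplicial[OF assms(1)] that by simp
  qed (intro simplicial_map_Simplex assms simplicial_set_Simplex simplicial_set_Tot id_map_in_chn)+
  then show ?thesis by (simp add: add.commute after_id_map mono_mapsD(1)[OF assms(1)])
qed

text \<open>
  A codegeneracy maps the fundamental simplex to a degenerate simplex. So the image of a chain on
  \<open>Tot X\<close> consists of normalized representatives.
\<close>

lemma phi_normalized:
  assumes "a \<in> chn (Tot X) m"
  shows "normalized X n (m + int n) (phi X m a n)"
  unfolding normalized_def
proof (intro conjI allI impI phi_chn assms)
  fix k assume "k < n"
  then obtain n' where n: "n = Suc n'" and k: "k \<le> n'" by (cases n) auto
  have "gen (sop (Simplex n') n' (codg n' k) (id_map n')) \<in> degen (Simplex n') (Suc n')"
    using k by (intro gen_repeat_in_degen[OF simplicial_set_Simplex _ codg_in_mono_maps, of _ _ _ k]) auto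
  then have "gen (codg n' k) \<in> dgn (Simplex n') (int n)"
    using id_map_after[of "codg n' k" n'] mono_mapsD(2)[OF codg_in_mono_maps[OF k]] by (simp add: dgn_def n)
  then have "pairing (eval n') (Simplex n') (Tot X) (int n) m (gen (codg n' k)) a \<in> dgn (lev X n') (int n + m)"
    by (rule pairing_dgn_left[OF eval_pairing _ assms])
  then show "codeg X (n - 1) k (m + int n) (phi X m a n) \<in> dgn (lev X (n - 1)) (m + int n)"
    using cm_phi[OF codg_in_mono_maps[OF k] assms] by (simp add: n add.commute)
qed

text \<open>
  The boundary of the fundamental simplex is the sum of its cofaces. Hence evaluation turns the
  boundary in \<open>Tot X\<close> into the total differential.
\<close>

lemma phi_family_bd:
  assumes a: "a \<in> chn (Tot X) m"
  shows "family_bd X m (phi X m a) n = phi X (m - 1) (bd (Tot X) (nat m) a) n"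
proof -
  have "bd (lev X n) (nat (m + int n)) (phi X m a n) =
      pairing (eval n) (Simplex n) (Tot X) (int n - 1) m (bd (Simplex n) n (gen (id_map n))) a +
      phi X (m - 1) (bd (Tot X) (nat m) a) n"
    using pairing_Leibniz[OF eval_pairing id_map_in_chn a] by (simp add: phi_def add.commute)
  moreover have "pairing (eval n) (Simplex n) (Tot X) (int n - 1) m (bd (Simplex n) n (gen (id_map n))) a =
      (case n of 0 \<Rightarrow> 0 | Suc n' \<Rightarrow> codiff X n' (m + int n') (phi X m a n'))"
  proof (cases n)
    case (Suc n')
    then show ?thesis
      by (simp add: sum_cofaces_id_map codiff_def pairing_sum_left cm_phi[OF cofc_in_mono_maps a] del: sum.atMost_Suc)
  qed simp
  ultimately show ?thesis by (simp add: family_bd_def add.commute)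
qed

lemma to_TC_represents:
  assumes "a \<in> chn (Tot X) m"
  shows "represents X m (to_TC m a) (phi X m a)"
  by (simp add: represents_def to_TC_pos to_TC_column[OF assms] phi_chn[OF assms] submodule_zero[OF submodule_conorm_rel])

lemma to_TC_tch: "a \<in> chn (Tot X) m \<Longrightarrow> to_TC m a \<in> tch X m"
  by (rule represents_tch[OF X to_TC_represents])

lemma to_TC_trl:
  assumes "a \<in> dgn (Tot X) m"
  shows "to_TC m a \<in> trl X m"
  by (rule represents_dgn_iff[OF to_TC_represents[OF subsetD[OF dgn_subset_chn[OF simplicial_set_Tot] assms]] phi_dgn[OF assms]])

lemma to_TC_tbd:
  assumes a: "a \<in> chn (Tot X) m"
  shows "tbd X m (to_TC m a) + to_TC (m - 1) (bd (Tot X) (nat m) a) \<in> trl X (m - 1)"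
proof -
  have "represents X (m - 1) (tbd X m (to_TC m a) + to_TC (m - 1) (bd (Tot X) (nat m) a)) (\<lambda>p. 0)"
    using represents_add[OF represents_tbd[OF X to_TC_represents[OF a]]
        to_TC_represents[OF bd_chn[OF simplicial_set_Tot a]]]
    by (simp add: phi_family_bd[OF a])
  then show ?thesis by (simp only: represents_zero_iff[OF X])
qed

end

section \<open>The Eilenberg--Zilber homotopy\<close>

lemma codiff_chn: "cosimplicial_space X \<Longrightarrow> y \<in> chn (lev X p) i \<Longrightarrow> codiff X p i y \<in> chn (lev X (Suc p)) i"
  unfolding codiff_def by (rule submodule_sum[OF submodule_chn]) (rule coface_chn)

lemma codiff_codiff:
  assumes "cosimplicial_space X" "y \<in> chn (lev X p) i"
  shows "codiff X (Suc p) i (codiff X p i y) = 0"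
  unfolding codiff_def kmap_sum
  by (rule sum_faces_twice_zero) (rule coface_coface[OF assms])

lemma bd_codiff:
  assumes "cosimplicial_space X" "y \<in> chn (lev X p) i"
  shows "bd (lev X (Suc p)) (nat i) (codiff X p i y) = codiff X p (i - 1) (bd (lev X p) (nat i) y)"
  unfolding codiff_def bd_sum by (rule sum.cong) (simp_all only: cm_bd[OF assms(1) cofc_in_mono_maps assms(2)])

lemma lev_Simplex_co [simp]: "lev Simplex_co n = Simplex n"
  by (simp add: Simplex_co_def)

lemma cop_Simplex_co [simp]: "cop Simplex_co n \<theta> q u = after \<theta> u"
  by (simp add: Simplex_co_def)

lemma cosimplicial_space_Simplex_co: "cosimplicial_space Simplex_co"
proof -
  have "simplicial_map (Simplex m) (Simplex n) (cop Simplex_co n \<theta>)" if "\<theta> \<in> mono_maps m n" for m n \<theta>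
    using simplicial_map_Simplex[OF that] by (simp add: Simplex_co_def)
  then show ?thesis
    unfolding cosimplicial_space_def
    by (auto simp: simplicial_set_Simplex id_map_after mono_mapsD(2) after_assoc_mono)
qed

abbreviation Simplex2_co :: "(nat list \<times> nat list) cospace" where
  "Simplex2_co \<equiv> cprod Simplex_co Simplex_co"

abbreviation diagonal :: "nat \<Rightarrow> (nat list \<times> nat list \<Rightarrow>\<^sub>0 bit)" where
  "diagonal n \<equiv> gen (id_map n, id_map n)"

text \<open>
  The sum of the shuffle products of the front \<open>p\<close>-face and the back \<open>(n-p)\<close>-face of \<open>\<Delta>\<^sup>n\<close>, over all
  \<open>p\<close>. Since the standard simplices form a cosimplicial space, it is a product of families as above.
\<close>

definition AW_diagonal :: "nat \<Rightarrow> (nat list \<times> nat list \<Rightarrow>\<^sub>0 bit)" where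
  "AW_diagonal = aw_shuffle Simplex_co Simplex_co 0 0 (\<lambda>p. gen (id_map p)) (\<lambda>p. gen (id_map p))"

definition cone :: "(nat list \<times> nat list \<Rightarrow>\<^sub>0 bit) \<Rightarrow> (nat list \<times> nat list \<Rightarrow>\<^sub>0 bit)" where
  "cone = kmap (map_prod (Cons 0) (Cons 0))"

text \<open>
  The diagonal and its Alexander--Whitney approximation are natural chains on \<open>\<Delta>\<^sup>n \<times> \<Delta>\<^sup>n\<close> that agree
  for \<open>n = 0\<close>. As the product of simplices is contracted by the cone on its first vertex, one can
  construct a natural homotopy between them by induction on \<open>n\<close> (the method of acyclic models).
\<close>

primrec EZ_homotopy :: "nat \<Rightarrow> (nat list \<times> nat list \<Rightarrow>\<^sub>0 bit)" where
  "EZ_homotopy 0 = 0"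
| "EZ_homotopy (Suc n) = cone (diagonal (Suc n) + AW_diagonal (Suc n) +
     codiff Simplex2_co n (1 + int n) (EZ_homotopy n))"

lemma Cons_0_in_mono_maps:
  assumes "u \<in> mono_maps k n"
  shows "0 # u \<in> mono_maps (Suc k) n"
proof (rule mono_mapsI)
  show "(0 # u) ! j \<le> (0 # u) ! Suc j" if "j < Suc k" for j
    using that mono_mapsD(3)[OF assms, of "j - 1" j] by (cases j) auto
  show "(0 # u) ! j \<le> n" if "j \<le> Suc k" for j
    using that mono_mapsD(4)[OF assms, of "j - 1"] by (cases j) auto
qed (simp add: mono_mapsD(1)[OF assms])

lemma cone_free_on:
  "c \<in> free_on (cells (lev Simplex2_co n) k) \<Longrightarrow> cone c \<in> free_on (cells (lev Simplex2_co n) (Suc k))"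
  unfolding cone_def by (rule kmap_in_free_on) (auto intro: Cons_0_in_mono_maps)

text \<open>
  Deleting the cone vertex gives back the chain. So the cone is a contraction in positive degrees.
\<close>

lemma bd_cone:
  assumes c: "c \<in> free_on (cells (lev Simplex2_co n) (Suc k))"
  shows "bd (lev Simplex2_co n) (Suc (Suc k)) (cone c) = c + cone (bd (lev Simplex2_co n) (Suc k) c)"
proof (rule free_on_ext[OF _ _ _ c, of "\<lambda>c. bd (lev Simplex2_co n) (Suc (Suc k)) (cone c)"
      "\<lambda>c. c + cone (bd (lev Simplex2_co n) (Suc k) c)"])
  fix x assume "x \<in> cells (lev Simplex2_co n) (Suc k)"
  then obtain u v where x: "x = (u, v)" and l: "length u = Suc (Suc k)" "length v = Suc (Suc k)"
    by (auto dest: mono_mapsD(1))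
  have 0: "after (0 # w) (cofc (Suc (Suc k)) 0) = w" if "length w = Suc (Suc k)" for w :: "nat list"
    using that by (intro nth_equalityI) auto
  have S: "after (0 # w) (cofc (Suc (Suc k)) (Suc i)) = 0 # after w (cofc (Suc k) i)" for w :: "nat list" and i
    by (rule nth_equalityI) (auto simp: nth_Cons split: nat.split)
  show "bd (lev Simplex2_co n) (Suc (Suc k)) (cone (gen x)) = gen x + cone (bd (lev Simplex2_co n) (Suc k) (gen x))"
    unfolding x cone_def kmap_gen bd_gen kmap_sum
    by (subst sum.atMost_Suc_shift) (simp add: 0[OF l(1)] 0[OF l(2)] S del: sum.atMost_Suc)
qed (simp_all add: cone_def ac_simps)

lemma family_bd_id_map: "family_bd Simplex_co 0 (\<lambda>p. gen (id_map p)) n = 0"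
proof (cases n)
  case (Suc k)
  then show ?thesis
    by (simp add: family_bd_def sum_cofaces_id_map codiff_def after_id_map nat_add_distrib del: sum.atMost_Suc)
qed (simp add: family_bd_def)

lemma family_bd_diagonal: "family_bd Simplex2_co 0 diagonal n = 0"
proof (cases n)
  case (Suc k)
  then show ?thesis
    using id_map_after[OF mono_mapsD(2)[OF cofc_in_mono_maps]]
    by (simp add: family_bd_def bd_gen codiff_def after_id_map nat_add_distrib del: sum.atMost_Suc)
qed (simp add: family_bd_def)

lemma family_bd_AW_diagonal: "family_bd Simplex2_co 0 AW_diagonal n = 0"
  using aw_shuffle_Leibniz[OF cosimplicial_space_Simplex_co cosimplicial_space_Simplex_co,
      of "\<lambda>p. gen (id_map p)" 0 "\<lambda>p. gen (id_map p)" 0 n]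
  by (simp add: AW_diagonal_def family_bd_id_map[abs_def] id_map_in_chn aw_shuffle_def)

lemma AW_diagonal_chn: "AW_diagonal n \<in> chn (lev Simplex2_co n) (int n)"
  using aw_shuffle_chn[OF cosimplicial_space_Simplex_co cosimplicial_space_Simplex_co,
      of "\<lambda>p. gen (id_map p)" 0 "\<lambda>p. gen (id_map p)" 0 n]
  by (simp add: AW_diagonal_def id_map_in_chn)

lemma diagonal_chn: "diagonal n \<in> chn (lev Simplex2_co n) (int n)"
  by (simp add: chn_def)

lemma AW_diagonal_0: "AW_diagonal 0 = diagonal 0"
proof -
  have "{\<mu>. \<mu> \<subseteq> {..<0::nat} \<and> card \<mu> = 0} = {{}}" by auto
  moreover have "shift_map 0 0 = [0]" "id_map 0 = [0]" "collapse 0 {} = [0]"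
    by (simp_all add: shift_map_def id_map_def collapse_def)
  ultimately show ?thesis
    by (simp add: AW_diagonal_def aw_shuffle_def shuffle_gen after_def)
qed

lemmas cosimplicial_space_Simplex2_co =
  cosimplicial_space_cprod[OF cosimplicial_space_Simplex_co cosimplicial_space_Simplex_co]

lemma EZ_homotopy_chn: "EZ_homotopy n \<in> chn (lev Simplex2_co n) (int (Suc n))"
proof (induction n)
  case (Suc n)
  let ?z = "diagonal (Suc n) + AW_diagonal (Suc n) + codiff Simplex2_co n (int (Suc n)) (EZ_homotopy n)"
  have "?z \<in> chn (lev Simplex2_co (Suc n)) (int (Suc n))"
    by (intro submodule_add[OF submodule_chn] diagonal_chn AW_diagonal_chn
        codiff_chn[OF cosimplicial_space_Simplex2_co] Suc)
  then have "?z \<in> free_on (cells (lev Simplex2_co (Suc n)) (Suc n))"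
    using chn_free_on[of ?z "lev Simplex2_co (Suc n)" "int (Suc n)"] by simp
  then have "cone ?z \<in> free_on (cells (lev Simplex2_co (Suc n)) (Suc (Suc n)))" by (rule cone_free_on)
  moreover have "1 + int n = int (Suc n)" "nat (int (Suc (Suc n))) = Suc (Suc n)" "\<not> int (Suc (Suc n)) < 0" by simp_all
  ultimately show ?case
    by (simp only: chn_def if_False EZ_homotopy.simps)
qed (simp add: submodule_zero[OF submodule_chn])

text \<open>
  It suffices that the chain under the cone is a cycle. The families given by the diagonal and by its
  approximation are compatible with the boundary, and the iterated cofaces of the homotopy in lower
  degrees cancel in pairs.
\<close>

lemma family_bd_EZ_homotopy:
  "family_bd Simplex2_co 1 EZ_homotopy n = diagonal n + AW_diagonal n"
proof (induction n)
  case 0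
  then show ?case
    by (simp add: family_bd_def AW_diagonal_0)
next
  case (Suc n)
  let ?L = "lev Simplex2_co" and ?d = "codiff Simplex2_co"
  note D = cosimplicial_space_cprod[OF cosimplicial_space_Simplex_co cosimplicial_space_Simplex_co]
  have deg: "1 + int n = int (Suc n)" by simp
  note H = EZ_homotopy_chn[of n]
  define z where "z = diagonal (Suc n) + AW_diagonal (Suc n) + ?d n (int (Suc n)) (EZ_homotopy n)"
  have z: "z \<in> chn (?L (Suc n)) (int (Suc n))"
    unfolding z_def by (intro submodule_add[OF submodule_chn] diagonal_chn AW_diagonal_chn codiff_chn D H)
  have H': "EZ_homotopy (Suc n) = cone z" by (simp only: EZ_homotopy.simps z_def deg)
  have "bd (?L (Suc n)) (Suc n) (diagonal (Suc n)) = ?d n (int n) (diagonal n)"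
    using family_bd_diagonal[of "Suc n"] by (simp add: family_bd_def add_eq_0_iff del: lev_cprod)
  moreover have "bd (?L (Suc n)) (Suc n) (AW_diagonal (Suc n)) = ?d n (int n) (AW_diagonal n)"
    using family_bd_AW_diagonal[of "Suc n"] by (simp add: family_bd_def add_eq_0_iff del: lev_cprod)
  moreover have "bd (?L (Suc n)) (Suc n) (?d n (int (Suc n)) (EZ_homotopy n)) =
      ?d n (int n) (diagonal n) + ?d n (int n) (AW_diagonal n)"
  proof -
    have "bd (?L (Suc n)) (Suc n) (?d n (int (Suc n)) (EZ_homotopy n)) = ?d n (int n) (bd (?L n) (Suc n) (EZ_homotopy n))"
      using bd_codiff[OF D H] by (simp del: lev_cprod)
    also have "bd (?L n) (Suc n) (EZ_homotopy n) = diagonal n + AW_diagonal n +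
        (case n of 0 \<Rightarrow> 0 | Suc k \<Rightarrow> ?d k (int n) (EZ_homotopy k))"
    proof -
      have "bd (?L n) (Suc n) (EZ_homotopy n) + (case n of 0 \<Rightarrow> 0 | Suc k \<Rightarrow> ?d k (1 + int k) (EZ_homotopy k)) =
          diagonal n + AW_diagonal n"
        using Suc by (simp add: family_bd_def nat_add_distrib del: lev_cprod)
      moreover have "(case n of 0 \<Rightarrow> 0 | Suc k \<Rightarrow> ?d k (1 + int k) (EZ_homotopy k)) =
          (case n of 0 \<Rightarrow> 0 | Suc k \<Rightarrow> ?d k (int n) (EZ_homotopy k))"
        by (simp split: nat.split)
      moreover have "x = z + y'" if "x + y = z" "y = y'" for x y y' z :: "nat list \<times> nat list \<Rightarrow>\<^sub>0 bit"
        using that by (auto simp: add.assoc)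
      ultimately show ?thesis by blast
    qed
    also have "?d n (int n) \<dots> = ?d n (int n) (diagonal n) + ?d n (int n) (AW_diagonal n)"
    proof (cases n)
      case 0 then show ?thesis by (simp add: codiff_add)
    next
      case (Suc k)
      show ?thesis using codiff_codiff[OF D EZ_homotopy_chn[of k]] by (simp add: Suc codiff_add)
    qed
    finally show ?thesis .
  qed
  ultimately have "bd (?L (Suc n)) (Suc n) z = 0"
    unfolding z_def bd_add by (simp add: ac_simps)
  moreover have z': "z \<in> free_on (cells (?L (Suc n)) (Suc n))"
    using chn_free_on[OF z] by simp
  ultimately have "bd (?L (Suc n)) (Suc (Suc n)) (cone z) = z"
    using bd_cone[OF z'] by (simp add: cone_def)
  then have "family_bd Simplex2_co 1 EZ_homotopy (Suc n) = z + ?d n (int (Suc n)) (EZ_homotopy n)"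
    unfolding family_bd_def H' by (simp add: nat_add_distrib)
  then show ?case
    unfolding z_def by (simp add: add.assoc)
qed

section \<open>Multiplicativity of the evaluation up to homotopy\<close>

text \<open>
  The evaluation of two simplices of \<open>Tot X\<close> and \<open>Tot X'\<close> at two independent simplices of \<open>\<Delta>\<^sup>n\<close>.
  The product on the homology of \<open>Tot\<close> uses it on the diagonal of \<open>\<Delta>\<^sup>n \<times> \<Delta>\<^sup>n\<close>, the product of the
  spectral sequence on the Alexander--Whitney approximation of the diagonal.
\<close>

definition eval2 :: "nat \<Rightarrow> nat \<Rightarrow> (nat list \<times> nat list) \<times> ('a tot \<times> 'b tot) \<Rightarrow> 'a \<times> 'b" where
  "eval2 n k w = map_prod (eval n k) (eval n k) (mid_swap w)"

lemma simplicial_map_mid_swap: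
  "simplicial_map (sprod (sprod A B) (sprod C D)) (sprod (sprod A C) (sprod B D)) (\<lambda>n. mid_swap)"
  by (auto simp: simplicial_map_def mid_swap_def)

lemma simplicial_map_eval2:
  "simplicial_map (sprod (lev Simplex2_co n) (sprod (Tot X) (Tot X'))) (lev (cprod X X') n) (eval2 n)"
  using simplicial_map_compose[OF simplicial_map_mid_swap simplicial_map_sprod[OF simplicial_map_eval simplicial_map_eval]]
  unfolding eval2_def[abs_def] lev_cprod lev_Simplex_co .

abbreviation pairing2 :: "'a cospace \<Rightarrow> 'b cospace \<Rightarrow> nat \<Rightarrow> int \<Rightarrow> int \<Rightarrow>
    (nat list \<times> nat list \<Rightarrow>\<^sub>0 bit) \<Rightarrow> ('a tot \<times> 'b tot \<Rightarrow>\<^sub>0 bit) \<Rightarrow> ('a \<times> 'b \<Rightarrow>\<^sub>0 bit)" where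
  "pairing2 X X' n \<equiv> pairing (eval2 n) (lev Simplex2_co n) (sprod (Tot X) (Tot X'))"

context
  fixes X :: "'a cospace" and X' :: "'b cospace"
  assumes X: "cosimplicial_space X" and X': "cosimplicial_space X'"
begin

lemmas eval2_pairing = cosimplicial_spaceD(1)[OF cosimplicial_space_Simplex2_co]
  simplicial_set_sprod[OF simplicial_set_Tot[of undefined X] simplicial_set_Tot[of undefined X']]
  cosimplicial_spaceD(1)[OF cosimplicial_space_cprod[OF X X']] simplicial_map_eval2[of _ X X']

lemma coface_pairing2:
  assumes c: "c \<in> chn (lev Simplex2_co n) i" and x: "x \<in> chn (sprod (Tot X) (Tot X')) m"
  shows "coface (cprod X X') (Suc n) k (i + m) (pairing2 X X' n i m c x) =
    pairing2 X X' (Suc n) i m (coface Simplex2_co (Suc n) k i c) x"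
proof (rule pairing_natural[where g = "cop (cprod X X') (Suc n) (cofc (Suc n) k)" and f = "cop Simplex2_co (Suc n) (cofc (Suc n) k)",
      OF cosimplicial_spaceD(2)[OF cosimplicial_space_Simplex2_co cofc_in_mono_maps] _ eval2_pairing(1,2) c x])
  fix j u t assume "u \<in> cells (lev Simplex2_co n) j" "t \<in> cells (sprod (Tot X) (Tot X')) j"
  then show "cop (cprod X X') (Suc n) (cofc (Suc n) k) j (eval2 n j (u, t)) =
      eval2 (Suc n) j (cop Simplex2_co (Suc n) (cofc (Suc n) k) j u, t)"
    by (auto simp: eval2_def mid_swap_def eval_cosimplicial[OF cofc_in_mono_maps])
qed

lemma codiff_pairing2:
  assumes c: "c \<in> chn (lev Simplex2_co n) i" and x: "x \<in> chn (sprod (Tot X) (Tot X')) m"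
  shows "codiff (cprod X X') n (i + m) (pairing2 X X' n i m c x) =
    pairing2 X X' (Suc n) i m (codiff Simplex2_co n i c) x"
  unfolding codiff_def pairing_sum_left by (rule sum.cong) (simp_all only: coface_pairing2[OF c x])

text \<open>
  The two shuffle products on the left are interchanged, so that each simplex of \<open>\<Delta>\<^sup>n\<close> meets the chain
  at which it is evaluated.
\<close>

lemma pairing2_shuffle:
  assumes c: "c \<in> chn (Simplex n) i" "c' \<in> chn (Simplex n) i'"
    and a: "a \<in> chn (Tot X) m" and b: "b \<in> chn (Tot X') m'"
  shows "pairing2 X X' n (i + i') (m + m') (shuffle (Simplex n) (Simplex n) (nat i) (nat i') c c')
      (shuffle (Tot X) (Tot X') (nat m) (nat m') a b) =
    shuffle (lev X n) (lev X' n) (nat (i + m)) (nat (i' + m'))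
      (pairing (eval n) (Simplex n) (Tot X) i m c a) (pairing (eval n) (Simplex n) (Tot X') i' m' c' b)"
proof (cases "i < 0 \<or> i' < 0 \<or> m < 0 \<or> m' < 0")
  case True
  then have "c = 0 \<or> c' = 0 \<or> a = 0 \<or> b = 0" using assms by (auto simp: chn_def)
  then show ?thesis by auto
next
  case False
  let ?S = "Simplex n"
  note S = simplicial_set_Simplex[of n] and T = simplicial_set_Tot[of undefined X] and T' = simplicial_set_Tot[of undefined X']
  have deg: "i + i' + (m + m') = (i + m) + (i' + m')" by simp
  have nat: "nat (i + i') = nat i + nat i'" "nat (m + m') = nat m + nat m'"
    "nat (i + m) = nat i + nat m" "nat (i' + m') = nat i' + nat m'"
    using False by (simp_all add: nat_add_distrib)
  have "pairing2 X X' n (i + i') (m + m') (shuffle ?S ?S (nat i) (nat i') c c') (shuffle (Tot X) (Tot X') (nat m) (nat m') a b) =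
      kmap (map_prod (eval n (nat ((i + m) + (i' + m')))) (eval n (nat ((i + m) + (i' + m')))))
        (kmap mid_swap (shuffle (sprod ?S ?S) (sprod (Tot X) (Tot X')) (nat i + nat i') (nat m + nat m')
          (shuffle ?S ?S (nat i) (nat i') c c') (shuffle (Tot X) (Tot X') (nat m) (nat m') a b)))"
    by (simp only: pairing_def lev_cprod lev_Simplex_co kmap_kmap eval2_def[abs_def] deg nat(1,2))
  also have "kmap mid_swap (shuffle (sprod ?S ?S) (sprod (Tot X) (Tot X')) (nat i + nat i') (nat m + nat m')
          (shuffle ?S ?S (nat i) (nat i') c c') (shuffle (Tot X) (Tot X') (nat m) (nat m') a b)) =
      shuffle (sprod ?S (Tot X)) (sprod ?S (Tot X')) (nat (i + m)) (nat (i' + m'))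
        (shuffle ?S (Tot X) (nat i) (nat m) c a) (shuffle ?S (Tot X') (nat i') (nat m') c' b)"
    unfolding nat(3,4) by (intro shuffle_interchange S T T' chn_free_on assms)
  also have "kmap (map_prod (eval n (nat ((i + m) + (i' + m')))) (eval n (nat ((i + m) + (i' + m'))))) \<dots> =
      shuffle (lev X n) (lev X' n) (nat (i + m)) (nat (i' + m'))
        (kmap (eval n (nat (i + m))) (shuffle ?S (Tot X) (nat i) (nat m) c a))
        (kmap (eval n (nat (i' + m'))) (shuffle ?S (Tot X') (nat i') (nat m') c' b))"
    by (intro shuffle_natural_int simplicial_map_eval shuffle_chn S T T' assms)
  finally show ?thesis by (simp only: pairing_def)
qed

lemma pairing2_diagonal:
  assumes x: "x \<in> chn (sprod (Tot X) (Tot X')) m"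
  shows "pairing2 X X' n (int n) m (diagonal n) x = phi (cprod X X') m (kmap (Tot_prod_iso (nat m)) x) n"
proof -
  let ?T = "sprod (Tot X) (Tot X')" and ?N = "nat (int n + m)"
  note id = id_map_in_chn[of n]
  have diag: "simplicial_map (Simplex n) (lev Simplex2_co n) (\<lambda>k u. (u, u))"
    by (simp add: simplicial_map_def)
  let ?s = "shuffle (Simplex n) ?T (nat (int n)) (nat m) (gen (id_map n)) x"
  have "phi (cprod X X') m (kmap (Tot_prod_iso (nat m)) x) n =
      kmap (eval n ?N) (kmap (map_prod (\<lambda>u. u) (Tot_prod_iso ?N)) ?s)"
    unfolding phi_def pairing_def
    using shuffle_natural_int[OF simplicial_map_id simplicial_map_Tot_prod_iso id x] by simp
  also have "\<dots> = kmap (eval2 n ?N) (kmap (map_prod (\<lambda>u. (u, u)) (\<lambda>x. x)) ?s)"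
    unfolding kmap_kmap
  proof (rule kmap_cong[OF refl])
    fix w assume "w \<in> Poly_Mapping.keys ?s"
    then have "w \<in> cells (sprod (Simplex n) ?T) ?N"
      using free_on_keys[OF chn_free_on[OF shuffle_chn[OF simplicial_set_Simplex eval2_pairing(2) id x]]] by blast
    then show "eval n ?N (map_prod (\<lambda>u. u) (Tot_prod_iso ?N) w) = eval2 n ?N (map_prod (\<lambda>u. (u, u)) (\<lambda>x. x) w)"
      by (auto simp: eval2_def mid_swap_def eval_def Tot_prod_iso_def on_dom_eq)
  qed
  also have "\<dots> = pairing2 X X' n (int n) m (diagonal n) x"
    unfolding pairing_def
    using shuffle_natural_int[OF diag simplicial_map_id id x] by (simp add: kmap_id)
  finally show ?thesis ..
qed

lemma pairing2_AW_diagonal: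
  assumes a: "a \<in> chn (Tot X) m" and b: "b \<in> chn (Tot X') m'"
  shows "pairing2 X X' n (int n) (m + m') (AW_diagonal n) (shuffle (Tot X) (Tot X') (nat m) (nat m') a b) =
    aw_shuffle X X' m m' (phi X m a) (phi X' m' b) n"
proof -
  have "pairing2 X X' n (int n) (m + m') (shuffle (Simplex n) (Simplex n) (nat (int p)) (nat (int (n - p)))
        (gen (id_map p)) (gen (shift_map p (n - p)))) (shuffle (Tot X) (Tot X') (nat m) (nat m') a b) =
      shuffle (lev X n) (lev X' n) (nat (m + int p)) (nat (m' + int (n - p)))
        (cm X n (id_map p) (m + int p) (phi X m a p)) (cm X' n (shift_map p (n - p)) (m' + int (n - p)) (phi X' m' b (n - p)))"
    if "p \<le> n" for p
  proof -
    have id: "id_map p \<in> mono_maps p n" and sh: "shift_map p (n - p) \<in> mono_maps (n - p) n"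
      using that by (auto intro: id_map_in_mono_maps' shift_map_in_mono_maps)
    have n: "int n = int p + int (n - p)" using that by simp
    have "gen (id_map p) \<in> chn (Simplex n) (int p)" "gen (shift_map p (n - p)) \<in> chn (Simplex n) (int (n - p))"
      using id sh by (simp_all add: chn_def del: of_nat_diff)
    from pairing2_shuffle[OF this a b]
    show ?thesis unfolding n by (simp only: cm_phi[OF X id a] cm_phi[OF X' sh b] add.commute[of "int p" m] add.commute[of "int (n - p)" m'])
  qed
  moreover have "AW_diagonal n = (\<Sum>p\<le>n. shuffle (Simplex n) (Simplex n) (nat (int p)) (nat (int (n - p)))
        (gen (id_map p)) (gen (shift_map p (n - p))))"
    by (simp add: AW_diagonal_def aw_shuffle_def after_id_map)
  ultimately show ?thesis
    unfolding aw_shuffle_def by (simp add: pairing_sum_left del: of_nat_diff)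
qed

text \<open>
  The Eilenberg--Zilber homotopy, evaluated on a product of cycles, is a chain whose boundary is the
  difference of the two products.
\<close>

theorem HTot_mult_homologous_TC_mult:
  assumes a: "a \<in> chn (Tot X) m" "bd (Tot X) (nat m) a \<in> dgn (Tot X) (m - 1)"
    and b: "b \<in> chn (Tot X') m'" "bd (Tot X') (nat m') b \<in> dgn (Tot X') (m' - 1)"
  obtains y where "y \<in> tch (cprod X X') (m + m' + 1)"
    "tbd (cprod X X') (m + m' + 1) y +
      (to_TC (m + m') (HTot_mult X X' m m' a b) + TC_mult X X' m m' (to_TC m a) (to_TC m' b)) \<in> trl (cprod X X') (m + m')"
proof -
  let ?T = "sprod (Tot X) (Tot X')" and ?XX = "cprod X X'" and ?L = "lev Simplex2_co"
  define M where "M = m + m'"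
  define x where "x = shuffle (Tot X) (Tot X') (nat m) (nat m') a b"
  define h where "h = (\<lambda>n. pairing2 X X' n (int (Suc n)) M (EZ_homotopy n) x)"
  define y where "y = (\<lambda>j::int. if j > 0 then 0 else h (nat (- j)))"
  note XX = cosimplicial_space_cprod[OF X X']
  note T = simplicial_set_Tot[of undefined X] and T' = simplicial_set_Tot[of undefined X']
  have x: "x \<in> chn ?T M" unfolding x_def M_def by (intro shuffle_chn T T' a b)
  have bdx: "bd ?T (nat M) x \<in> dgn ?T (M - 1)"
  proof -
    have "shuffle (Tot X) (Tot X') (nat (m - 1)) (nat m') (bd (Tot X) (nat m) a) b \<in> dgn ?T (m - 1 + m')"
      by (intro shuffle_dgn_left T T' a b)
    moreover have "shuffle (Tot X) (Tot X') (nat m) (nat (m' - 1)) a (bd (Tot X') (nat m') b) \<in> dgn ?T (m + (m' - 1))"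
      by (intro shuffle_dgn_right T T' a b)
    moreover have "m - 1 + m' = M - 1" "m + (m' - 1) = M - 1" by (simp_all add: M_def)
    ultimately show ?thesis
      unfolding x_def M_def shuffle_Leibniz_int[OF T T' a(1) b(1)]
      by (simp add: submodule_add[OF submodule_dgn])
  qed
  have h: "h n \<in> chn (lev ?XX n) (M + 1 + int n)" for n
    using pairing_chn[OF eval2_pairing EZ_homotopy_chn x, of n] by (simp add: h_def add_ac)
  have y: "represents ?XX (M + 1) y h"
    using h by (simp add: represents_def y_def submodule_zero[OF submodule_conorm_rel])
  have bd_h: "family_bd ?XX (M + 1) h n + (phi ?XX M (kmap (Tot_prod_iso (nat M)) x) n + aw_shuffle X X' m m' (phi X m a) (phi X' m' b) n)
      \<in> dgn (lev ?XX n) (M + int n)" for n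
  proof -
    let ?p = "pairing2 X X' n"
    have "bd (lev ?XX n) (nat (M + 1 + int n)) (h n) =
        ?p (int n) M (bd (?L n) (Suc n) (EZ_homotopy n)) x + ?p (int (Suc n)) (M - 1) (EZ_homotopy n) (bd ?T (nat M) x)"
      using pairing_Leibniz[OF eval2_pairing EZ_homotopy_chn x, of n]
      by (simp add: h_def add_ac)
    moreover have "(case n of 0 \<Rightarrow> 0 | Suc k \<Rightarrow> codiff ?XX k (M + 1 + int k) (h k)) =
        ?p (int n) M (case n of 0 \<Rightarrow> 0 | Suc k \<Rightarrow> codiff Simplex2_co k (1 + int k) (EZ_homotopy k)) x"
    proof (cases n)
      case (Suc k)
      have "codiff ?XX k (int (Suc k) + M) (h k) = pairing2 X X' (Suc k) (int (Suc k)) M (codiff Simplex2_co k (int (Suc k)) (EZ_homotopy k)) x"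
        unfolding h_def by (rule codiff_pairing2[OF EZ_homotopy_chn x])
      moreover have "int (Suc k) + M = M + 1 + int k" "1 + int k = int (Suc k)" by simp_all
      ultimately show ?thesis by (simp only: Suc nat.case)
    qed simp
    ultimately have "family_bd ?XX (M + 1) h n = ?p (int n) M (family_bd Simplex2_co 1 EZ_homotopy n) x +
        ?p (int (Suc n)) (M - 1) (EZ_homotopy n) (bd ?T (nat M) x)"
      unfolding family_bd_def by (simp add: pairing_add ac_simps del: lev_cprod of_nat_Suc)
    also have "?p (int n) M (family_bd Simplex2_co 1 EZ_homotopy n) x =
        phi ?XX M (kmap (Tot_prod_iso (nat M)) x) n + aw_shuffle X X' m m' (phi X m a) (phi X' m' b) n"
      unfolding family_bd_EZ_homotopy pairing_add pairing2_diagonal[OF x]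
      unfolding M_def x_def pairing2_AW_diagonal[OF a(1) b(1)] ..
    finally have "family_bd ?XX (M + 1) h n + (phi ?XX M (kmap (Tot_prod_iso (nat M)) x) n + aw_shuffle X X' m m' (phi X m a) (phi X' m' b) n) =
        ?p (int (Suc n)) (M - 1) (EZ_homotopy n) (bd ?T (nat M) x)"
      by (simp add: ac_simps)
    also have "\<dots> \<in> dgn (lev ?XX n) (int (Suc n) + (M - 1))"
      by (rule pairing_dgn_right[OF eval2_pairing EZ_homotopy_chn bdx])
    finally show ?thesis by (simp add: add_ac)
  qed
  have e: "kmap (Tot_prod_iso (nat M)) x \<in> chn (Tot ?XX) M"
    by (rule kmap_chn[OF simplicial_map_Tot_prod_iso x])
  have "represents ?XX M (tbd ?XX (M + 1) y + (to_TC M (kmap (Tot_prod_iso (nat M)) x) + TC_mult X X' m m' (to_TC m a) (to_TC m' b)))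
      (\<lambda>n. family_bd ?XX (M + 1) h n + (phi ?XX M (kmap (Tot_prod_iso (nat M)) x) n + aw_shuffle X X' m m' (phi X m a) (phi X' m' b) n))"
  proof (intro represents_add)
    show "represents ?XX M (tbd ?XX (M + 1) y) (family_bd ?XX (M + 1) h)"
      using represents_tbd[OF XX y] by simp
    show "represents ?XX M (to_TC M (kmap (Tot_prod_iso (nat M)) x)) (phi ?XX M (kmap (Tot_prod_iso (nat M)) x))"
      by (rule to_TC_represents[OF XX e])
    show "represents ?XX M (TC_mult X X' m m' (to_TC m a) (to_TC m' b)) (aw_shuffle X X' m m' (phi X m a) (phi X' m' b))"
      unfolding M_def
      by (rule TC_mult_represents[OF X X' to_TC_represents[OF X a(1)] phi_normalized[OF X a(1)]
            to_TC_represents[OF X' b(1)] phi_normalized[OF X' b(1)]])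
  qed
  then have "tbd ?XX (M + 1) y + (to_TC M (kmap (Tot_prod_iso (nat M)) x) + TC_mult X X' m m' (to_TC m a) (to_TC m' b)) \<in> trl ?XX M"
    by (rule represents_dgn_iff) (rule bd_h)
  moreover have "kmap (Tot_prod_iso (nat M)) x = HTot_mult X X' m m' a b"
    by (simp add: HTot_mult_def x_def M_def)
  moreover have "y \<in> tch ?XX (M + 1)" by (rule represents_tch[OF XX y])
  ultimately show ?thesis using that[of y] by (simp add: M_def)
qed

end

section \<open>Tensor products\<close>

lemma kmoduleD:
  assumes "kmodule M"
  shows "submodule (carr M)" "submodule (rel M)" "rel M \<subseteq> carr M"
  using assms by (auto simp: kmodule_def submodule_def)

lemma kmoduleI:
  fixes M :: "'v::exponent_two kmod"
  assumes "submodule (carr M)" "submodule (rel M)" "rel M \<subseteq> carr M"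
  shows "kmodule M"
  using assms by (auto simp: kmodule_def submodule_def)

lemma kmod_homI:
  fixes N :: "'w::exponent_two kmod"
  assumes "\<And>x. x \<in> carr M \<Longrightarrow> f x \<in> carr N" "\<And>x. x \<in> rel M \<Longrightarrow> f x \<in> rel N"
    and "\<And>x y. x \<in> carr M \<Longrightarrow> y \<in> carr M \<Longrightarrow> f (x + y) + (f x + f y) \<in> rel N"
  shows "kmod_hom M N f"
  using assms by (simp add: kmod_hom_def eq_in_def)

lemma kmod_homD:
  fixes N :: "'w::exponent_two kmod"
  assumes "kmod_hom M N f"
  shows "x \<in> carr M \<Longrightarrow> f x \<in> carr N" "x \<in> rel M \<Longrightarrow> f x \<in> rel N"
    and "x \<in> carr M \<Longrightarrow> y \<in> carr M \<Longrightarrow> f (x + y) + (f x + f y) \<in> rel N"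
  using assms by (simp_all add: kmod_hom_def eq_in_def)

lemma carr_tensor: "carr (tensor M N) = free_on (carr M \<times> carr N)"
  by (simp add: tensor_def free_on_def)

lemma submodule_rel_tensor: "submodule (rel (tensor M N))"
  by (simp add: tensor_def submodule_kspan)

lemma tensor_rel_image:
  fixes F :: "('v::ab_group_add \<times> 'w::ab_group_add \<Rightarrow>\<^sub>0 bit) \<Rightarrow> 'z::ab_group_add"
  assumes F: "\<And>a b. F (a + b) = F a + F b" and S: "submodule S"
    and "\<And>x x' y. x \<in> carr M \<Longrightarrow> x' \<in> carr M \<Longrightarrow> y \<in> carr N \<Longrightarrow> F (gen (x + x', y)) + (F (gen (x, y)) + F (gen (x', y))) \<in> S"
    and "\<And>x y y'. x \<in> carr M \<Longrightarrow> y \<in> carr N \<Longrightarrow> y' \<in> carr N \<Longrightarrow> F (gen (x, y + y')) + (F (gen (x, y)) + F (gen (x, y'))) \<in> S"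
    and "\<And>x y. x \<in> rel M \<Longrightarrow> y \<in> carr N \<Longrightarrow> F (gen (x, y)) \<in> S"
    and "\<And>x y. x \<in> carr M \<Longrightarrow> y \<in> rel N \<Longrightarrow> F (gen (x, y)) \<in> S"
    and a: "a \<in> rel (tensor M N)"
  shows "F a \<in> S"
  using a unfolding tensor_def kmod.simps
  by (rule kspan_image[OF F S, rotated]) (auto simp: F assms)

lemma tensor_rel_generators:
  shows "x \<in> carr M \<Longrightarrow> x' \<in> carr M \<Longrightarrow> y \<in> carr N \<Longrightarrow> gen (x + x', y) + (gen (x, y) + gen (x', y)) \<in> rel (tensor M N)"
    and "x \<in> carr M \<Longrightarrow> y \<in> carr N \<Longrightarrow> y' \<in> carr N \<Longrightarrow> gen (x, y + y') + (gen (x, y) + gen (x, y')) \<in> rel (tensor M N)"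
    and "x \<in> rel M \<Longrightarrow> y \<in> carr N \<Longrightarrow> gen (x, y) \<in> rel (tensor M N)"
    and "x \<in> carr M \<Longrightarrow> y \<in> rel N \<Longrightarrow> gen (x, y) \<in> rel (tensor M N)"
proof -
  assume "x \<in> carr M" "x' \<in> carr M" "y \<in> carr N"
  then show "gen (x + x', y) + (gen (x, y) + gen (x', y)) \<in> rel (tensor M N)"
    unfolding tensor_def kmod.simps minus_eq by (intro kspan_base) blast
next
  assume "x \<in> carr M" "y \<in> carr N" "y' \<in> carr N"
  then show "gen (x, y + y') + (gen (x, y) + gen (x, y')) \<in> rel (tensor M N)"
    unfolding tensor_def kmod.simps minus_eq by (intro kspan_base) blast
next
  assume "x \<in> rel M" "y \<in> carr N"
  then show "gen (x, y) \<in> rel (tensor M N)"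
    unfolding tensor_def kmod.simps by (intro kspan_base) blast
next
  assume "x \<in> carr M" "y \<in> rel N"
  then show "gen (x, y) \<in> rel (tensor M N)"
    unfolding tensor_def kmod.simps by (intro kspan_base) blast
qed

lemma kmodule_tensor:
  assumes M: "kmodule M" and N: "kmodule N"
  shows "kmodule (tensor M N)"
proof (rule kmoduleI)
  show "submodule (carr (tensor M N))" by (simp add: carr_tensor submodule_free_on)
  show "submodule (rel (tensor M N))" by (rule submodule_rel_tensor)
  show "rel (tensor M N) \<subseteq> carr (tensor M N)"
  proof
    fix a assume "a \<in> rel (tensor M N)"
    then show "a \<in> carr (tensor M N)"
      unfolding carr_tensor
      by (rule tensor_rel_image[of "\<lambda>a. a", rotated -1])
         (use kmoduleD[OF M] kmoduleD[OF N] in \<open>auto intro!: submodule_add[OF submodule_free_on] submodule_free_on submodule_add\<close>)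
  qed
qed

lemma tensor_lift_gen: "tensor_lift \<mu> (gen (x, y)) = \<mu> x y"
  by (simp add: tensor_lift_def)

lemma tensor_lift_add:
  fixes \<mu> :: "'v \<Rightarrow> 'w \<Rightarrow> 'z::exponent_two"
  shows "tensor_lift \<mu> (a + b) = tensor_lift \<mu> a + tensor_lift \<mu> b"
  by (simp add: tensor_lift_def klin_add)

lemma kmod_hom_tensor_lift:
  fixes \<mu> :: "'v::ab_group_add \<Rightarrow> 'w::ab_group_add \<Rightarrow> 'z::exponent_two"
  assumes P: "kmodule P"
    and "\<And>x y. x \<in> carr M \<Longrightarrow> y \<in> carr N \<Longrightarrow> \<mu> x y \<in> carr P"
    and "\<And>x x' y. x \<in> carr M \<Longrightarrow> x' \<in> carr M \<Longrightarrow> y \<in> carr N \<Longrightarrow> \<mu> (x + x') y + (\<mu> x y + \<mu> x' y) \<in> rel P"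
    and "\<And>x y y'. x \<in> carr M \<Longrightarrow> y \<in> carr N \<Longrightarrow> y' \<in> carr N \<Longrightarrow> \<mu> x (y + y') + (\<mu> x y + \<mu> x y') \<in> rel P"
    and "\<And>x y. x \<in> rel M \<Longrightarrow> y \<in> carr N \<Longrightarrow> \<mu> x y \<in> rel P"
    and "\<And>x y. x \<in> carr M \<Longrightarrow> y \<in> rel N \<Longrightarrow> \<mu> x y \<in> rel P"
  shows "kmod_hom (tensor M N) P (tensor_lift \<mu>)"
proof (rule kmod_homI)
  fix a assume "a \<in> carr (tensor M N)"
  then show "tensor_lift \<mu> a \<in> carr P"
    unfolding carr_tensor
    by (rule free_on_image[OF tensor_lift_add kmoduleD(1)[OF P], rotated]) (auto simp: tensor_lift_gen assms)
next
  fix a assume "a \<in> rel (tensor M N)"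
  then show "tensor_lift \<mu> a \<in> rel P"
    by (rule tensor_rel_image[OF tensor_lift_add kmoduleD(2)[OF P], rotated -1]) (simp_all add: tensor_lift_gen assms)
next
  fix a b show "tensor_lift \<mu> (a + b) + (tensor_lift \<mu> a + tensor_lift \<mu> b) \<in> rel P"
    using submodule_zero[OF kmoduleD(2)[OF P]] by (simp add: tensor_lift_add)
qed

lemma kmod_hom_tensor_map:
  fixes f :: "'v::ab_group_add \<Rightarrow> 'v2::exponent_two" and g :: "'w::ab_group_add \<Rightarrow> 'w2::exponent_two"
  assumes f: "kmod_hom M M' f" and g: "kmod_hom N N' g" and M': "kmodule M'" and N': "kmodule N'"
  shows "kmod_hom (tensor M N) (tensor M' N') (tensor_map f g)"
proof -
  let ?R = "rel (tensor M' N')"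
  note R = submodule_rel_tensor[of M' N'] and M'D = kmoduleD[OF M'] and N'D = kmoduleD[OF N']
  have left: "gen (z, y) + (gen (x, y) + gen (x', y)) \<in> ?R"
    if "z + (x + x') \<in> rel M'" "x \<in> carr M'" "x' \<in> carr M'" "y \<in> carr N'" for x x' y z
  proof -
    have "gen (z, y) = gen ((z + (x + x')) + (x + x'), y)" by (simp add: add.assoc)
    moreover have "gen ((z + (x + x')) + (x + x'), y) + (gen (z + (x + x'), y) + gen (x + x', y)) \<in> ?R"
      using that M'D by (intro tensor_rel_generators(1)) (auto intro: submodule_add)
    moreover have "gen (z + (x + x'), y) \<in> ?R" using that by (intro tensor_rel_generators(3))
    moreover have "gen (x + x', y) + (gen (x, y) + gen (x', y)) \<in> ?R" using that by (intro tensor_rel_generators(1))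
    ultimately have "(gen (z, y) + (gen (z + (x + x'), y) + gen (x + x', y))) + gen (z + (x + x'), y) +
        (gen (x + x', y) + (gen (x, y) + gen (x', y))) \<in> ?R"
      by (metis submodule_add[OF R])
    then show ?thesis by (simp add: ac_simps)
  qed
  have right: "gen (x, z) + (gen (x, y) + gen (x, y')) \<in> ?R"
    if "z + (y + y') \<in> rel N'" "x \<in> carr M'" "y \<in> carr N'" "y' \<in> carr N'" for x y y' z
  proof -
    have "gen (x, z) = gen (x, (z + (y + y')) + (y + y'))" by (simp add: add.assoc)
    moreover have "gen (x, (z + (y + y')) + (y + y')) + (gen (x, z + (y + y')) + gen (x, y + y')) \<in> ?R"
      using that N'D by (intro tensor_rel_generators(2)) (auto intro: submodule_add)
    moreover have "gen (x, z + (y + y')) \<in> ?R" using that by (intro tensor_rel_generators(4))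
    moreover have "gen (x, y + y') + (gen (x, y) + gen (x, y')) \<in> ?R" using that by (intro tensor_rel_generators(2))
    ultimately have "(gen (x, z) + (gen (x, z + (y + y')) + gen (x, y + y'))) + gen (x, z + (y + y')) +
        (gen (x, y + y') + (gen (x, y) + gen (x, y'))) \<in> ?R"
      by (metis submodule_add[OF R])
    then show ?thesis by (simp add: ac_simps)
  qed
  show ?thesis
  proof (rule kmod_homI)
    fix a assume "a \<in> carr (tensor M N)"
    then show "tensor_map f g a \<in> carr (tensor M' N')"
      unfolding carr_tensor tensor_map_def by (rule kmap_in_free_on) (auto simp: kmod_homD(1)[OF f] kmod_homD(1)[OF g])
  next
    fix a assume "a \<in> rel (tensor M N)"
    then show "tensor_map f g a \<in> ?R"
      unfolding tensor_map_def
    proof (rule tensor_rel_image[OF kmap_add R, rotated -1], unfold kmap_gen map_prod_simp)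
      show "gen (f (x + x'), g y) + (gen (f x, g y) + gen (f x', g y)) \<in> ?R"
        if "x \<in> carr M" "x' \<in> carr M" "y \<in> carr N" for x x' y
        using that by (intro left kmod_homD[OF f] kmod_homD[OF g])
      show "gen (f x, g (y + y')) + (gen (f x, g y) + gen (f x, g y')) \<in> ?R"
        if "x \<in> carr M" "y \<in> carr N" "y' \<in> carr N" for x y y'
        using that by (intro right kmod_homD[OF f] kmod_homD[OF g])
      show "gen (f x, g y) \<in> ?R" if "x \<in> rel M" "y \<in> carr N" for x y
        using that by (intro tensor_rel_generators(3) kmod_homD[OF f] kmod_homD[OF g])
      show "gen (f x, g y) \<in> ?R" if "x \<in> carr M" "y \<in> rel N" for x y
        using that by (intro tensor_rel_generators(4) kmod_homD[OF f] kmod_homD[OF g])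
    qed
  qed (simp add: tensor_map_def submodule_zero[OF R])
qed

section \<open>The filtration and the abutment\<close>

abbreviation tot_cycles :: "'a cospace \<Rightarrow> int \<Rightarrow> ('a tot \<Rightarrow>\<^sub>0 bit) set" where
  "tot_cycles X m \<equiv> carr (homology (S_space (Tot X)) m)"

abbreviation tcycles :: "'a cospace \<Rightarrow> int \<Rightarrow> (int \<Rightarrow> 'a \<Rightarrow>\<^sub>0 bit) set" where
  "tcycles X m \<equiv> carr (homology (TC (S_co X)) m)"

abbreviation tboundaries :: "'a cospace \<Rightarrow> int \<Rightarrow> (int \<Rightarrow> 'a \<Rightarrow>\<^sub>0 bit) set" where
  "tboundaries X m \<equiv> rel (homology (TC (S_co X)) m)"

abbreviation tfilt :: "'a cospace \<Rightarrow> int \<Rightarrow> int \<Rightarrow> (int \<Rightarrow> 'a \<Rightarrow>\<^sub>0 bit) set" where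
  "tfilt X s m \<equiv> filt (conorm (S_co X)) (- s) m"

lemma tot_cycles_iff:
  "a \<in> tot_cycles X m \<longleftrightarrow> a \<in> chn (Tot X) m \<and> bd (Tot X) (nat m) a \<in> dgn (Tot X) (m - 1)"
  by (simp add: homology_def chain_S_space bdry_S_space)

lemma tcycles_iff: "y \<in> tcycles X m \<longleftrightarrow> y \<in> tch X m \<and> tbd X m y \<in> trl X (m - 1)"
  by (simp add: homology_def)

lemma tboundaries_iff:
  "y \<in> tboundaries X m \<longleftrightarrow> (\<exists>u\<in>tch X (m + 1). tbd X (m + 1) u + y \<in> trl X m)"
proof
  assume "y \<in> tboundaries X m"
  then obtain u r where "u \<in> tch X (m + 1)" "r \<in> trl X m" "y = tbd X (m + 1) u + r" by (auto simp: homology_def)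
  then show "\<exists>u\<in>tch X (m + 1). tbd X (m + 1) u + y \<in> trl X m" by (intro bexI[of _ u]) simp_all
next
  assume "\<exists>u\<in>tch X (m + 1). tbd X (m + 1) u + y \<in> trl X m"
  then obtain u where "u \<in> tch X (m + 1)" "tbd X (m + 1) u + y \<in> trl X m" by blast
  moreover have "y = tbd X (m + 1) u + (tbd X (m + 1) u + y)" by simp
  ultimately show "y \<in> tboundaries X m" unfolding homology_def kmod.simps by blast
qed

lemma gr_HTot_simps: "carr (gr_HTot X s m) = carr (F_HTot X s m)" "rel (gr_HTot X s m) = carr (F_HTot X (s + 1) m)"
  by (simp_all add: gr_HTot_def)

lemma tcycles_tch: "y \<in> tcycles X m \<Longrightarrow> y \<in> tch X m"
  by (simp add: tcycles_iff)

lemma submodule_tot_cycles: "submodule (tot_cycles X m)"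
  by (auto simp: submodule_def tot_cycles_iff intro: submodule_zero[OF submodule_chn] submodule_add[OF submodule_chn]
      submodule_zero[OF submodule_dgn] submodule_add[OF submodule_dgn])

lemma tbd_zero: "tbd X m 0 = 0"
  by (rule additive_zero[of "tbd X m"]) (rule tbd_add)

lemma submodule_tcycles: "submodule (tcycles X m)"
  by (auto simp: submodule_def tcycles_iff tbd_add tbd_zero intro: submodule_zero[OF submodule_tch] submodule_add[OF submodule_tch]
      submodule_zero[OF submodule_trl] submodule_add[OF submodule_trl])

lemma submodule_tboundaries: "submodule (tboundaries X m)"
  unfolding submodule_def
proof (intro conjI ballI)
  show "0 \<in> tboundaries X m"
    unfolding tboundaries_iff using submodule_zero[OF submodule_tch] submodule_zero[OF submodule_trl]
    by (intro bexI[of _ 0]) (auto simp: tbd_zero)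
  fix x y assume "x \<in> tboundaries X m" "y \<in> tboundaries X m"
  then obtain u v where u: "u \<in> tch X (m + 1)" "tbd X (m + 1) u + x \<in> trl X m"
    and v: "v \<in> tch X (m + 1)" "tbd X (m + 1) v + y \<in> trl X m" unfolding tboundaries_iff by blast
  have "tbd X (m + 1) (u + v) + (x + y) = (tbd X (m + 1) u + x) + (tbd X (m + 1) v + y)"
    by (simp add: tbd_add ac_simps)
  also have "\<dots> \<in> trl X m" by (rule submodule_add[OF submodule_trl u(2) v(2)])
  finally show "x + y \<in> tboundaries X m"
    unfolding tboundaries_iff by (rule bexI[of _ "u + v"]) (rule submodule_add[OF submodule_tch u(1) v(1)])
qed

lemma trl_subset_tboundaries: "trl X m \<subseteq> tboundaries X m"
  unfolding tboundaries_iff subset_iff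
  using submodule_zero[OF submodule_tch] by (intro allI impI bexI[of _ 0]) (auto simp: tbd_zero)

lemma tfilt_mono: "s \<le> s' \<Longrightarrow> tfilt X s' m \<subseteq> tfilt X s m"
  by (auto simp: filt_iff)

lemma E_inf_simps:
  "carr (E_inf (S_co X) s (m + s)) = tfilt X s m \<inter> tcycles X m"
  "rel (E_inf (S_co X) s (m + s)) =
    {x + b | x b. x \<in> tfilt X (s + 1) m \<inter> tcycles X m \<and> b \<in> tboundaries X m \<inter> tfilt X s m}"
  by (simp_all add: E_inf_def Let_def)

context
  fixes X :: "'a cospace"
  assumes X: "cosimplicial_space X"
begin

lemma tboundaries_subset_tcycles: "tboundaries X m \<subseteq> tcycles X m"
proof
  fix y assume "y \<in> tboundaries X m"
  then obtain u where u: "u \<in> tch X (m + 1)" and r: "tbd X (m + 1) u + y \<in> trl X m" unfolding tboundaries_iff by blast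
  have "tbd X (m + 1) u \<in> tch X m" using tbd_tch[OF X u] by simp
  then have "y \<in> tch X m"
    using r submodule_cong[OF submodule_tch] trl_subset_tch[OF X] by blast
  moreover have "tbd X m (tbd X (m + 1) u) + tbd X m y \<in> trl X (m - 1)"
    using tbd_trl[OF X r] by (simp only: tbd_add)
  then have "tbd X m y \<in> trl X (m - 1)"
    using tbd_tbd[OF X u] submodule_cong[OF submodule_trl] by fastforce
  ultimately show "y \<in> tcycles X m" by (simp add: tcycles_iff)
qed

lemma kmodule_E_inf: "kmodule (E_inf (S_co X) s (m + s))"
proof (rule kmoduleI)
  show "submodule (carr (E_inf (S_co X) s (m + s)))"
    unfolding E_inf_simps using submodule_filt[of X s m] submodule_tcycles[of X m] by (auto simp: submodule_def)
  show "rel (E_inf (S_co X) s (m + s)) \<subseteq> carr (E_inf (S_co X) s (m + s))"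
    unfolding E_inf_simps using tfilt_mono[of s "s + 1" X m] tboundaries_subset_tcycles[of m]
    by (auto intro!: submodule_add[OF submodule_filt] submodule_add[OF submodule_tcycles])
  show "submodule (rel (E_inf (S_co X) s (m + s)))"
    unfolding submodule_def
  proof (intro conjI ballI)
    have "0 + 0 \<in> rel (E_inf (S_co X) s (m + s))"
      unfolding E_inf_simps
      using submodule_zero[OF submodule_filt] submodule_zero[OF submodule_tcycles] submodule_zero[OF submodule_tboundaries]
      by blast
    then show "0 \<in> rel (E_inf (S_co X) s (m + s))" by simp
    fix x y assume "x \<in> rel (E_inf (S_co X) s (m + s))" "y \<in> rel (E_inf (S_co X) s (m + s))"
    then obtain x1 x2 y1 y2 where xy: "x = x1 + x2" "y = y1 + y2"
      and 1: "x1 \<in> tfilt X (s + 1) m \<inter> tcycles X m" "y1 \<in> tfilt X (s + 1) m \<inter> tcycles X m"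
      and 2: "x2 \<in> tboundaries X m \<inter> tfilt X s m" "y2 \<in> tboundaries X m \<inter> tfilt X s m"
      unfolding E_inf_simps by blast
    have "x1 + y1 \<in> tfilt X (s + 1) m \<inter> tcycles X m" "x2 + y2 \<in> tboundaries X m \<inter> tfilt X s m"
      using 1 2 submodule_add[OF submodule_filt] submodule_add[OF submodule_tcycles] submodule_add[OF submodule_tboundaries]
      by blast+
    moreover have "x + y = (x1 + y1) + (x2 + y2)" by (simp add: xy ac_simps)
    ultimately show "x + y \<in> rel (E_inf (S_co X) s (m + s))" unfolding E_inf_simps by blast
  qed
qed

lemma E_inf_relI:
  assumes "x \<in> tfilt X (s + 1) m" "x \<in> tcycles X m" "y \<in> tfilt X s m" "x + y \<in> tboundaries X m"
  shows "y \<in> rel (E_inf (S_co X) s (m + s))"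
proof -
  have "x + y \<in> tfilt X s m"
    using assms(1,3) tfilt_mono[of s "s + 1" X m] by (intro submodule_add[OF submodule_filt]) auto
  moreover have "y = x + (x + y)" by simp
  ultimately show ?thesis unfolding E_inf_simps using assms by blast
qed

lemma E_inf_rel_boundary:
  assumes "y \<in> tfilt X s m" "y \<in> tboundaries X m"
  shows "y \<in> rel (E_inf (S_co X) s (m + s))"
  by (rule E_inf_relI[OF submodule_zero[OF submodule_filt] submodule_zero[OF submodule_tcycles] assms(1)])
     (simp add: assms(2))

lemma to_TC_tcycles:
  assumes "a \<in> tot_cycles X m"
  shows "to_TC m a \<in> tcycles X m"
proof -
  have a: "a \<in> chn (Tot X) m" "bd (Tot X) (nat m) a \<in> dgn (Tot X) (m - 1)" using assms by (simp_all add: tot_cycles_iff)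
  have "tbd X m (to_TC m a) \<in> trl X (m - 1)"
    using to_TC_tbd[OF X a(1)] to_TC_trl[OF X a(2)] submodule_cong[OF submodule_trl] by blast
  then show ?thesis using to_TC_tch[OF X a(1)] by (simp add: tcycles_iff)
qed

text \<open>
  A class lies in the filtration iff it is represented by a cycle in the filtration of the total
  complex: such a cycle is what remains after subtracting a boundary.
\<close>

lemma F_HTot_iff:
  "a \<in> carr (F_HTot X s m) \<longleftrightarrow>
    a \<in> tot_cycles X m \<and> (\<exists>w\<in>tfilt X s m \<inter> tcycles X m. w + to_TC m a \<in> tboundaries X m)"
proof -
  have "to_TC m a \<in> rel (homology (total_trunc (s - 1) (conorm (S_co X))) m) \<longleftrightarrow>
      (\<exists>w\<in>tfilt X s m \<inter> tcycles X m. w + to_TC m a \<in> tboundaries X m)" (is "?l \<longleftrightarrow> ?r") if a: "a \<in> tot_cycles X m"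
  proof
    assume ?l
    then obtain u r where u: "u \<in> tch X (m + 1)" and r: "r \<in> tfilt X s m" and eq: "to_TC m a = tbd X (m + 1) u + r"
      by (auto simp: homology_def total_trunc_def)
    have "r + to_TC m a = tbd X (m + 1) u" by (simp add: eq ac_simps)
    moreover have "tbd X (m + 1) u \<in> tboundaries X m"
      unfolding tboundaries_iff using u submodule_zero[OF submodule_trl] by (intro bexI[of _ u]) auto
    ultimately have b: "r + to_TC m a \<in> tboundaries X m" by simp
    then have "r \<in> tcycles X m"
      using to_TC_tcycles[OF a] tboundaries_subset_tcycles submodule_cong[OF submodule_tcycles] by blast
    then show ?r using r b by blast
  next
    assume ?r
    then obtain w u where w: "w \<in> tfilt X s m" and u: "u \<in> tch X (m + 1)" and r: "tbd X (m + 1) u + (w + to_TC m a) \<in> trl X m"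
      unfolding tboundaries_iff by blast
    have "(tbd X (m + 1) u + (w + to_TC m a)) + w \<in> tfilt X s m"
      by (rule submodule_add[OF submodule_filt subsetD[OF trl_subset_filt[OF X] r] w])
    moreover have "to_TC m a = tbd X (m + 1) u + ((tbd X (m + 1) u + (w + to_TC m a)) + w)" by (simp add: ac_simps)
    ultimately have "to_TC m a \<in> {tbd X (m + 1) u + r | u r. u \<in> tch X (m + 1) \<and> r \<in> tfilt X s m}"
      using u by blast
    then show ?l by (simp add: homology_def total_trunc_def)
  qed
  then show ?thesis by (auto simp: F_HTot_def)
qed

lemma submodule_F_HTot: "submodule (carr (F_HTot X s m))"
  unfolding submodule_def
proof (intro conjI ballI)
  show "0 \<in> carr (F_HTot X s m)"
    unfolding F_HTot_iff
    using submodule_zero[OF submodule_filt] submodule_zero[OF submodule_tcycles] submodule_zero[OF submodule_tboundaries]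
      submodule_zero[OF submodule_tot_cycles] by (auto simp: to_TC_zero intro!: bexI[of _ 0])
  fix a b assume "a \<in> carr (F_HTot X s m)" "b \<in> carr (F_HTot X s m)"
  then obtain w v where a: "a \<in> tot_cycles X m" "w \<in> tfilt X s m \<inter> tcycles X m" "w + to_TC m a \<in> tboundaries X m"
    and b: "b \<in> tot_cycles X m" "v \<in> tfilt X s m \<inter> tcycles X m" "v + to_TC m b \<in> tboundaries X m"
    unfolding F_HTot_iff by blast
  have "(w + v) + to_TC m (a + b) = (w + to_TC m a) + (v + to_TC m b)" by (simp add: to_TC_add ac_simps)
  also have "\<dots> \<in> tboundaries X m" by (rule submodule_add[OF submodule_tboundaries a(3) b(3)])
  finally show "a + b \<in> carr (F_HTot X s m)"
    unfolding F_HTot_iff using a b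
    by (intro conjI bexI[of _ "w + v"] IntI submodule_add[OF submodule_filt] submodule_add[OF submodule_tcycles]
         submodule_add[OF submodule_tot_cycles]) simp_all
qed

lemma F_HTot_mono: "carr (F_HTot X (s + 1) m) \<subseteq> carr (F_HTot X s m)"
  using tfilt_mono[of s "s + 1" X m] unfolding F_HTot_iff subset_iff by auto

lemma kmodule_gr_HTot: "kmodule (gr_HTot X s m)"
  by (rule kmoduleI) (simp_all add: gr_HTot_simps submodule_F_HTot F_HTot_mono)

lemma abut_spec:
  assumes "a \<in> carr (F_HTot X s m)"
  shows "abut X s m a \<in> tfilt X s m" "abut X s m a \<in> tcycles X m" "abut X s m a + to_TC m a \<in> tboundaries X m"
proof -
  have "\<exists>w. w \<in> tfilt X s m \<inter> tcycles X m \<and> w + to_TC m a \<in> tboundaries X m"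
    using assms unfolding F_HTot_iff by blast
  moreover have "abut X s m a = (SOME w. w \<in> tfilt X s m \<inter> tcycles X m \<and> w + to_TC m a \<in> tboundaries X m)"
    by (simp add: abut_def eq_in_def)
  ultimately have "abut X s m a \<in> tfilt X s m \<inter> tcycles X m \<and> abut X s m a + to_TC m a \<in> tboundaries X m"
    by (metis (mono_tags, lifting) someI_ex)
  then show "abut X s m a \<in> tfilt X s m" "abut X s m a \<in> tcycles X m" "abut X s m a + to_TC m a \<in> tboundaries X m"
    by auto
qed

text \<open>
  The value of \<open>abut\<close> is chosen, but any two choices are homologous within the filtration, which makes them
  equal in the spectral sequence.
\<close>

lemma kmod_hom_abut: "kmod_hom (gr_HTot X s m) (E_inf (S_co X) s (m + s)) (abut X s m)"
proof (rule kmod_homI)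
  show "abut X s m a \<in> carr (E_inf (S_co X) s (m + s))" if "a \<in> carr (gr_HTot X s m)" for a
    using that abut_spec[of a s m] by (simp add: E_inf_simps gr_HTot_simps)
  show "abut X s m a \<in> rel (E_inf (S_co X) s (m + s))" if "a \<in> rel (gr_HTot X s m)" for a
  proof -
    have a: "a \<in> carr (F_HTot X (s + 1) m)" using that by (simp add: gr_HTot_simps)
    then have a': "a \<in> carr (F_HTot X s m)" using F_HTot_mono by blast
    obtain w where w: "w \<in> tfilt X (s + 1) m" "w \<in> tcycles X m" "w + to_TC m a \<in> tboundaries X m"
      using a unfolding F_HTot_iff by blast
    have "w + abut X s m a \<in> tboundaries X m"
      by (rule submodule_trans[OF submodule_tboundaries w(3)]) (use abut_spec(3)[OF a'] in \<open>simp add: add.commute\<close>)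
    then show ?thesis by (rule E_inf_relI[OF w(1,2) abut_spec(1)[OF a']])
  qed
  fix a b assume "a \<in> carr (gr_HTot X s m)" "b \<in> carr (gr_HTot X s m)"
  then have a: "a \<in> carr (F_HTot X s m)" and b: "b \<in> carr (F_HTot X s m)" by (simp_all add: gr_HTot_simps)
  note ab = submodule_add[OF submodule_F_HTot a b]
  have "abut X s m (a + b) + (abut X s m a + abut X s m b) =
      (abut X s m (a + b) + to_TC m (a + b)) + ((abut X s m a + to_TC m a) + (abut X s m b + to_TC m b))"
    by (simp add: to_TC_add ac_simps)
  also have "\<dots> \<in> tboundaries X m"
    by (intro submodule_add[OF submodule_tboundaries] abut_spec a b ab)
  finally show "abut X s m (a + b) + (abut X s m a + abut X s m b) \<in> rel (E_inf (S_co X) s (m + s))"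
    by (intro E_inf_rel_boundary submodule_add[OF submodule_filt] abut_spec a b ab)
qed

end

subsection \<open>Compatibility with products\<close>

context
  fixes X :: "'a cospace" and X' :: "'b cospace"
  assumes X: "cosimplicial_space X" and X': "cosimplicial_space X'"
begin

lemma TC_mult_tcycles:
  assumes y: "y \<in> tcycles X m" and z: "z \<in> tcycles X' m'"
  shows "TC_mult X X' m m' y z \<in> tcycles (cprod X X') (m + m')"
proof -
  have deg: "m - 1 + m' = m + m' - 1" "m + (m' - 1) = m + m' - 1" by simp_all
  have y': "y \<in> tch X m" "tbd X m y \<in> trl X (m - 1)" and z': "z \<in> tch X' m'" "tbd X' m' z \<in> trl X' (m' - 1)"
    using y z by (simp_all add: tcycles_iff)
  have "TC_mult X X' (m - 1) m' (tbd X m y) z + TC_mult X X' m (m' - 1) y (tbd X' m' z) \<in> trl (cprod X X') (m + m' - 1)"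
    using TC_mult_trl_left[OF X X' y'(2) z'(1)] TC_mult_trl_right[OF X X' y'(1) z'(2)]
    unfolding deg by (rule submodule_add[OF submodule_trl])
  then have "tbd (cprod X X') (m + m') (TC_mult X X' m m' y z) \<in> trl (cprod X X') (m + m' - 1)"
    using TC_mult_Leibniz[OF X X' y'(1) z'(1)] submodule_cong[OF submodule_trl] by blast
  then show ?thesis using TC_mult_tch[OF X X' y'(1) z'(1)] by (simp add: tcycles_iff)
qed

lemma TC_mult_tboundaries_left:
  assumes y: "y \<in> tboundaries X m" and z: "z \<in> tcycles X' m'"
  shows "TC_mult X X' m m' y z \<in> tboundaries (cprod X X') (m + m')"
proof -
  let ?XX = "cprod X X'"
  have deg: "m + m' + 1 = m + 1 + m'" "m + 1 - 1 = m" "m + 1 + m' - 1 = m + m'" "m + 1 + (m' - 1) = m + m'" by simp_all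
  obtain u where u: "u \<in> tch X (m + 1)" and r: "tbd X (m + 1) u + y \<in> trl X m" using y unfolding tboundaries_iff by blast
  have z': "z \<in> tch X' m'" "tbd X' m' z \<in> trl X' (m' - 1)" using z by (simp_all add: tcycles_iff)
  have du: "tbd X (m + 1) u \<in> tch X m" using tbd_tch[OF X u] by simp
  have y': "y \<in> tch X m" using y tboundaries_subset_tcycles[OF X] tcycles_tch by blast
  let ?d = "tbd ?XX (m + 1 + m') (TC_mult X X' (m + 1) m' u z)"
  let ?e = "TC_mult X X' m m' (tbd X (m + 1) u) z"
  let ?f = "TC_mult X X' (m + 1) (m' - 1) u (tbd X' m' z)"
  let ?g = "TC_mult X X' m m' (tbd X (m + 1) u + y) z"
  have d: "?d + (?e + ?f) \<in> trl ?XX (m + m')"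
    using TC_mult_Leibniz[OF X X' u z'(1)] unfolding deg .
  have f: "?f \<in> trl ?XX (m + m')"
    using TC_mult_trl_right[OF X X' u z'(2)] unfolding deg .
  have g: "?g \<in> trl ?XX (m + m')" by (rule TC_mult_trl_left[OF X X' r z'(1)])
  have g': "?g + (?e + TC_mult X X' m m' y z) \<in> trl ?XX (m + m')"
    by (rule TC_mult_add_left[OF X X' du y' z'(1)])
  note add = submodule_add[OF submodule_trl]
  from add[OF add[OF d f] add[OF g g']]
  have "?d + TC_mult X X' m m' y z \<in> trl ?XX (m + m')" by (simp add: ac_simps)
  then show ?thesis
    unfolding tboundaries_iff deg using TC_mult_tch[OF X X' u z'(1)] by blast
qed

lemma TC_mult_tboundaries_right:
  assumes y: "y \<in> tcycles X m" and z: "z \<in> tboundaries X' m'"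
  shows "TC_mult X X' m m' y z \<in> tboundaries (cprod X X') (m + m')"
proof -
  let ?XX = "cprod X X'"
  have deg: "m + m' + 1 = m + (m' + 1)" "m' + 1 - 1 = m'" "m + (m' + 1) - 1 = m + m'" "m - 1 + (m' + 1) = m + m'" by simp_all
  obtain u where u: "u \<in> tch X' (m' + 1)" and r: "tbd X' (m' + 1) u + z \<in> trl X' m'" using z unfolding tboundaries_iff by blast
  have y': "y \<in> tch X m" "tbd X m y \<in> trl X (m - 1)" using y by (simp_all add: tcycles_iff)
  have du: "tbd X' (m' + 1) u \<in> tch X' m'" using tbd_tch[OF X' u] by simp
  have z': "z \<in> tch X' m'" using z tboundaries_subset_tcycles[OF X'] tcycles_tch by blast
  let ?d = "tbd ?XX (m + (m' + 1)) (TC_mult X X' m (m' + 1) y u)"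
  let ?e = "TC_mult X X' m m' y (tbd X' (m' + 1) u)"
  let ?f = "TC_mult X X' (m - 1) (m' + 1) (tbd X m y) u"
  let ?g = "TC_mult X X' m m' y (tbd X' (m' + 1) u + z)"
  have d: "?d + (?f + ?e) \<in> trl ?XX (m + m')"
    using TC_mult_Leibniz[OF X X' y'(1) u] unfolding deg .
  have f: "?f \<in> trl ?XX (m + m')"
    using TC_mult_trl_left[OF X X' y'(2) u] unfolding deg .
  have g: "?g \<in> trl ?XX (m + m')" by (rule TC_mult_trl_right[OF X X' y'(1) r])
  have g': "?g + (?e + TC_mult X X' m m' y z) \<in> trl ?XX (m + m')"
    by (rule TC_mult_add_right[OF X X' y'(1) du z'])
  note add = submodule_add[OF submodule_trl]
  from add[OF add[OF d f] add[OF g g']]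
  have "?d + TC_mult X X' m m' y z \<in> trl ?XX (m + m')" by (simp add: ac_simps)
  then show ?thesis
    unfolding tboundaries_iff deg using TC_mult_tch[OF X X' y'(1) u] by blast
qed

lemma TC_mult_homologous:
  assumes y: "y \<in> tcycles X m" "y' \<in> tcycles X m" "y + y' \<in> tboundaries X m"
    and z: "z \<in> tcycles X' m'" "z' \<in> tcycles X' m'" "z + z' \<in> tboundaries X' m'"
  shows "TC_mult X X' m m' y z + TC_mult X X' m m' y' z' \<in> tboundaries (cprod X X') (m + m')"
proof -
  let ?B = "tboundaries (cprod X X') (m + m')"
  have ch: "y \<in> tch X m" "y' \<in> tch X m" "z \<in> tch X' m'" "z' \<in> tch X' m'" using y z by (simp_all add: tcycles_iff)
  have "TC_mult X X' m m' (y + y') z + (TC_mult X X' m m' y z + TC_mult X X' m m' y' z) \<in> ?B"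
    using TC_mult_add_left[OF X X' ch(1-3)] trl_subset_tboundaries by blast
  then have 1: "TC_mult X X' m m' y z + TC_mult X X' m m' y' z \<in> ?B"
    using TC_mult_tboundaries_left[OF y(3) z(1)] submodule_cong[OF submodule_tboundaries] by blast
  have "TC_mult X X' m m' y' (z + z') + (TC_mult X X' m m' y' z + TC_mult X X' m m' y' z') \<in> ?B"
    using TC_mult_add_right[OF X X' ch(2-4)] trl_subset_tboundaries by blast
  then have "TC_mult X X' m m' y' z + TC_mult X X' m m' y' z' \<in> ?B"
    using TC_mult_tboundaries_right[OF y(2) z(3)] submodule_cong[OF submodule_tboundaries] by blast
  with 1 show ?thesis by (rule submodule_trans[OF submodule_tboundaries])
qed

lemma HTot_mult_tot_cycles:
  assumes a: "a \<in> tot_cycles X m" and b: "b \<in> tot_cycles X' m'"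
  shows "HTot_mult X X' m m' a b \<in> tot_cycles (cprod X X') (m + m')"
proof -
  note T = simplicial_set_Tot[of undefined X] and T' = simplicial_set_Tot[of undefined X']
  have a': "a \<in> chn (Tot X) m" "bd (Tot X) (nat m) a \<in> dgn (Tot X) (m - 1)"
    and b': "b \<in> chn (Tot X') m'" "bd (Tot X') (nat m') b \<in> dgn (Tot X') (m' - 1)"
    using a b by (simp_all add: tot_cycles_iff)
  let ?x = "shuffle (Tot X) (Tot X') (nat m) (nat m') a b"
  have deg: "m - 1 + m' = m + m' - 1" "m + (m' - 1) = m + m' - 1" by simp_all
  have x: "?x \<in> chn (sprod (Tot X) (Tot X')) (m + m')" by (rule shuffle_chn[OF T T' a'(1) b'(1)])
  have "bd (sprod (Tot X) (Tot X')) (nat (m + m')) ?x \<in> dgn (sprod (Tot X) (Tot X')) (m + m' - 1)"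
    unfolding shuffle_Leibniz_int[OF T T' a'(1) b'(1)]
    using shuffle_dgn_left[OF T T' a'(2) b'(1)] shuffle_dgn_right[OF T T' a'(1) b'(2)]
    unfolding deg by (rule submodule_add[OF submodule_dgn])
  from kmap_dgn[OF simplicial_set_sprod[OF T T'] simplicial_set_Tot simplicial_map_Tot_prod_iso this]
  have "bd (Tot (cprod X X')) (nat (m + m')) (HTot_mult X X' m m' a b) \<in> dgn (Tot (cprod X X')) (m + m' - 1)"
    by (simp only: HTot_mult_def bd_natural_int[OF simplicial_map_Tot_prod_iso x])
  moreover have "HTot_mult X X' m m' a b \<in> chn (Tot (cprod X X')) (m + m')"
    unfolding HTot_mult_def by (rule kmap_chn[OF simplicial_map_Tot_prod_iso x])
  ultimately show ?thesis by (simp add: tot_cycles_iff)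
qed

text \<open>
  The chosen cycles are homologous to the images of \<open>a\<close> and \<open>b\<close>. Since the product of the total
  complexes is defined on homology, their product is homologous to the product of these images, and
  hence to the image of the product of \<open>a\<close> and \<open>b\<close>.
\<close>

lemma TC_mult_abut:
  assumes a: "a \<in> carr (F_HTot X s m)" and b: "b \<in> carr (F_HTot X' s' m')"
  shows "TC_mult X X' m m' (abut X s m a) (abut X' s' m' b) \<in> tfilt (cprod X X') (s + s') (m + m') \<inter> tcycles (cprod X X') (m + m')"
    and "TC_mult X X' m m' (abut X s m a) (abut X' s' m' b) + to_TC (m + m') (HTot_mult X X' m m' a b) \<in> tboundaries (cprod X X') (m + m')"
proof -
  have a': "a \<in> tot_cycles X m" and b': "b \<in> tot_cycles X' m'"
    using a b by (simp_all add: F_HTot_iff[OF X] F_HTot_iff[OF X'])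
  note sa = abut_spec[OF X a] and sb = abut_spec[OF X' b]
  show "TC_mult X X' m m' (abut X s m a) (abut X' s' m' b) \<in> tfilt (cprod X X') (s + s') (m + m') \<inter> tcycles (cprod X X') (m + m')"
    by (intro IntI TC_mult_filt X X' TC_mult_tcycles sa sb)
  have "TC_mult X X' m m' (abut X s m a) (abut X' s' m' b) + TC_mult X X' m m' (to_TC m a) (to_TC m' b) \<in> tboundaries (cprod X X') (m + m')"
    by (intro TC_mult_homologous sa sb to_TC_tcycles X X' a' b')
  moreover obtain u where "u \<in> tch (cprod X X') (m + m' + 1)"
    "tbd (cprod X X') (m + m' + 1) u +
      (to_TC (m + m') (HTot_mult X X' m m' a b) + TC_mult X X' m m' (to_TC m a) (to_TC m' b)) \<in> trl (cprod X X') (m + m')"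
    using HTot_mult_homologous_TC_mult[OF X X'] a' b' unfolding tot_cycles_iff by metis
  then have "TC_mult X X' m m' (to_TC m a) (to_TC m' b) + to_TC (m + m') (HTot_mult X X' m m' a b) \<in> tboundaries (cprod X X') (m + m')"
    unfolding tboundaries_iff by (auto simp: add.commute)
  ultimately show "TC_mult X X' m m' (abut X s m a) (abut X' s' m' b) + to_TC (m + m') (HTot_mult X X' m m' a b) \<in> tboundaries (cprod X X') (m + m')"
    by (rule submodule_trans[OF submodule_tboundaries])
qed

lemma HTot_mult_F_HTot:
  assumes a: "a \<in> carr (F_HTot X s m)" and b: "b \<in> carr (F_HTot X' s' m')"
  shows "HTot_mult X X' m m' a b \<in> carr (F_HTot (cprod X X') (s + s') (m + m'))"
  unfolding F_HTot_iff[OF cosimplicial_space_cprod[OF X X']]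
  using TC_mult_abut[OF a b] HTot_mult_tot_cycles a b unfolding F_HTot_iff[OF X] F_HTot_iff[OF X'] by blast

lemma kmod_hom_HTot_mult:
  "kmod_hom (tensor (gr_HTot X s m) (gr_HTot X' s' m')) (gr_HTot (cprod X X') (s + s') (m + m'))
     (tensor_lift (HTot_mult X X' m m'))"
proof (rule kmod_hom_tensor_lift)
  note XX = cosimplicial_space_cprod[OF X X']
  show "kmodule (gr_HTot (cprod X X') (s + s') (m + m'))" by (rule kmodule_gr_HTot[OF XX])
  have 0: "0 \<in> rel (gr_HTot (cprod X X') (s + s') (m + m'))"
    using submodule_zero[OF submodule_F_HTot[OF XX]] by (simp add: gr_HTot_simps)
  show "HTot_mult X X' m m' (a + a') b + (HTot_mult X X' m m' a b + HTot_mult X X' m m' a' b) \<in> rel (gr_HTot (cprod X X') (s + s') (m + m'))"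
    for a a' b using 0 by (simp add: HTot_mult_def)
  show "HTot_mult X X' m m' a (b + b') + (HTot_mult X X' m m' a b + HTot_mult X X' m m' a b') \<in> rel (gr_HTot (cprod X X') (s + s') (m + m'))"
    for a b b' using 0 by (simp add: HTot_mult_def)
  have deg: "s + s' + 1 = s + 1 + s'" "s + s' + 1 = s + (s' + 1)" by simp_all
  show "HTot_mult X X' m m' a b \<in> carr (gr_HTot (cprod X X') (s + s') (m + m'))"
    if "a \<in> carr (gr_HTot X s m)" "b \<in> carr (gr_HTot X' s' m')" for a b
    using that HTot_mult_F_HTot by (simp add: gr_HTot_simps)
  show "HTot_mult X X' m m' a b \<in> rel (gr_HTot (cprod X X') (s + s') (m + m'))"
    if "a \<in> rel (gr_HTot X s m)" "b \<in> carr (gr_HTot X' s' m')" for a b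
    using that HTot_mult_F_HTot unfolding gr_HTot_simps deg(1) by blast
  show "HTot_mult X X' m m' a b \<in> rel (gr_HTot (cprod X X') (s + s') (m + m'))"
    if "a \<in> carr (gr_HTot X s m)" "b \<in> rel (gr_HTot X' s' m')" for a b
    using that HTot_mult_F_HTot unfolding gr_HTot_simps deg(2) by blast
qed

lemma kmod_hom_TC_mult:
  "kmod_hom (tensor (E_inf (S_co X) s (m + s)) (E_inf (S_co X') s' (m' + s')))
     (E_inf (S_co (cprod X X')) (s + s') (m + m' + (s + s'))) (tensor_lift (TC_mult X X' m m'))"
proof (rule kmod_hom_tensor_lift)
  note XX = cosimplicial_space_cprod[OF X X']
  let ?E = "E_inf (S_co (cprod X X')) (s + s') (m + m' + (s + s'))"
  let ?\<mu> = "TC_mult X X' m m'"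
  show "kmodule ?E" by (rule kmodule_E_inf[OF XX])
  have carr: "?\<mu> y z \<in> carr ?E" if "y \<in> carr (E_inf (S_co X) s (m + s))" "z \<in> carr (E_inf (S_co X') s' (m' + s'))" for y z
    using that unfolding E_inf_simps by (blast intro: TC_mult_filt[OF X X'] TC_mult_tcycles)
  then show "?\<mu> y z \<in> carr ?E" if "y \<in> carr (E_inf (S_co X) s (m + s))" "z \<in> carr (E_inf (S_co X') s' (m' + s'))" for y z
    using that by blast
  have trl: "w \<in> rel ?E" if "w \<in> trl (cprod X X') (m + m')" for w
    by (rule E_inf_rel_boundary[OF XX]) (use that trl_subset_filt[OF XX] trl_subset_tboundaries in blast)+
  have tch: "y \<in> tch X m" if "y \<in> carr (E_inf (S_co X) s (m + s))" for y
    using that tcycles_tch unfolding E_inf_simps by blast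
  have tch': "z \<in> tch X' m'" if "z \<in> carr (E_inf (S_co X') s' (m' + s'))" for z
    using that tcycles_tch unfolding E_inf_simps by blast
  show "?\<mu> (y + y') z + (?\<mu> y z + ?\<mu> y' z) \<in> rel ?E"
    if "y \<in> carr (E_inf (S_co X) s (m + s))" "y' \<in> carr (E_inf (S_co X) s (m + s))" "z \<in> carr (E_inf (S_co X') s' (m' + s'))" for y y' z
    by (intro trl TC_mult_add_left X X' tch tch' that)
  show "?\<mu> y (z + z') + (?\<mu> y z + ?\<mu> y z') \<in> rel ?E"
    if "y \<in> carr (E_inf (S_co X) s (m + s))" "z \<in> carr (E_inf (S_co X') s' (m' + s'))" "z' \<in> carr (E_inf (S_co X') s' (m' + s'))" for y z z'
    by (intro trl TC_mult_add_right X X' tch tch' that)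
  have deg: "s + s' + 1 = s + 1 + s'" "s + s' + 1 = s + (s' + 1)" by simp_all
  show "?\<mu> y z \<in> rel ?E" if y: "y \<in> rel (E_inf (S_co X) s (m + s))" and z: "z \<in> carr (E_inf (S_co X') s' (m' + s'))" for y z
  proof -
    obtain x b where yxb: "y = x + b" and x: "x \<in> tfilt X (s + 1) m" "x \<in> tcycles X m" and b: "b \<in> tboundaries X m" "b \<in> tfilt X s m"
      using y unfolding E_inf_simps by blast
    have z': "z \<in> tfilt X' s' m'" "z \<in> tcycles X' m'" using z unfolding E_inf_simps by blast+
    have y': "y \<in> carr (E_inf (S_co X) s (m + s))" using y kmoduleD(3)[OF kmodule_E_inf[OF X]] by blast
    have bc: "b \<in> tcycles X m" using b(1) tboundaries_subset_tcycles[OF X] by blast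
    show ?thesis
    proof (rule E_inf_relI[OF XX])
      show "?\<mu> x z \<in> tfilt (cprod X X') (s + s' + 1) (m + m')"
        unfolding deg(1) by (rule TC_mult_filt[OF X X' x(1) z'(1)])
      show "?\<mu> x z \<in> tcycles (cprod X X') (m + m')" by (rule TC_mult_tcycles[OF x(2) z'(2)])
      show "?\<mu> y z \<in> tfilt (cprod X X') (s + s') (m + m')" using carr[OF y' z] unfolding E_inf_simps by blast
      have "x + y = b" by (simp add: yxb)
      then show "?\<mu> x z + ?\<mu> y z \<in> tboundaries (cprod X X') (m + m')"
        using b(1) submodule_zero[OF submodule_tboundaries] y' unfolding E_inf_simps
        by (intro TC_mult_homologous x z') auto
    qed
  qed
  show "?\<mu> y z \<in> rel ?E" if y: "y \<in> carr (E_inf (S_co X) s (m + s))" and z: "z \<in> rel (E_inf (S_co X') s' (m' + s'))" for y z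
  proof -
    obtain x b where zxb: "z = x + b" and x: "x \<in> tfilt X' (s' + 1) m'" "x \<in> tcycles X' m'" and b: "b \<in> tboundaries X' m'" "b \<in> tfilt X' s' m'"
      using z unfolding E_inf_simps by blast
    have y': "y \<in> tfilt X s m" "y \<in> tcycles X m" using y unfolding E_inf_simps by blast+
    have z': "z \<in> carr (E_inf (S_co X') s' (m' + s'))" using z kmoduleD(3)[OF kmodule_E_inf[OF X']] by blast
    show ?thesis
    proof (rule E_inf_relI[OF XX])
      show "?\<mu> y x \<in> tfilt (cprod X X') (s + s' + 1) (m + m')"
        unfolding deg(2) by (rule TC_mult_filt[OF X X' y'(1) x(1)])
      show "?\<mu> y x \<in> tcycles (cprod X X') (m + m')" by (rule TC_mult_tcycles[OF y'(2) x(2)])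
      show "?\<mu> y z \<in> tfilt (cprod X X') (s + s') (m + m')" using carr[OF y z'] unfolding E_inf_simps by blast
      have "x + z = b" by (simp add: zxb)
      then show "?\<mu> y x + ?\<mu> y z \<in> tboundaries (cprod X X') (m + m')"
        using b(1) submodule_zero[OF submodule_tboundaries] z' unfolding E_inf_simps
        by (intro TC_mult_homologous x y') auto
    qed
  qed
qed

text \<open>
  Both ways around the square lead to cycles in filtration \<open>s + s'\<close> that are homologous in the total
  complex. The difference of two such cycles is a boundary that lies in this filtration, so it is zero
  in the spectral sequence.
\<close>

theorem abut_multiplicative:
  "commuting_square
     (tensor (gr_HTot X s m) (gr_HTot X' s' m'))
     (tensor (E_inf (S_co X) s (m + s)) (E_inf (S_co X') s' (m' + s')))
     (gr_HTot (cprod X X') (s + s') (m + m'))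
     (E_inf (S_co (cprod X X')) (s + s') (m + m' + (s + s')))
     (tensor_map (abut X s m) (abut X' s' m'))
     (tensor_lift (HTot_mult X X' m m'))
     (tensor_lift (TC_mult X X' m m'))
     (abut (cprod X X') (s + s') (m + m'))"
  unfolding commuting_square_def
proof (intro conjI ballI)
  note XX = cosimplicial_space_cprod[OF X X']
  let ?M = "tensor (gr_HTot X s m) (gr_HTot X' s' m')"
  let ?E = "E_inf (S_co (cprod X X')) (s + s') (m + m' + (s + s'))"
  let ?B = "tboundaries (cprod X X') (m + m')"
  show "kmodule ?M" by (intro kmodule_tensor kmodule_gr_HTot X X')
  show "kmodule (tensor (E_inf (S_co X) s (m + s)) (E_inf (S_co X') s' (m' + s')))"
    by (intro kmodule_tensor kmodule_E_inf X X')
  show "kmodule (gr_HTot (cprod X X') (s + s') (m + m'))" by (rule kmodule_gr_HTot[OF XX])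
  show "kmodule ?E" by (rule kmodule_E_inf[OF XX])
  show "kmod_hom ?M (tensor (E_inf (S_co X) s (m + s)) (E_inf (S_co X') s' (m' + s'))) (tensor_map (abut X s m) (abut X' s' m'))"
    by (intro kmod_hom_tensor_map kmod_hom_abut kmodule_E_inf X X')
  show lift: "kmod_hom ?M (gr_HTot (cprod X X') (s + s') (m + m')) (tensor_lift (HTot_mult X X' m m'))"
    by (rule kmod_hom_HTot_mult)
  show "kmod_hom (tensor (E_inf (S_co X) s (m + s)) (E_inf (S_co X') s' (m' + s'))) ?E (tensor_lift (TC_mult X X' m m'))"
    by (rule kmod_hom_TC_mult)
  show "kmod_hom (gr_HTot (cprod X X') (s + s') (m + m')) ?E (abut (cprod X X') (s + s') (m + m'))"
    by (rule kmod_hom_abut[OF XX])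
  fix w assume w: "w \<in> carr ?M"
  let ?l = "tensor_lift (HTot_mult X X' m m') w"
  let ?r = "tensor_lift (TC_mult X X' m m') (tensor_map (abut X s m) (abut X' s' m') w)"
  have l: "?l \<in> carr (F_HTot (cprod X X') (s + s') (m + m'))"
    using kmod_homD(1)[OF lift w] by (simp add: gr_HTot_simps)
  have w': "w \<in> free_on (carr (F_HTot X s m) \<times> carr (F_HTot X' s' m'))"
    using w by (simp add: carr_tensor gr_HTot_simps)
  have add: "tensor_lift \<mu> (tensor_map f g (a + b)) = tensor_lift \<mu> (tensor_map f g a) + tensor_lift \<mu> (tensor_map f g b)"
    for \<mu> :: "(int \<Rightarrow> 'a \<Rightarrow>\<^sub>0 bit) \<Rightarrow> (int \<Rightarrow> 'b \<Rightarrow>\<^sub>0 bit) \<Rightarrow> (int \<Rightarrow> 'a \<times> 'b \<Rightarrow>\<^sub>0 bit)"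
      and f :: "('a tot \<Rightarrow>\<^sub>0 bit) \<Rightarrow> _" and g :: "('b tot \<Rightarrow>\<^sub>0 bit) \<Rightarrow> _" and a b
    by (simp add: tensor_map_def tensor_lift_add)
  have r: "?r \<in> tfilt (cprod X X') (s + s') (m + m')"
    by (rule free_on_image[OF add submodule_filt _ w'])
       (use TC_mult_abut(1) in \<open>auto simp: tensor_map_def tensor_lift_gen\<close>)
  have "?r + to_TC (m + m') ?l \<in> ?B"
    by (rule free_on_image[OF _ submodule_tboundaries _ w', of "\<lambda>w. tensor_lift (TC_mult X X' m m') (tensor_map (abut X s m) (abut X' s' m') w) + to_TC (m + m') (tensor_lift (HTot_mult X X' m m') w)"])
       (use TC_mult_abut(2) in \<open>auto simp: add tensor_lift_add to_TC_add tensor_map_def tensor_lift_gen ac_simps\<close>)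
  moreover have "to_TC (m + m') ?l + abut (cprod X X') (s + s') (m + m') ?l \<in> ?B"
    using abut_spec(3)[OF XX l] by (simp add: add.commute)
  ultimately have "?r + abut (cprod X X') (s + s') (m + m') ?l \<in> ?B"
    by (rule submodule_trans[OF submodule_tboundaries])
  then have "?r + abut (cprod X X') (s + s') (m + m') ?l \<in> rel ?E"
    by (intro E_inf_rel_boundary XX submodule_add[OF submodule_filt] r abut_spec(1)[OF XX l])
  then show "eq_in ?E ?r (abut (cprod X X') (s + s') (m + m') ?l)" by (simp add: eq_in_def)
qed

end

subsection \<open>Naturality\<close>

context
  fixes X :: "'a cospace" and Y :: "'b cospace" and h :: "nat \<Rightarrow> nat \<Rightarrow> 'a \<Rightarrow> 'b"
  assumes X: "cosimplicial_space X" and Y: "cosimplicial_space Y" and h: "cosimplicial_map X Y h"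
begin

lemma simplicial_map_level: "simplicial_map (lev X p) (lev Y p) (h p)"
  using h by (simp add: cosimplicial_map_def)

lemma TC_map_pos: "j > 0 \<Longrightarrow> TC_map h m y j = 0"
  by (simp add: TC_map_def)

lemma TC_map_column: "TC_map h m y (- int p) = kmap (h p (nat (m + int p))) (y (- int p))"
  by (simp add: TC_map_def)

lemma TC_map_add: "TC_map h m (y + z) = TC_map h m y + TC_map h m z"
  by (simp add: TC_map_def fun_eq_iff)

lemma kmap_cm:
  assumes "\<theta> \<in> mono_maps k n" "a \<in> chn (lev X k) i"
  shows "kmap (h n (nat i)) (cm X n \<theta> i a) = cm Y n \<theta> i (kmap (h k (nat i)) a)"
  unfolding kmap_kmap
proof (rule kmap_cong[OF refl])
  fix x assume "x \<in> Poly_Mapping.keys a"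
  then have "x \<in> cells (lev X k) (nat i)" using free_on_keys[OF chn_free_on[OF assms(2)]] by blast
  then show "h n (nat i) (cop X n \<theta> (nat i) x) = cop Y n \<theta> (nat i) (h k (nat i) x)"
    using h assms(1) unfolding cosimplicial_map_def by blast
qed

lemma kmap_conorm_rel:
  assumes "a \<in> conorm_rel X p i"
  shows "kmap (h p (nat i)) a \<in> conorm_rel Y p i"
proof (rule conorm_rel_image[OF kmap_add submodule_conorm_rel _ _ assms])
  show "kmap (h p (nat i)) b \<in> conorm_rel Y p i" if "b \<in> dgn (lev X p) i" for b
    using kmap_dgn[OF cosimplicial_spaceD(1)[OF X] cosimplicial_spaceD(1)[OF Y] simplicial_map_level that] dgn_subset_conorm_rel by blast
  show "kmap (h p (nat i)) (coface X p k i b) \<in> conorm_rel Y p i" if *: "p = Suc p'" "1 \<le> k" "k \<le> p" "b \<in> chn (lev X p') i" for p' k b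
    using kmap_cm[OF cofc_in_mono_maps *(4)] coface_in_conorm_rel[OF kmap_chn[OF simplicial_map_level *(4)] *(2)] *(1,3) by simp
qed

lemma TC_map_tch: "y \<in> tch X m \<Longrightarrow> TC_map h m y \<in> tch Y m"
  unfolding tch_iff by (auto simp: TC_map_pos TC_map_column intro: kmap_chn[OF simplicial_map_level])

lemma TC_map_trl: "y \<in> trl X m \<Longrightarrow> TC_map h m y \<in> trl Y m"
  unfolding trl_iff by (auto simp: TC_map_pos TC_map_column intro: kmap_conorm_rel)

lemma TC_map_tfilt: "y \<in> tfilt X s m \<Longrightarrow> TC_map h m y \<in> tfilt Y s m"
  unfolding filt_iff by (auto simp: TC_map_column intro: kmap_conorm_rel TC_map_tch)

lemma TC_map_tbd:
  assumes y: "y \<in> tch X m"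
  shows "TC_map h (m - 1) (tbd X m y) = tbd Y m (TC_map h m y)"
proof -
  have "\<forall>j. TC_map h (m - 1) (tbd X m y) j = tbd Y m (TC_map h m y) j"
  proof (subst all_columns_iff, intro conjI allI impI)
    fix p
    have y': "y (- int q) \<in> chn (lev X q) (m + int q)" for q using y by (simp add: tch_iff)
    have deg: "m - 1 + int p = m + int p - 1" by simp
    have "kmap (h p (nat (m - 1 + int p))) (case p of 0 \<Rightarrow> 0 | Suc p' \<Rightarrow> coface X (Suc p') 0 (m + int p') (y (- int p'))) =
        (case p of 0 \<Rightarrow> 0 | Suc p' \<Rightarrow> coface Y (Suc p') 0 (m + int p') (kmap (h p' (nat (m + int p'))) (y (- int p'))))"
    proof (cases p)
      case (Suc p')
      then show ?thesis using kmap_cm[OF cofc_in_mono_maps y'] by simp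
    qed simp
    moreover have "kmap (h p (nat (m - 1 + int p))) (bd (lev X p) (nat (m + int p)) (y (- int p))) =
        bd (lev Y p) (nat (m + int p)) (kmap (h p (nat (m + int p))) (y (- int p)))"
      unfolding deg by (rule bd_natural_int[OF simplicial_map_level y'])
    ultimately show "TC_map h (m - 1) (tbd X m y) (- int p) = tbd Y m (TC_map h m y) (- int p)"
      by (simp only: TC_map_column tbd_column kmap_add)
  qed (simp add: TC_map_pos tbd_pos)
  then show ?thesis by blast
qed

lemma TC_map_tcycles: "y \<in> tcycles X m \<Longrightarrow> TC_map h m y \<in> tcycles Y m"
  unfolding tcycles_iff using TC_map_tch TC_map_trl TC_map_tbd by metis

lemma TC_map_tboundaries:
  assumes "y \<in> tboundaries X m"
  shows "TC_map h m y \<in> tboundaries Y m"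
proof -
  obtain u where u: "u \<in> tch X (m + 1)" "tbd X (m + 1) u + y \<in> trl X m" using assms unfolding tboundaries_iff by blast
  have "tbd Y (m + 1) (TC_map h (m + 1) u) + TC_map h m y \<in> trl Y m"
    using TC_map_trl[OF u(2)] TC_map_tbd[OF u(1)] by (simp add: TC_map_add)
  then show ?thesis unfolding tboundaries_iff using TC_map_tch[OF u(1)] by blast
qed

lemma to_TC_natural:
  assumes a: "a \<in> chn (Tot X) m"
  shows "to_TC m (kmap (Tot_map h (nat m)) a) = TC_map h m (to_TC m a)"
proof -
  have a': "kmap (Tot_map h (nat m)) a \<in> chn (Tot Y) m"
    by (rule kmap_chn[OF simplicial_map_Tot_map[OF h] a])
  have "phi Y m (kmap (Tot_map h (nat m)) a) p = kmap (h p (nat (m + int p))) (phi X m a p)" for p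
  proof -
    let ?N = "nat (int p + m)"
    let ?s = "shuffle (Simplex p) (Tot X) (nat (int p)) (nat m) (gen (id_map p)) a"
    have "phi Y m (kmap (Tot_map h (nat m)) a) p = kmap (eval p ?N) (kmap (map_prod (\<lambda>u. u) (Tot_map h ?N)) ?s)"
      unfolding phi_def pairing_def
      using shuffle_natural_int[OF simplicial_map_id simplicial_map_Tot_map[OF h] id_map_in_chn a] by simp
    also have "\<dots> = kmap (h p ?N) (kmap (eval p ?N) ?s)"
      unfolding kmap_kmap
    proof (rule kmap_cong[OF refl])
      fix w assume "w \<in> Poly_Mapping.keys ?s"
      then have "w \<in> cells (sprod (Simplex p) (Tot X)) ?N"
        using free_on_keys[OF chn_free_on[OF shuffle_chn[OF simplicial_set_Simplex simplicial_set_Tot id_map_in_chn a]]] by blast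
      then show "eval p ?N (map_prod (\<lambda>u. u) (Tot_map h ?N) w) = h p ?N (eval p ?N w)"
        by (auto simp: eval_def Tot_map_def on_dom_eq)
    qed
    finally show ?thesis by (simp add: phi_def pairing_def add.commute)
  qed
  then have "\<forall>j. to_TC m (kmap (Tot_map h (nat m)) a) j = TC_map h m (to_TC m a) j"
    by (subst all_columns_iff) (simp add: to_TC_pos TC_map_pos TC_map_column to_TC_column[OF a] to_TC_column[OF a'])
  then show ?thesis by blast
qed

lemma Tot_map_F_HTot:
  assumes "a \<in> carr (F_HTot X s m)"
  shows "kmap (Tot_map h (nat m)) a \<in> carr (F_HTot Y s m)"
proof -
  obtain w where a: "a \<in> chn (Tot X) m" "bd (Tot X) (nat m) a \<in> dgn (Tot X) (m - 1)"
    and w: "w \<in> tfilt X s m" "w \<in> tcycles X m" "w + to_TC m a \<in> tboundaries X m"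
    using assms unfolding F_HTot_iff[OF X] tot_cycles_iff by blast
  note H = simplicial_map_Tot_map[OF h]
  have "kmap (Tot_map h (nat m)) a \<in> tot_cycles Y m"
    using kmap_chn[OF H a(1)] kmap_dgn[OF simplicial_set_Tot simplicial_set_Tot H a(2)]
    by (simp add: tot_cycles_iff bd_natural_int[OF H a(1)])
  moreover have "TC_map h m w + to_TC m (kmap (Tot_map h (nat m)) a) \<in> tboundaries Y m"
    using TC_map_tboundaries[OF w(3)] by (simp add: TC_map_add to_TC_natural[OF a(1)])
  ultimately show ?thesis
    unfolding F_HTot_iff[OF Y] using TC_map_tfilt[OF w(1)] TC_map_tcycles[OF w(2)] by blast
qed

text \<open>
  Evaluation commutes strictly with maps of cosimplicial spaces. So here too the two ways around the
  square lead to homologous cycles in the same filtration.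
\<close>

theorem abut_natural:
  "commuting_square (gr_HTot X s m) (E_inf (S_co X) s (m + s)) (gr_HTot Y s m) (E_inf (S_co Y) s (m + s))
     (abut X s m) (kmap (Tot_map h (nat m))) (TC_map h m) (abut Y s m)"
  unfolding commuting_square_def
proof (intro conjI ballI kmodule_gr_HTot kmodule_E_inf kmod_hom_abut X Y)
  show "kmod_hom (gr_HTot X s m) (gr_HTot Y s m) (kmap (Tot_map h (nat m)))"
    by (rule kmod_homI) (simp_all add: gr_HTot_simps Tot_map_F_HTot submodule_zero[OF submodule_F_HTot[OF Y]])
  show "kmod_hom (E_inf (S_co X) s (m + s)) (E_inf (S_co Y) s (m + s)) (TC_map h m)"
  proof (rule kmod_homI)
    show "TC_map h m y \<in> carr (E_inf (S_co Y) s (m + s))" if "y \<in> carr (E_inf (S_co X) s (m + s))" for y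
      using that unfolding E_inf_simps by (blast intro: TC_map_tfilt TC_map_tcycles)
    show "TC_map h m y \<in> rel (E_inf (S_co Y) s (m + s))" if rel: "y \<in> rel (E_inf (S_co X) s (m + s))" for y
    proof -
      obtain x b where y: "y = x + b" and x: "x \<in> tfilt X (s + 1) m" "x \<in> tcycles X m"
        and b: "b \<in> tboundaries X m" "b \<in> tfilt X s m" using rel unfolding E_inf_simps by blast
      show ?thesis
        unfolding E_inf_simps y TC_map_add
        using TC_map_tfilt[OF x(1)] TC_map_tcycles[OF x(2)] TC_map_tboundaries[OF b(1)] TC_map_tfilt[OF b(2)] by blast
    qed
    show "TC_map h m (y + z) + (TC_map h m y + TC_map h m z) \<in> rel (E_inf (S_co Y) s (m + s))" for y z
      using submodule_zero[OF kmoduleD(2)[OF kmodule_E_inf[OF Y]]] by (simp add: TC_map_add)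
  qed
  fix a assume "a \<in> carr (gr_HTot X s m)"
  then have a: "a \<in> carr (F_HTot X s m)" by (simp add: gr_HTot_simps)
  then have a': "a \<in> chn (Tot X) m" by (simp add: F_HTot_iff[OF X] tot_cycles_iff)
  note s = abut_spec[OF X a] and s' = abut_spec[OF Y Tot_map_F_HTot[OF a]]
  have "TC_map h m (abut X s m a) + to_TC m (kmap (Tot_map h (nat m)) a) \<in> tboundaries Y m"
    using TC_map_tboundaries[OF s(3)] by (simp add: TC_map_add to_TC_natural[OF a'])
  then have "TC_map h m (abut X s m a) + abut Y s m (kmap (Tot_map h (nat m)) a) \<in> tboundaries Y m"
    by (rule submodule_trans[OF submodule_tboundaries]) (use s'(3) in \<open>simp add: add.commute\<close>)
  then have "TC_map h m (abut X s m a) + abut Y s m (kmap (Tot_map h (nat m)) a) \<in> rel (E_inf (S_co Y) s (m + s))"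
    by (intro E_inf_rel_boundary Y submodule_add[OF submodule_filt] TC_map_tfilt s(1) s'(1))
  then show "eq_in (E_inf (S_co Y) s (m + s)) (TC_map h m (abut X s m a)) (abut Y s m (kmap (Tot_map h (nat m)) a))"
    by (simp add: eq_in_def)
qed

end

section \<open>The quotient by the group of order two\<close>

abbreviation Epi_prod :: "'a cospace \<Rightarrow> (bool list \<times> 'a \<times> 'a) cospace" where
  "Epi_prod X \<equiv> cprod (const_co Epi) (cprod X X)"

lemma cosimplicial_space_Epi_prod:
  assumes "cosimplicial_space X"
  shows "cosimplicial_space (Epi_prod X)"
proof -
  have "simplicial_set Epi"
    unfolding simplicial_set_def
    by (auto simp: Epi_def intro: after_id_map after_assoc_mono dest: mono_mapsD(1))
  then have "cosimplicial_space (const_co Epi)"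
    by (simp add: cosimplicial_space_def const_co_def simplicial_map_id)
  then show ?thesis by (intro cosimplicial_space_cprod assms)
qed

lemma Epi_square_simps:
  "cells (lev (Epi_square X) p) q = pi_orbit ` cells (lev (Epi_prod X) p) q"
  "sop (lev (Epi_square X) p) q \<theta> = image (sop (lev (Epi_prod X) p) q \<theta>)"
  "cop (Epi_square X) n \<theta> q = image (cop (Epi_prod X) n \<theta> q)"
  by (simp_all add: Epi_square_def Let_def del: lev_cprod cop_cprod)

text \<open>The operators commute with the action of the group, so they map orbits to orbits.\<close>

lemma sop_pi_orbit:
  assumes \<theta>: "\<theta> \<in> mono_maps k q" and z: "z \<in> cells (lev (Epi_prod X) p) q"
  shows "sop (lev (Epi_prod X) p) q \<theta> ` pi_orbit z = pi_orbit (sop (lev (Epi_prod X) p) q \<theta> z)"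
proof -
  obtain g x x' where z': "z = (g, x, x')" "length g = Suc q" using z by (auto simp: const_co_def Epi_def)
  have "after (map ((\<noteq>) b) g) \<theta> = map ((\<noteq>) b) (after g \<theta>)" for b
    using mono_mapsD(2)[OF \<theta>] z'(2) by (auto simp: after_def less_Suc_eq_le)
  then have "sop (lev (Epi_prod X) p) q \<theta> (pi_act b z) = pi_act b (sop (lev (Epi_prod X) p) q \<theta> z)" for b
    by (simp add: z'(1) pi_act_def const_co_def Epi_def)
  then show ?thesis unfolding pi_orbit_def image_image by simp
qed

lemma cop_pi_orbit: "cop (Epi_prod X) n \<theta> q ` pi_orbit z = pi_orbit (cop (Epi_prod X) n \<theta> q z)"
proof -
  have "cop (Epi_prod X) n \<theta> q (pi_act b z) = pi_act b (cop (Epi_prod X) n \<theta> q z)" for b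
    by (cases z) (simp add: pi_act_def const_co_def)
  then show ?thesis unfolding pi_orbit_def image_image by simp
qed

lemma cosimplicial_space_Epi_square:
  assumes "cosimplicial_space X"
  shows "cosimplicial_space (Epi_square X)"
proof -
  note W = cosimplicial_space_Epi_prod[OF assms]
  have s: "simplicial_set (lev (Epi_square X) p)" for p
    unfolding simplicial_set_def Epi_square_simps ball_simps(9)
  proof (intro conjI allI ballI)
    let ?W = "lev (Epi_prod X) p"
    note S = cosimplicial_spaceD(1)[OF W, of p]
    fix n z assume z: "z \<in> cells ?W n"
    show "sop ?W n (id_map n) ` pi_orbit z = pi_orbit z"
      unfolding sop_pi_orbit[OF id_map_in_mono_maps z] simplicial_setD(2)[OF S z] ..
    fix m \<theta> assume \<theta>: "\<theta> \<in> mono_maps m n"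
    note \<theta>z = simplicial_setD(1)[OF S \<theta> z]
    show "sop ?W n \<theta> ` pi_orbit z \<in> pi_orbit ` cells ?W m"
      unfolding sop_pi_orbit[OF \<theta> z] by (rule imageI) (rule \<theta>z)
    fix l \<eta> assume \<eta>: "\<eta> \<in> mono_maps l m"
    show "sop ?W m \<eta> ` sop ?W n \<theta> ` pi_orbit z = sop ?W n (after \<theta> \<eta>) ` pi_orbit z"
      unfolding sop_pi_orbit[OF \<theta> z] sop_pi_orbit[OF \<eta> \<theta>z] sop_pi_orbit[OF after_in_mono_maps[OF \<theta> \<eta>] z]
        simplicial_setD(3)[OF S \<theta> \<eta> z] ..
  qed
  show ?thesis
    unfolding cosimplicial_space_def
  proof (intro conjI allI ballI s)
    fix m n \<theta> assume \<theta>: "\<theta> \<in> mono_maps m n"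
    note M = cosimplicial_spaceD(2)[OF W \<theta>]
    show "simplicial_map (lev (Epi_square X) m) (lev (Epi_square X) n) (cop (Epi_square X) n \<theta>)"
      unfolding simplicial_map_def Epi_square_simps ball_simps(9)
    proof (intro conjI allI ballI)
      fix q z assume z: "z \<in> cells (lev (Epi_prod X) m) q"
      note Mz = simplicial_mapD(1)[OF M z]
      show "cop (Epi_prod X) n \<theta> q ` pi_orbit z \<in> pi_orbit ` cells (lev (Epi_prod X) n) q"
        unfolding cop_pi_orbit by (rule imageI) (rule Mz)
      fix k \<eta> assume \<eta>: "\<eta> \<in> mono_maps k q"
      show "cop (Epi_prod X) n \<theta> k ` sop (lev (Epi_prod X) m) q \<eta> ` pi_orbit z =
          sop (lev (Epi_prod X) n) q \<eta> ` cop (Epi_prod X) n \<theta> q ` pi_orbit z"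
        unfolding cop_pi_orbit sop_pi_orbit[OF \<eta> z] sop_pi_orbit[OF \<eta> Mz] simplicial_mapD(2)[OF M \<eta> z] ..
    qed
  next
    fix n q x assume "x \<in> cells (lev (Epi_square X) n) q"
    then obtain z where "z \<in> cells (lev (Epi_prod X) n) q" "x = pi_orbit z" unfolding Epi_square_simps by blast
    then show "cop (Epi_square X) n (id_map n) q x = x"
      unfolding Epi_square_simps using cosimplicial_spaceD(3)[OF W] by (simp only: cop_pi_orbit)
  next
    fix l m n q \<theta> \<eta> x assume "\<theta> \<in> mono_maps m n" "\<eta> \<in> mono_maps l m" "x \<in> cells (lev (Epi_square X) l) q"
    then obtain z where "z \<in> cells (lev (Epi_prod X) l) q" "x = pi_orbit z" unfolding Epi_square_simps by blast
    then show "cop (Epi_square X) n \<theta> q (cop (Epi_square X) m \<eta> q x) = cop (Epi_square X) n (after \<theta> \<eta>) q x"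
      unfolding Epi_square_simps using cosimplicial_spaceD(4)[OF W \<open>\<theta> \<in> mono_maps m n\<close> \<open>\<eta> \<in> mono_maps l m\<close>]
      by (simp only: cop_pi_orbit)
  qed
qed

lemma cosimplicial_map_Epi_incl:
  "cosimplicial_map (cprod X X) (Epi_square X) Epi_incl"
  unfolding cosimplicial_map_def simplicial_map_def Epi_square_simps
proof (intro conjI allI ballI)
  show "Epi_incl p q x \<in> pi_orbit ` cells (lev (Epi_prod X) p) q" if "x \<in> cells (lev (cprod X X) p) q" for p q x
    using that by (cases x) (auto simp: Epi_incl_def Epi_base_def const_co_def Epi_def intro!: imageI)
next
  fix p k q \<theta> x assume \<theta>: "\<theta> \<in> mono_maps k q" and x: "x \<in> cells (lev (cprod X X) p) q"
  have "after (Epi_base q) \<theta> = map (\<lambda>_. False) \<theta>"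
    unfolding after_def using mono_mapsD(2)[OF \<theta>]
    by (intro map_cong refl) (auto simp: Epi_base_def subset_iff less_Suc_eq_le simp del: replicate_Suc)
  then have "after (Epi_base q) \<theta> = Epi_base k"
    by (simp add: Epi_base_def map_replicate_const mono_mapsD(1)[OF \<theta>])
  moreover have "(Epi_base q, x) \<in> cells (lev (Epi_prod X) p) q"
    using x by (simp add: const_co_def Epi_def Epi_base_def)
  ultimately show "Epi_incl p k (sop (lev (cprod X X) p) q \<theta> x) = sop (lev (Epi_prod X) p) q \<theta> ` Epi_incl p q x"
    using sop_pi_orbit[OF \<theta>, of "(Epi_base q, x)" X p]
    by (cases x) (simp add: Epi_incl_def const_co_def Epi_def)
next
  fix m n q \<theta> x assume "\<theta> \<in> mono_maps m n" "x \<in> cells (lev (cprod X X) m) q"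
  show "Epi_incl n q (cop (cprod X X) n \<theta> q x) = cop (Epi_prod X) n \<theta> q ` Epi_incl m q x"
    using cop_pi_orbit[of X n \<theta> q "(Epi_base q, x)"]
    by (cases x) (simp add: Epi_incl_def const_co_def)
qed

theorem theorem4p8:
  fixes X :: "'a cospace" and s s' :: nat and m m' :: int
  assumes "cosimplicial_space X"
  shows
    "commuting_square
       (tensor (gr_HTot X (int s) m) (gr_HTot X (int s') m'))
       (tensor (E_inf (S_co X) (int s) (m + int s)) (E_inf (S_co X) (int s') (m' + int s')))
       (gr_HTot (cprod X X) (int s + int s') (m + m'))
       (E_inf (S_co (cprod X X)) (int s + int s') ((m + int s) + (m' + int s')))
       (tensor_map (abut X (int s) m) (abut X (int s') m'))
       (tensor_lift (HTot_mult X X m m'))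
       (tensor_lift (TC_mult X X m m'))
       (abut (cprod X X) (int s + int s') (m + m'))
     \<and>
     commuting_square
       (gr_HTot (cprod X X) (int s + int s') (m + m'))
       (E_inf (S_co (cprod X X)) (int s + int s') ((m + int s) + (m' + int s')))
       (gr_HTot (Epi_square X) (int s + int s') (m + m'))
       (E_inf (S_co (Epi_square X)) (int s + int s') ((m + int s) + (m' + int s')))
       (abut (cprod X X) (int s + int s') (m + m'))
       (kmap (Tot_map Epi_incl (nat (m + m'))))
       (TC_map Epi_incl (m + m'))
       (abut (Epi_square X) (int s + int s') (m + m'))"
proof -
  have deg: "(m + int s) + (m' + int s') = m + m' + (int s + int s')" by simp
  show ?thesis
    unfolding deg
    by (intro conjI abut_multiplicative abut_natural cosimplicial_space_cprod cosimplicial_space_Epi_square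
        cosimplicial_map_Epi_incl assms)
qed

end
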